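(* For every natural number $n$ there exists a compactly generated elementary group $G$ whose decomposition rank is $\xi(G)=\omega^n+2$.
   Context: All groups are totally disconnected, locally compact, second countable (t.d.l.c.s.c.) topological groups. A topological group is compactly generated if it is generated (as an abstract group) by a compact subset. The class $\mathcal{E}$ of elementary groups is the smallest class of t.d.l.c.s.c. groups such that: (i) $\mathcal{E}$ contains all second countable profinite groups and all countable discrete groups; (ii) $\mathcal{E}$ is closed under group extensions (if $N$ is a closed normal subgroup of a t.d.l.c.s.c. group $H$ with $N\in\mathcal{E}$ and $H/N\in\mathcal{E}$ then $H\in\mathcal{E}$); (iii) $\mathcal{E}$ is closed under closed subgroups; (iv) $\mathcal{E}$ is closed under quotients by closed normal subgroups; (v) if a t.d.l.c.s.c. group $G$ is the union of an increasing sequence of open subgroups $O_i\in\mathcal{E}$, $i\in\mathbb{N}$, then $G\in\mathcal{E}$. The discrete residual $\mathrm{Res}(G)$ is the intersection of all open normal subgroups of $G$. The decomposition rank $\xi:\mathcal{E}\to[1,\omega_1)$ is the (well-defined) ordinal-valued function with: (i) $\xi(\{1\})=1$; (ii) if $G$ is non-trivial and compactly generated, $\xi(G)=\xi(\mathrm{Res}(G))+1$; (iii) if $G$ is non-trivial and $(O_i)_{i\in\mathbb{N}}$ is any increasing sequence of compactly generated open subgroups with union $G$, then $\xi(G)=\sup_{i}\xi(\mathrm{Res}(O_i))+1$ (such sequences always exist and the value does not depend on the choice). *)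

theory Defs
  imports "HOL-Analysis.Analysis" "HOL-Algebra.Generated_Groups" "HOL-Library.Countable_Set_Type"
begin

section \<open>The ordinals below the first uncountable ordinal\<close>

text \<open>The cardinal successor of \<open>natLeq\<close> is a well-order of type \<open>\<omega>\<^sub>1\<close>, so its elements,
  ordered by it, are the countable ordinals.\<close>

typedef countable_ord = "Field (cardSuc natLeq)"
proof -
  have "Field (cardSuc natLeq) \<noteq> {}"
    using cardSuc_finite[OF natLeq_Card_order] by (metis Field_natLeq finite.emptyI infinite_UNIV_nat)
  then show ?thesis by blast
qed

lemma Well_order_cardSuc_natLeq: "Well_order (cardSuc natLeq)"
  using cardSuc_Card_order[OF natLeq_Card_order] by (simp add: card_order_on_def)

instantiation countable_ord :: linorder
begin

definition less_eq_countable_ord :: "countable_ord \<Rightarrow> countable_ord \<Rightarrow> bool" where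
  "\<alpha> \<le> \<beta> \<longleftrightarrow> (Rep_countable_ord \<alpha>, Rep_countable_ord \<beta>) \<in> cardSuc natLeq"

definition less_countable_ord :: "countable_ord \<Rightarrow> countable_ord \<Rightarrow> bool" where
  "(\<alpha> :: countable_ord) < \<beta> \<longleftrightarrow> \<alpha> \<le> \<beta> \<and> \<alpha> \<noteq> \<beta>"

instance
proof
  have lin: "Linear_order (cardSuc natLeq)"
    using Well_order_cardSuc_natLeq by (simp add: well_order_on_def)
  then have R: "refl_on (Field (cardSuc natLeq)) (cardSuc natLeq)"
    and T: "trans (cardSuc natLeq)" and A: "antisym (cardSuc natLeq)"
    and L: "total_on (Field (cardSuc natLeq)) (cardSuc natLeq)"
    by (auto simp: order_on_defs)
  fix x y z :: countable_ord
  show xx: "x \<le> x"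
    unfolding less_eq_countable_ord_def using R Rep_countable_ord by (auto simp: refl_on_def)
  show "x \<le> y \<Longrightarrow> y \<le> z \<Longrightarrow> x \<le> z"
    unfolding less_eq_countable_ord_def using T by (auto dest: transD)
  show anti: "x \<le> y \<Longrightarrow> y \<le> x \<Longrightarrow> x = y"
    unfolding less_eq_countable_ord_def using A by (auto dest: antisymD simp: Rep_countable_ord_inject)
  show "x < y \<longleftrightarrow> x \<le> y \<and> \<not> y \<le> x"
    unfolding less_countable_ord_def using anti xx by blast
  show "x \<le> y \<or> y \<le> x"
    unfolding less_eq_countable_ord_def using L R Rep_countable_ord[of x] Rep_countable_ord[of y]
    by (cases "Rep_countable_ord x = Rep_countable_ord y") (auto simp: total_on_def refl_on_def)
qed

end

instance countable_ord :: wellorder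
proof (rule wf_wellorderI)
  have "{(x, y :: countable_ord). x < y}
      = inv_image (cardSuc natLeq - Id) Rep_countable_ord"
    by (auto simp: inv_image_def less_countable_ord_def less_eq_countable_ord_def
        Rep_countable_ord_inject)
  then show "wf {(x, y :: countable_ord). x < y}"
    using Well_order_cardSuc_natLeq by (simp add: well_order_on_def)
  show "OFCLASS(countable_ord, linorder_class)" ..
qed

lemma countable_atMost_countable_ord:
  includes cardinal_syntax
  shows "countable {..\<alpha> :: countable_ord}"
proof -
  let ?r = "cardSuc natLeq"
  let ?a = "Rep_countable_ord \<alpha>"
  have a: "?a \<in> Field ?r" by (rule Rep_countable_ord)
  have "|underS ?r ?a| <o ?r"
    by (rule card_of_underS[OF cardSuc_Card_order[OF natLeq_Card_order] a])
  then have "|underS ?r ?a| \<le>o natLeq"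
    using cardSuc_ordLeq_ordLess[OF natLeq_Card_order card_of_Card_order] by blast
  then have c: "countable (underS ?r ?a)"
    by (simp add: countable_card_le_natLeq)
  have "Rep_countable_ord ` {..\<alpha>} \<subseteq> insert ?a (underS ?r ?a)"
    by (auto simp: underS_def less_eq_countable_ord_def)
  then have "countable (Rep_countable_ord ` {..\<alpha>})"
    using c by (meson countable_insert countable_subset)
  then show ?thesis
    by (rule countable_image_inj_on) (auto simp: inj_on_def Rep_countable_ord_inject)
qed

lemma uncountable_UNIV_countable_ord:
  includes cardinal_syntax
  shows "uncountable (UNIV :: countable_ord set)"
proof
  assume "countable (UNIV :: countable_ord set)"
  then have "countable (range Rep_countable_ord)" by (rule countable_image)
  moreover have "range Rep_countable_ord = Field (cardSuc natLeq)"
    using Rep_countable_ord Abs_countable_ord_inverse by (metis rangeI subsetI subset_antisym image_subsetI)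
  ultimately have "|Field (cardSuc natLeq)| \<le>o natLeq"
    by (simp add: countable_card_le_natLeq)
  moreover have "|Field (cardSuc natLeq)| =o cardSuc natLeq"
    by (rule card_of_Field_ordIso[OF cardSuc_Card_order[OF natLeq_Card_order]])
  moreover have "natLeq <o cardSuc natLeq"
    by (rule cardSuc_greater[OF natLeq_Card_order])
  ultimately show False
    using not_ordLess_ordLeq ordIso_ordLeq_trans ordIso_symmetric by blast
qed

lemma countable_imp_strictly_bounded:
  assumes "countable (A :: countable_ord set)"
  shows "\<exists>\<gamma>. \<forall>\<alpha>\<in>A. \<alpha> < \<gamma>"
proof (rule ccontr)
  assume "\<not> ?thesis"
  then have "UNIV = (\<Union>\<alpha>\<in>A. {..\<alpha>})" by (auto simp: not_less)
  moreover have "countable (\<Union>\<alpha>\<in>A. {..\<alpha>})"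
    using assms countable_atMost_countable_ord by blast
  ultimately show False using uncountable_UNIV_countable_ord by simp
qed

definition osup :: "countable_ord set \<Rightarrow> countable_ord" where
  "osup A = (LEAST \<gamma>. \<forall>\<alpha>\<in>A. \<alpha> \<le> \<gamma>)"

lemma osup_le_iff:
  assumes "countable A" shows "osup A \<le> \<beta> \<longleftrightarrow> (\<forall>\<alpha>\<in>A. \<alpha> \<le> \<beta>)"
proof -
  obtain \<gamma> where "\<forall>\<alpha>\<in>A. \<alpha> < \<gamma>" using countable_imp_strictly_bounded[OF assms] by blast
  then have "\<forall>\<alpha>\<in>A. \<alpha> \<le> \<gamma>" by auto
  then have "\<forall>\<alpha>\<in>A. \<alpha> \<le> osup A" unfolding osup_def by (rule LeastI)
  moreover have "osup A \<le> \<beta>" if "\<forall>\<alpha>\<in>A. \<alpha> \<le> \<beta>"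
    unfolding osup_def using that by (rule Least_le)
  ultimately show ?thesis by (meson order_trans)
qed

definition osuc :: "countable_ord \<Rightarrow> countable_ord" where
  "osuc \<alpha> = (LEAST \<gamma>. \<alpha> < \<gamma>)"

lemma osuc_le_iff: "osuc \<alpha> \<le> \<beta> \<longleftrightarrow> \<alpha> < \<beta>"
proof -
  obtain \<gamma> where "\<alpha> < \<gamma>" using countable_imp_strictly_bounded[of "{\<alpha>}"] by auto
  then have "\<alpha> < osuc \<alpha>" unfolding osuc_def by (rule LeastI)
  moreover have "osuc \<alpha> \<le> \<beta>" if "\<alpha> < \<beta>"
    unfolding osuc_def using that by (rule Least_le)
  ultimately show ?thesis by (meson order_less_le_trans)
qed

text \<open>Ordinal arithmetic, by transfinite recursion on the right argument:
  \<open>\<alpha> + \<beta> = sup ({\<alpha>} \<union> {(\<alpha> + \<beta>') + 1 | \<beta>' < \<beta>})\<close> and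
  \<open>\<alpha> \<cdot> \<beta> = sup {\<alpha> \<cdot> \<beta>' + \<alpha> | \<beta>' < \<beta>}\<close>.\<close>

function oadd :: "countable_ord \<Rightarrow> countable_ord \<Rightarrow> countable_ord" where
  "oadd \<alpha> \<beta> = osup (insert \<alpha> ((\<lambda>\<beta>'. osuc (oadd \<alpha> \<beta>')) ` {..<\<beta>}))"
  by auto
termination by (relation "inv_image {(x, y). x < y} snd") (auto simp: wf)
declare oadd.simps [simp del]

function omult :: "countable_ord \<Rightarrow> countable_ord \<Rightarrow> countable_ord" where
  "omult \<alpha> \<beta> = osup ((\<lambda>\<beta>'. oadd (omult \<alpha> \<beta>') \<alpha>) ` {..<\<beta>})"
  by auto
termination by (relation "inv_image {(x, y). x < y} snd") (auto simp: wf)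
declare omult.simps [simp del]

lemma countable_lessThan_countable_ord: "countable {..<\<alpha> :: countable_ord}"
  by (rule countable_subset[OF _ countable_atMost_countable_ord[of \<alpha>]]) auto

lemma oadd_le_iff: "oadd \<alpha> \<beta> \<le> \<gamma> \<longleftrightarrow> \<alpha> \<le> \<gamma> \<and> (\<forall>\<beta>'<\<beta>. oadd \<alpha> \<beta>' < \<gamma>)"
  by (subst oadd.simps) (simp add: osup_le_iff osuc_le_iff countable_lessThan_countable_ord Ball_def[of "{..<\<beta>}"])

lemma oadd_ge: "\<alpha> \<le> oadd \<alpha> \<beta>"
  using oadd_le_iff[of \<alpha> \<beta> "oadd \<alpha> \<beta>"] by simp

lemma oadd_strict: "\<beta>' < \<beta> \<Longrightarrow> oadd \<alpha> \<beta>' < oadd \<alpha> \<beta>"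
  using oadd_le_iff[of \<alpha> \<beta> "oadd \<alpha> \<beta>"] by simp

lemma less_oadd_iff: "\<gamma> < oadd \<alpha> \<beta> \<longleftrightarrow> \<gamma> < \<alpha> \<or> (\<exists>\<beta>'<\<beta>. \<gamma> \<le> oadd \<alpha> \<beta>')"
  using oadd_le_iff[of \<alpha> \<beta> \<gamma>] by (meson not_less)

lemma oadd_assoc: "oadd (oadd \<alpha> \<beta>) \<gamma> = oadd \<alpha> (oadd \<beta> \<gamma>)"
proof (induction \<gamma> rule: less_induct)
  case (less \<gamma>)
  have "oadd (oadd \<alpha> \<beta>) \<gamma> \<le> \<delta> \<longleftrightarrow> oadd \<alpha> (oadd \<beta> \<gamma>) \<le> \<delta>" for \<delta>
  proof
    assume L: "oadd (oadd \<alpha> \<beta>) \<gamma> \<le> \<delta>"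
    have "oadd \<alpha> \<epsilon> < \<delta>" if \<epsilon>: "\<epsilon> < oadd \<beta> \<gamma>" for \<epsilon>
    proof -
      consider "\<epsilon> < \<beta>" | \<gamma>' where "\<gamma>' < \<gamma>" "\<epsilon> \<le> oadd \<beta> \<gamma>'"
        using \<epsilon> less_oadd_iff[of \<epsilon> \<beta> \<gamma>] by blast
      then show ?thesis
      proof cases
        case 1
        then show ?thesis using L oadd_strict[OF 1, of \<alpha>] oadd_ge[of "oadd \<alpha> \<beta>" \<gamma>]
          by (meson order_less_le_trans)
      next
        case 2
        then have "oadd \<alpha> \<epsilon> \<le> oadd \<alpha> (oadd \<beta> \<gamma>')"
          by (metis order.order_iff_strict oadd_strict)
        also have "\<dots> = oadd (oadd \<alpha> \<beta>) \<gamma>'" using less.IH[OF 2(1)] by simp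
        also have "\<dots> < \<delta>" using L 2(1) oadd_le_iff[of "oadd \<alpha> \<beta>" \<gamma> \<delta>] by blast
        finally show ?thesis .
      qed
    qed
    moreover have "\<alpha> \<le> \<delta>" using L oadd_ge by (meson order_trans)
    ultimately show "oadd \<alpha> (oadd \<beta> \<gamma>) \<le> \<delta>" using oadd_le_iff[of \<alpha> "oadd \<beta> \<gamma>" \<delta>] by blast
  next
    assume R: "oadd \<alpha> (oadd \<beta> \<gamma>) \<le> \<delta>"
    have "oadd \<alpha> \<beta> \<le> oadd \<alpha> (oadd \<beta> \<gamma>)"
      using oadd_ge[of \<beta> \<gamma>] by (metis order.order_iff_strict oadd_strict)
    then have "oadd \<alpha> \<beta> \<le> \<delta>" using R by simp
    moreover have "oadd (oadd \<alpha> \<beta>) \<gamma>' < \<delta>" if "\<gamma>' < \<gamma>" for \<gamma>'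
      using less.IH[OF that] oadd_strict[OF oadd_strict[OF that]] R
      by (metis order_less_le_trans)
    ultimately show "oadd (oadd \<alpha> \<beta>) \<gamma> \<le> \<delta>" using oadd_le_iff[of "oadd \<alpha> \<beta>" \<gamma> \<delta>] by blast
  qed
  then show ?case by (meson order_antisym order_refl)
qed

instantiation countable_ord :: "{zero, one, plus, times}"
begin

definition "0 = (LEAST \<alpha> :: countable_ord. True)"
definition "1 = osuc (0 :: countable_ord)"
definition "\<alpha> + \<beta> = oadd \<alpha> (\<beta> :: countable_ord)"
definition "\<alpha> * \<beta> = omult \<alpha> (\<beta> :: countable_ord)"

instance ..

end

instance countable_ord :: semigroup_add
  by standard (simp add: plus_countable_ord_def oadd_assoc)

instance countable_ord :: numeral ..

text \<open>Since \<open>\<alpha> ^ Suc n = \<alpha> * \<alpha> ^ n\<close> and ordinal multiplication is associative, this is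
  ordinal exponentiation with finite exponent.\<close>

instance countable_ord :: power ..

lemma zero_le_countable_ord [simp]: "0 \<le> (\<alpha> :: countable_ord)"
  unfolding zero_countable_ord_def by (rule Least_le) simp

lemma add_zero_countable_ord [simp]: "\<alpha> + 0 = (\<alpha> :: countable_ord)"
proof -
  have "oadd \<alpha> 0 \<le> \<alpha>" by (auto simp: oadd_le_iff) (meson not_less zero_le_countable_ord)
  then show ?thesis unfolding plus_countable_ord_def using oadd_ge order_antisym by blast
qed

lemma add_one_countable_ord: "\<alpha> + 1 = osuc \<alpha>"
proof (rule order_antisym)
  have lt: "\<beta> < 1 \<longleftrightarrow> \<beta> = 0" for \<beta> :: countable_ord
    unfolding one_countable_ord_def
    by (metis not_less order_antisym osuc_le_iff zero_le_countable_ord)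
  have "\<alpha> < osuc \<alpha>" using osuc_le_iff by blast
  then show "\<alpha> + 1 \<le> osuc \<alpha>"
    using add_zero_countable_ord[of \<alpha>] unfolding plus_countable_ord_def by (auto simp: oadd_le_iff lt)
  show "osuc \<alpha> \<le> \<alpha> + 1"
    using add_zero_countable_ord[of \<alpha>] unfolding plus_countable_ord_def
    by (metis lt oadd_strict osuc_le_iff)
qed

definition omega_ord :: countable_ord  (\<open>\<omega>\<close>) where
  "\<omega> = (LEAST \<gamma>. 0 < \<gamma> \<and> (\<forall>\<beta><\<gamma>. \<beta> + 1 < \<gamma>))"

section \<open>Totally disconnected locally compact second countable groups\<close>

record 'a topgroup = "'a monoid" +
  topol :: "'a topology"

definition topological_group :: "'a topgroup \<Rightarrow> bool" where
  "topological_group G \<longleftrightarrow>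
     group G \<and> topspace (topol G) = carrier G \<and>
     continuous_map (prod_topology (topol G) (topol G)) (topol G) (\<lambda>(x, y). x \<otimes>\<^bsub>G\<^esub> y) \<and>
     continuous_map (topol G) (topol G) (\<lambda>x. inv\<^bsub>G\<^esub> x)"

definition totally_disconnected_space :: "'a topology \<Rightarrow> bool" where
  "totally_disconnected_space X \<longleftrightarrow> (\<forall>x\<in>topspace X. connected_component_of_set X x = {x})"

definition second_countable_space :: "'a topology \<Rightarrow> bool" where
  "second_countable_space X \<longleftrightarrow>
     (\<exists>\<B>. countable \<B> \<and> (\<forall>B\<in>\<B>. openin X B) \<and>
        (\<forall>U. openin X U \<longrightarrow> (\<exists>\<U>\<subseteq>\<B>. U = \<Union>\<U>)))"

definition tdlcsc_group :: "'a topgroup \<Rightarrow> bool" where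
  "tdlcsc_group G \<longleftrightarrow>
     topological_group G \<and> Hausdorff_space (topol G) \<and> totally_disconnected_space (topol G) \<and>
     locally_compact_space (topol G) \<and> second_countable_space (topol G)"

definition subgrp :: "'a topgroup \<Rightarrow> 'a set \<Rightarrow> 'a topgroup" where
  "subgrp G H = G\<lparr>carrier := H, topol := subtopology (topol G) H\<rparr>"

text \<open>The quotient topology: the finest one making the projection onto the cosets continuous.\<close>

definition quotient_topology :: "'a topgroup \<Rightarrow> 'a set \<Rightarrow> 'a set topology" where
  "quotient_topology G N = topology (\<lambda>\<U>. \<U> \<subseteq> rcosets\<^bsub>G\<^esub> N \<and>
     openin (topol G) {x \<in> carrier G. N #>\<^bsub>G\<^esub> x \<in> \<U>})"

definition quotgrp :: "'a topgroup \<Rightarrow> 'a set \<Rightarrow> 'a set topgroup" where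
  "quotgrp G N = monoid.extend (G Mod N) (topgroup.fields (quotient_topology G N))"

definition topgroup_iso :: "'a topgroup \<Rightarrow> 'b topgroup \<Rightarrow> bool"  (infix \<open>\<cong>\<^sub>t\<close> 50) where
  "G \<cong>\<^sub>t H \<longleftrightarrow> (\<exists>f \<in> iso G H. homeomorphic_map (topol G) (topol H) f)"

definition compactly_generated :: "'a topgroup \<Rightarrow> bool" where
  "compactly_generated G \<longleftrightarrow> (\<exists>K. compactin (topol G) K \<and> generate G K = carrier G)"

definition Res :: "'a topgroup \<Rightarrow> 'a set" where
  "Res G = \<Inter>{N. N \<lhd> G \<and> openin (topol G) N}"

lemma openin_quotient_topology:
  assumes "topological_group G" "N \<lhd> G"
  shows "openin (quotient_topology G N) \<U> \<longleftrightarrow>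
    \<U> \<subseteq> rcosets\<^bsub>G\<^esub> N \<and> openin (topol G) {x \<in> carrier G. N #>\<^bsub>G\<^esub> x \<in> \<U>}"
proof -
  have "istopology (\<lambda>\<U>. \<U> \<subseteq> rcosets\<^bsub>G\<^esub> N \<and> openin (topol G) {x \<in> carrier G. N #>\<^bsub>G\<^esub> x \<in> \<U>})"
    unfolding istopology_def
  proof (intro conjI allI impI)
    fix S T assume *: "S \<subseteq> rcosets\<^bsub>G\<^esub> N \<and> openin (topol G) {x \<in> carrier G. N #>\<^bsub>G\<^esub> x \<in> S}"
      "T \<subseteq> rcosets\<^bsub>G\<^esub> N \<and> openin (topol G) {x \<in> carrier G. N #>\<^bsub>G\<^esub> x \<in> T}"
    have "{x \<in> carrier G. N #>\<^bsub>G\<^esub> x \<in> S \<inter> T}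
        = {x \<in> carrier G. N #>\<^bsub>G\<^esub> x \<in> S} \<inter> {x \<in> carrier G. N #>\<^bsub>G\<^esub> x \<in> T}" by auto
    then show "openin (topol G) {x \<in> carrier G. N #>\<^bsub>G\<^esub> x \<in> S \<inter> T}" using * by auto
    show "S \<inter> T \<subseteq> rcosets\<^bsub>G\<^esub> N" using * by auto
  next
    fix \<K> assume *: "\<forall>K\<in>\<K>. K \<subseteq> rcosets\<^bsub>G\<^esub> N \<and> openin (topol G) {x \<in> carrier G. N #>\<^bsub>G\<^esub> x \<in> K}"
    have "{x \<in> carrier G. N #>\<^bsub>G\<^esub> x \<in> \<Union>\<K>} = (\<Union>K\<in>\<K>. {x \<in> carrier G. N #>\<^bsub>G\<^esub> x \<in> K})" by auto
    then show "openin (topol G) {x \<in> carrier G. N #>\<^bsub>G\<^esub> x \<in> \<Union>\<K>}" using * by auto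
    show "\<Union>\<K> \<subseteq> rcosets\<^bsub>G\<^esub> N" using * by auto
  qed
  then show ?thesis unfolding quotient_topology_def by (simp add: topology_inverse')
qed

lemma quotgrp_simps [simp]:
  "carrier (quotgrp G N) = rcosets\<^bsub>G\<^esub> N"
  "mult (quotgrp G N) = set_mult G"
  "one (quotgrp G N) = N"
  "topol (quotgrp G N) = quotient_topology G N"
  by (simp_all add: quotgrp_def FactGroup_def monoid.defs topgroup.defs)

lemma quotient_map_quotgrp:
  assumes G: "topological_group G" and N: "N \<lhd> G"
  shows "quotient_map (topol G) (topol (quotgrp G N)) (\<lambda>x. N #>\<^bsub>G\<^esub> x)"
proof -
  have ts: "topspace (topol G) = carrier G" using G by (simp add: topological_group_def)
  have "openin (quotient_topology G N) (rcosets\<^bsub>G\<^esub> N)"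
  proof -
    have "{x \<in> carrier G. N #>\<^bsub>G\<^esub> x \<in> rcosets\<^bsub>G\<^esub> N} = topspace (topol G)"
      using ts by (auto simp: RCOSETS_def)
    then show ?thesis by (simp add: openin_quotient_topology[OF G N])
  qed
  then have tq: "topspace (quotient_topology G N) = rcosets\<^bsub>G\<^esub> N"
    by (metis G N openin_quotient_topology openin_subset openin_topspace subset_antisym)
  show ?thesis
    unfolding quotient_map_def by (auto simp: ts tq openin_quotient_topology[OF G N] RCOSETS_def)
qed

section \<open>Elementary groups and the decomposition rank\<close>

text \<open>A second countable Hausdorff space has at most continuum many points, so every
  t.d.l.c.s.c. group has a copy with elements in \<open>nat set\<close> (\<open>tdlcsc_group_universe\<close> below).
  The class of all such groups is therefore represented by those on \<open>nat set\<close>; the quotients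
  occurring in the closure properties are represented by their isomorphic copies on \<open>nat set\<close>.\<close>

lemma tdlcsc_group_universe:
  fixes G :: "'a topgroup"
  assumes "tdlcsc_group G"
  shows "\<exists>H :: nat set topgroup. tdlcsc_group H \<and> G \<cong>\<^sub>t H"
proof -
  let ?X = "topol G" and ?C = "carrier G"
  have tg: "group G" and ts: "topspace ?X = ?C"
    and cm: "continuous_map (prod_topology ?X ?X) ?X (\<lambda>(x, y). x \<otimes>\<^bsub>G\<^esub> y)"
    and ci: "continuous_map ?X ?X (\<lambda>x. inv\<^bsub>G\<^esub> x)"
    and hs: "Hausdorff_space ?X" and td: "totally_disconnected_space ?X"
    and lc: "locally_compact_space ?X" and sc: "second_countable_space ?X"
    using assms by (auto simp: tdlcsc_group_def topological_group_def)
  interpret group G by (rule tg)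
  obtain \<B> where B: "countable \<B>" "\<And>B. B \<in> \<B> \<Longrightarrow> openin ?X B"
    "\<And>U. openin ?X U \<Longrightarrow> \<exists>\<U>\<subseteq>\<B>. U = \<Union>\<U>"
    using sc unfolding second_countable_space_def by meson
  define f where "f x = {n. x \<in> from_nat_into \<B> n}" for x
  have inj: "inj_on f ?C"
  proof (rule inj_onI, rule ccontr)
    fix x y assume *: "x \<in> ?C" "y \<in> ?C" "f x = f y" "x \<noteq> y"
    then obtain U V where U: "openin ?X U" "openin ?X V" "x \<in> U" "y \<in> V" "disjnt U V"
      using hs ts unfolding Hausdorff_space_def by metis
    then obtain b where b: "b \<in> \<B>" "x \<in> b" "b \<subseteq> U" using B(3)[of U] by blast
    then obtain n where "from_nat_into \<B> n = b"
      using B(1) by (metis from_nat_into_surj)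
    then have "n \<in> f x" "n \<notin> f y" using b U by (auto simp: f_def disjnt_iff)
    then show False using * by simp
  qed
  define g where "g = inv_into ?C f"
  have gf [simp]: "g (f x) = x" if "x \<in> ?C" for x
    using that inj by (simp add: g_def)
  define D where "D = f ` ?C"
  have fD [simp]: "f x \<in> D" if "x \<in> ?C" for x using that by (simp add: D_def)
  have gC [simp]: "g y \<in> ?C" and fg [simp]: "f (g y) = y" if "y \<in> D" for y
    using that by (auto simp: D_def)
  define H where "H = \<lparr>carrier = D, mult = (\<lambda>x y. f (g x \<otimes>\<^bsub>G\<^esub> g y)), one = f \<one>\<^bsub>G\<^esub>,
    topol = pullback_topology D g ?X\<rparr>"
  let ?Y = "topol H"
  have H [simp]: "carrier H = D" "\<And>x y. x \<otimes>\<^bsub>H\<^esub> y = f (g x \<otimes>\<^bsub>G\<^esub> g y)" "\<one>\<^bsub>H\<^esub> = f \<one>\<^bsub>G\<^esub>"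
    by (simp_all add: H_def)
  have topH: "?Y = pullback_topology D g ?X" by (simp add: H_def)
  have tsH: "topspace ?Y = D"
    unfolding topH topspace_pullback_topology using ts by auto
  have cg: "continuous_map ?Y ?X g"
    using continuous_map_pullback[OF continuous_map_id, of D g ?X] by (simp add: topH)
  have cf: "continuous_map ?X ?Y f"
    unfolding topH
  proof (rule continuous_map_pullback')
    show "continuous_map ?X ?X (g \<circ> f)"
      by (rule continuous_map_eq[OF continuous_map_id]) (simp add: ts)
    show "topspace ?X \<subseteq> f -` D" using ts by auto
  qed
  have hm: "homeomorphic_maps ?X ?Y f g"
    unfolding homeomorphic_maps_def using cf cg by (simp add: ts tsH)
  then have hf: "homeomorphic_map ?X ?Y f" and hg: "homeomorphic_map ?Y ?X g"
    using homeomorphic_maps_map by blast+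
  have hsp: "?X homeomorphic_space ?Y" using hm homeomorphic_space_def by blast
  have gH: "group H"
  proof (rule groupI)
    fix x assume "x \<in> carrier H"
    then show "\<exists>y\<in>carrier H. y \<otimes>\<^bsub>H\<^esub> x = \<one>\<^bsub>H\<^esub>"
      by (intro bexI[of _ "f (inv\<^bsub>G\<^esub> (g x))"]) auto
  qed (auto simp: m_assoc)
  have invH: "inv\<^bsub>H\<^esub> x = f (inv\<^bsub>G\<^esub> (g x))" if "x \<in> D" for x
    using that by (intro group.inv_equality[OF gH]) auto
  have tgH: "topological_group H"
    unfolding topological_group_def
  proof (intro conjI gH)
    show "topspace ?Y = carrier H" by (simp add: tsH)
    have "continuous_map (prod_topology ?Y ?Y) ?X ((\<lambda>(x, y). x \<otimes>\<^bsub>G\<^esub> y) \<circ> (\<lambda>(x, y). (g x, g y)))"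
      using cg by (intro continuous_map_compose[OF _ cm]) (simp add: continuous_map_prod_top)
    then have "continuous_map (prod_topology ?Y ?Y) ?Y
        (f \<circ> ((\<lambda>(x, y). x \<otimes>\<^bsub>G\<^esub> y) \<circ> (\<lambda>(x, y). (g x, g y))))"
      by (rule continuous_map_compose[OF _ cf])
    then show "continuous_map (prod_topology ?Y ?Y) ?Y (\<lambda>(x, y). x \<otimes>\<^bsub>H\<^esub> y)"
      by (rule continuous_map_eq) auto
    have "continuous_map ?Y ?Y (f \<circ> ((\<lambda>x. inv\<^bsub>G\<^esub> x) \<circ> g))"
      by (intro continuous_map_compose[OF _ cf] continuous_map_compose[OF cg ci])
    then show "continuous_map ?Y ?Y (\<lambda>x. inv\<^bsub>H\<^esub> x)"
      by (rule continuous_map_eq) (simp add: tsH invH)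
  qed
  have "totally_disconnected_space ?Y"
    unfolding totally_disconnected_space_def
  proof
    fix y assume y: "y \<in> topspace ?Y"
    let ?S = "connected_component_of_set ?Y y"
    have S: "connectedin ?Y ?S" "y \<in> ?S"
      using y by (simp_all add: connectedin_connected_component_of connected_component_of_refl)
    then have "connectedin ?X (g ` ?S)"
      using connectedin_continuous_map_image[OF cg] by blast
    then have "g ` ?S \<subseteq> connected_component_of_set ?X (g y)"
      using S(2) by (intro connected_component_of_maximal) auto
    also have "\<dots> = {g y}" using td y tsH ts by (simp add: totally_disconnected_space_def)
    finally have "g ` ?S \<subseteq> {g y}" .
    moreover have "?S \<subseteq> D" using S(1) connectedin_subset_topspace tsH by fastforce
    ultimately have "z = y" if "z \<in> ?S" for z
      using that y tsH by (metis fg image_subset_iff singletonD subsetD)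
    then show "?S = {y}" using S(2) by blast
  qed
  moreover have "second_countable_space ?Y"
    unfolding second_countable_space_def
  proof (rule exI[of _ "(\<lambda>B. g -` B \<inter> D) ` \<B>"], intro conjI allI impI ballI)
    show "countable ((\<lambda>B. g -` B \<inter> D) ` \<B>)" using B(1) by simp
    show "openin ?Y b" if "b \<in> (\<lambda>B. g -` B \<inter> D) ` \<B>" for b
      using that B(2) by (auto simp: topH openin_pullback_topology)
    fix U assume "openin ?Y U"
    then obtain V where V: "openin ?X V" "U = g -` V \<inter> D"
      by (auto simp: topH openin_pullback_topology)
    then obtain \<U> where "\<U> \<subseteq> \<B>" "V = \<Union>\<U>" using B(3) by meson
    then show "\<exists>\<U>\<subseteq>(\<lambda>B. g -` B \<inter> D) ` \<B>. U = \<Union>\<U>"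
      using V by (intro exI[of _ "(\<lambda>B. g -` B \<inter> D) ` \<U>"]) auto
  qed
  moreover have "Hausdorff_space ?Y" "locally_compact_space ?Y"
    using hs lc hsp homeomorphic_Hausdorff_space homeomorphic_locally_compact_space by blast+
  ultimately have "tdlcsc_group H" using tgH by (simp add: tdlcsc_group_def)
  moreover have "f \<in> iso G H"
    using inj by (auto simp: iso_def hom_def bij_betw_def D_def)
  ultimately show ?thesis using hf by (auto simp: topgroup_iso_def)
qed

text \<open>In the first rule, a profinite group is a compact totally disconnected Hausdorff group.\<close>

inductive elementary :: "nat set topgroup \<Rightarrow> bool" where
  profinite: "tdlcsc_group G \<Longrightarrow> compact_space (topol G) \<Longrightarrow> elementary G"
| discrete: "tdlcsc_group G \<Longrightarrow> countable (carrier G) \<Longrightarrow>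
    topol G = discrete_topology (carrier G) \<Longrightarrow> elementary G"
| extension: "tdlcsc_group H \<Longrightarrow> N \<lhd> H \<Longrightarrow> closedin (topol H) N \<Longrightarrow>
    elementary (subgrp H N) \<Longrightarrow> elementary Q \<Longrightarrow> quotgrp H N \<cong>\<^sub>t Q \<Longrightarrow> elementary H"
| subgroup: "elementary G \<Longrightarrow> subgroup H G \<Longrightarrow> closedin (topol G) H \<Longrightarrow> elementary (subgrp G H)"
| quotient: "elementary G \<Longrightarrow> N \<lhd> G \<Longrightarrow> closedin (topol G) N \<Longrightarrow>
    tdlcsc_group Q \<Longrightarrow> quotgrp G N \<cong>\<^sub>t Q \<Longrightarrow> elementary Q"
| increasing_union: "tdlcsc_group G \<Longrightarrow> (\<And>i. subgroup (U i) G) \<Longrightarrow>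
    (\<And>i. openin (topol G) (U i)) \<Longrightarrow> (\<And>i. U i \<subseteq> U (Suc i)) \<Longrightarrow>
    (\<Union>i::nat. U i) = carrier G \<Longrightarrow> (\<And>i. elementary (subgrp G (U i))) \<Longrightarrow> elementary G"

text \<open>The decomposition rank is given by transfinite recursion: \<open>has_rank\<close> is the graph generated
  by its defining clauses, one value for each admissible sequence of subgroups. As the rank does
  not depend on that sequence, \<open>\<xi>\<close> picks the unique value. The subgroup
  \<open>Res (U i)\<close> of \<open>U i\<close> is taken with respect to the topological group \<open>subgrp G (U i)\<close>.\<close>

inductive has_rank :: "nat set topgroup \<Rightarrow> countable_ord \<Rightarrow> bool" where
  trivial: "elementary G \<Longrightarrow> carrier G = {\<one>\<^bsub>G\<^esub>} \<Longrightarrow> has_rank G 1"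
| comp_gen: "elementary G \<Longrightarrow> carrier G \<noteq> {\<one>\<^bsub>G\<^esub>} \<Longrightarrow> compactly_generated G \<Longrightarrow>
    has_rank (subgrp G (Res G)) \<alpha> \<Longrightarrow> has_rank G (\<alpha> + 1)"
| increasing_union: "elementary G \<Longrightarrow> carrier G \<noteq> {\<one>\<^bsub>G\<^esub>} \<Longrightarrow>
    (\<And>i. subgroup (U i) G) \<Longrightarrow> (\<And>i. openin (topol G) (U i)) \<Longrightarrow>
    (\<And>i. compactly_generated (subgrp G (U i))) \<Longrightarrow> (\<And>i. U i \<subseteq> U (Suc i)) \<Longrightarrow>
    (\<Union>i::nat. U i) = carrier G \<Longrightarrow>
    (\<And>i. has_rank (subgrp G (Res (subgrp G (U i)))) (\<alpha> i)) \<Longrightarrow>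
    has_rank G (osup (range \<alpha>) + 1)"

definition decomposition_rank :: "nat set topgroup \<Rightarrow> countable_ord"  (\<open>\<xi>\<close>) where
  "\<xi> G = (THE \<alpha>. has_rank G \<alpha>)"

end

(* Only a lower bound on ranks is needed: if a group in the class E has a rank of at least
   alpha + 2, then well-founded descent along the residuals of its compactly generated open
   subgroups meets a compactly generated group of rank exactly alpha + 2.

   Large ranks come from a generalised wreath product. Let G be a transitive closed permutation group
   on nat with compact open point stabiliser, and let D be the affine symmetric group on three letters.
   D acts on the integers and preserves the order generated by i < i + 3, which splits into three
   chains. Let W consist of the permutations of the finitely supported functions from the integers to
   nat that are triangular with respect to this order, up to a translation of levels by an element of
   D, have local actions in G, and have all but finitely many local actions in the point stabiliser.
   W is compactly generated since D is finitely generated and transitive on the levels. Along a chain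
   of levels W contains finite iterated wreath products of G of all lengths, and the discrete residual
   of such a product contains all but the top level and the residual on the top level. So if G has rank
   at least alpha, then W has rank at least the supremum of the alpha * k, which is alpha * omega. W acts
   on the cosets of a compact open subgroup as a group of the same kind as G, and the construction can be
   iterated, starting from D itself. *)

theory Submission
  imports Defs "HOL-Library.Poly_Mapping"
begin

section \<open>Arithmetic of countable ordinals\<close>

text \<open>Normal generation of the whole group by the point stabiliser is the invariant that the
  iteration must preserve: without it the residual of a wreath product could miss the lower levels.
  The group permuting the levels therefore has to be infinite, transitive, compatible with an order
  on the levels, and generated as a normal subgroup by a finite subgroup. Translations of the
  totally ordered integers fail the last condition, being torsion-free; this forces a merely partial
  order and a group of reflections. On two letters the affine group is infinite dihedral and its two
  generating reflections are not conjugate; on three letters the braid relation makes them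
  conjugate.

  The other obstacle is that a rank must exist before it can be bounded below. No upper bound is
  computed. Membership in the class E and well-foundedness of the passage to residuals are proved
  side by side, by resolving W into split extensions and increasing unions of copies of G, D and
  compact groups. The sections are continuous, so each quotient topology is identified
  directly.\<close>

lemma add_le_iff_countable_ord:
  "(\<alpha>::countable_ord) + \<beta> \<le> \<gamma> \<longleftrightarrow> \<alpha> \<le> \<gamma> \<and> (\<forall>\<beta>'<\<beta>. \<alpha> + \<beta>' < \<gamma>)"
  by (simp add: plus_countable_ord_def oadd_le_iff)

lemma add_less_cancel_countable_ord: "\<beta> < \<gamma> \<Longrightarrow> (\<alpha>::countable_ord) + \<beta> < \<alpha> + \<gamma>"
  by (simp add: plus_countable_ord_def oadd_strict)

lemma add_right_mono_countable_ord: "\<beta> \<le> \<gamma> \<Longrightarrow> (\<alpha>::countable_ord) + \<beta> \<le> \<alpha> + \<gamma>"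
  by (metis add_less_cancel_countable_ord order_le_less)

lemma add_left_mono_countable_ord:
  assumes "(\<alpha>::countable_ord) \<le> \<beta>" shows "\<alpha> + \<gamma> \<le> \<beta> + \<gamma>"
proof (induction \<gamma> rule: less_induct)
  case (less \<gamma>)
  have "\<alpha> \<le> \<beta> + \<gamma>"
    using assms oadd_ge[of \<beta> \<gamma>] by (simp add: plus_countable_ord_def)
  moreover have "\<alpha> + \<gamma>' < \<beta> + \<gamma>" if "\<gamma>' < \<gamma>" for \<gamma>'
    using less.IH[OF that] add_less_cancel_countable_ord[OF that] by (rule order_le_less_trans)
  ultimately show ?case by (simp add: add_le_iff_countable_ord)
qed

lemma le_add_countable_ord: "(\<alpha>::countable_ord) \<le> \<alpha> + \<beta>"
  by (simp add: plus_countable_ord_def oadd_ge)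

lemma le_add_left_countable_ord: "(\<alpha>::countable_ord) \<le> \<beta> + \<alpha>"
proof (induction \<alpha> rule: less_induct)
  case (less \<alpha>)
  show ?case
  proof (rule ccontr)
    assume "\<not> ?thesis"
    then have "\<beta> + \<alpha> < \<alpha>" by simp
    then show False
      using less.IH[of "\<beta> + \<alpha>"] add_less_cancel_countable_ord[of "\<beta> + \<alpha>" \<alpha> \<beta>] by simp
  qed
qed

lemma add_one_le_iff: "(\<alpha>::countable_ord) + 1 \<le> \<beta> \<longleftrightarrow> \<alpha> < \<beta>"
  by (simp add: add_one_countable_ord osuc_le_iff)

lemma less_add_one_iff: "(\<alpha>::countable_ord) < \<beta> + 1 \<longleftrightarrow> \<alpha> \<le> \<beta>"
  by (meson add_one_le_iff not_less)

lemma one_le_iff_countable_ord: "(1::countable_ord) \<le> \<alpha> \<longleftrightarrow> 0 < \<alpha>"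
  by (simp add: one_countable_ord_def osuc_le_iff)

lemma add_one_eq_iff: "(\<alpha>::countable_ord) + 1 = \<beta> + 1 \<longleftrightarrow> \<alpha> = \<beta>"
  by (metis less_add_one_iff order_antisym order_refl)

lemma osup_range_le_iff: "osup (range (f::nat \<Rightarrow> countable_ord)) \<le> \<beta> \<longleftrightarrow> (\<forall>i. f i \<le> \<beta>)"
  by (subst osup_le_iff) auto

lemma le_osup_range: "f i \<le> osup (range (f::nat \<Rightarrow> countable_ord))"
  using osup_range_le_iff[of f "osup (range f)"] by simp

lemma less_osup_range_iff: "\<beta> < osup (range (f::nat \<Rightarrow> countable_ord)) \<longleftrightarrow> (\<exists>i. \<beta> < f i)"
  by (meson not_less osup_range_le_iff)

text \<open>Anything below the supremum lies below some \<open>f i\<close>, and adding on the right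
  of \<alpha> is strictly monotone. This is what carries limit bounds through a wreath product in
  \<open>big_tower\<close>.\<close>

lemma add_osup_range_le:
  "(\<alpha>::countable_ord) + osup (range f) \<le> osup (range (\<lambda>i::nat. \<alpha> + f i))"
proof -
  have "\<alpha> \<le> osup (range (\<lambda>i. \<alpha> + f i))"
    using le_osup_range[of "\<lambda>i. \<alpha> + f i" 0] le_add_countable_ord order_trans by blast
  moreover have "\<alpha> + \<beta> < osup (range (\<lambda>i. \<alpha> + f i))" if "\<beta> < osup (range f)" for \<beta>
    using that add_less_cancel_countable_ord by (auto simp: less_osup_range_iff)
  ultimately show ?thesis by (simp add: add_le_iff_countable_ord)
qed

lemma mult_le_iff_countable_ord:
  "(\<alpha>::countable_ord) * \<beta> \<le> \<gamma> \<longleftrightarrow> (\<forall>\<beta>'<\<beta>. \<alpha> * \<beta>' + \<alpha> \<le> \<gamma>)"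
  unfolding times_countable_ord_def plus_countable_ord_def
  by (subst omult.simps)
    (simp add: osup_le_iff countable_lessThan_countable_ord Ball_def[of "{..<\<beta>}"])

lemma mult_right_mono_countable_ord: "\<beta> \<le> \<gamma> \<Longrightarrow> (\<alpha>::countable_ord) * \<beta> \<le> \<alpha> * \<gamma>"
  using mult_le_iff_countable_ord[of \<alpha> \<gamma> "\<alpha> * \<gamma>"]
  by (auto simp: mult_le_iff_countable_ord[of \<alpha> \<beta>])

text \<open>The half of left distributivity that bounds a product from above. An ordinal below
  \<beta> + \<gamma> is below \<beta> or at most some \<beta> + \<gamma>' with \<gamma>' < \<gamma>,
  and the second case is the induction step.\<close>

lemma mult_add_le_countable_ord: "(\<alpha>::countable_ord) * (\<beta> + \<gamma>) \<le> \<alpha> * \<beta> + \<alpha> * \<gamma>"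
proof (induction \<gamma> rule: less_induct)
  case (less \<gamma>)
  have "\<alpha> * \<delta> + \<alpha> \<le> \<alpha> * \<beta> + \<alpha> * \<gamma>" if \<delta>: "\<delta> < \<beta> + \<gamma>" for \<delta>
  proof -
    consider "\<delta> < \<beta>" | \<gamma>' where "\<gamma>' < \<gamma>" "\<delta> \<le> \<beta> + \<gamma>'"
      using \<delta> less_oadd_iff[of \<delta> \<beta> \<gamma>] unfolding plus_countable_ord_def by blast
    then show ?thesis
    proof cases
      case 1
      then have "\<alpha> * \<delta> + \<alpha> \<le> \<alpha> * \<beta>" using mult_le_iff_countable_ord by blast
      then show ?thesis using le_add_countable_ord order_trans by blast
    next
      case 2
      have "\<alpha> * \<delta> \<le> \<alpha> * (\<beta> + \<gamma>')" by (rule mult_right_mono_countable_ord[OF 2(2)])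
      also have "\<dots> \<le> \<alpha> * \<beta> + \<alpha> * \<gamma>'" by (rule less.IH[OF 2(1)])
      finally have "\<alpha> * \<delta> + \<alpha> \<le> \<alpha> * \<beta> + (\<alpha> * \<gamma>' + \<alpha>)"
        using add_left_mono_countable_ord by (simp flip: add.assoc)
      also have "\<dots> \<le> \<alpha> * \<beta> + \<alpha> * \<gamma>"
        using 2(1) mult_le_iff_countable_ord by (blast intro: add_right_mono_countable_ord)
      finally show ?thesis .
    qed
  qed
  then show ?case by (subst mult_le_iff_countable_ord) blast
qed

lemma mult_osup_range_le:
  "(\<alpha>::countable_ord) * osup (range f) \<le> osup (range (\<lambda>i::nat. \<alpha> * f i))"
proof (subst mult_le_iff_countable_ord, intro allI impI)
  fix \<beta> assume "\<beta> < osup (range f)"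
  then obtain i where "\<beta> < f i" by (auto simp: less_osup_range_iff)
  then have "\<alpha> * \<beta> + \<alpha> \<le> \<alpha> * f i" using mult_le_iff_countable_ord by blast
  also have "\<dots> \<le> osup (range (\<lambda>i. \<alpha> * f i))" by (rule le_osup_range)
  finally show "\<alpha> * \<beta> + \<alpha> \<le> osup (range (\<lambda>i. \<alpha> * f i))" .
qed

lemma add_left_zero_countable_ord [simp]: "0 + (\<alpha>::countable_ord) = \<alpha>"
proof (induction \<alpha> rule: less_induct)
  case (less \<alpha>)
  then have "0 + \<alpha> \<le> \<alpha>" by (simp add: add_le_iff_countable_ord)
  then show ?case using le_add_left_countable_ord order_antisym by blast
qed

lemma mult_zero_countable_ord [simp]: "(\<alpha>::countable_ord) * 0 = 0"
  using mult_le_iff_countable_ord[of \<alpha> 0 0]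
  by (metis not_less order_antisym zero_le_countable_ord)

section \<open>Finite multiples and powers of omega\<close>

primrec mult_nat_ord :: "countable_ord \<Rightarrow> nat \<Rightarrow> countable_ord" where
  "mult_nat_ord \<alpha> 0 = 0"
| "mult_nat_ord \<alpha> (Suc k) = mult_nat_ord \<alpha> k + \<alpha>"

text \<open>\<open>\<omega>_power n\<close> is \<open>\<omega> ^ n\<close>, computed with the factor \<open>\<omega>\<close> on the right. Only one inequality between the
  two is needed.\<close>

primrec omega_power :: "nat \<Rightarrow> countable_ord" where
  "omega_power 0 = 1"
| "omega_power (Suc n) = osup (range (mult_nat_ord (omega_power n)))"

lemma mult_mult_nat_ord_le: "\<alpha> * mult_nat_ord \<beta> k \<le> mult_nat_ord (\<alpha> * \<beta>) k"
proof (induction k)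
  case (Suc k)
  have "\<alpha> * mult_nat_ord \<beta> (Suc k) \<le> \<alpha> * mult_nat_ord \<beta> k + \<alpha> * \<beta>"
    by (simp add: mult_add_le_countable_ord)
  also have "\<dots> \<le> mult_nat_ord (\<alpha> * \<beta>) (Suc k)"
    using add_left_mono_countable_ord[OF Suc] by simp
  finally show ?case .
qed simp

lemma mult_nat_ord_mono: "\<alpha> \<le> \<beta> \<Longrightarrow> mult_nat_ord \<alpha> k \<le> mult_nat_ord \<beta> k"
proof (induction k)
  case (Suc k)
  then show ?case
    by simp (meson add_left_mono_countable_ord add_right_mono_countable_ord order_trans)
qed simp

text \<open>These are the two conditions in the \<open>LEAST\<close> that defines \<omega>. They
  show both that this minimum is attained and that \<omega> is at most the supremum of the finite
  ordinals.\<close>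

lemma omega_power_one_limit:
  "0 < osup (range (mult_nat_ord 1))"
  "\<beta> < osup (range (mult_nat_ord 1)) \<Longrightarrow> \<beta> + 1 < osup (range (mult_nat_ord 1))"
proof -
  have "mult_nat_ord 1 1 \<le> osup (range (mult_nat_ord 1))" by (rule le_osup_range)
  then show "0 < osup (range (mult_nat_ord 1))" by (simp add: one_le_iff_countable_ord)
  assume "\<beta> < osup (range (mult_nat_ord 1))"
  then obtain k where "\<beta> < mult_nat_ord 1 k" by (auto simp: less_osup_range_iff)
  then have "\<beta> + 1 < mult_nat_ord 1 (Suc k)" by (simp add: less_add_one_iff add_one_le_iff)
  also have "\<dots> \<le> osup (range (mult_nat_ord 1))" by (rule le_osup_range)
  finally show "\<beta> + 1 < osup (range (mult_nat_ord 1))" .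
qed

lemma omega_le: "\<omega> \<le> osup (range (mult_nat_ord 1))"
  unfolding omega_ord_def using omega_power_one_limit by (intro Least_le) blast

lemma omega_pos: "0 < \<omega>"
proof -
  have "0 < \<omega> \<and> (\<forall>\<beta><\<omega>. \<beta> + 1 < \<omega>)"
    unfolding omega_ord_def
    by (rule LeastI[of _ "osup (range (mult_nat_ord 1))"]) (use omega_power_one_limit in blast)
  then show ?thesis ..
qed

lemma power_omega_pos: "0 < \<omega> ^ n"
proof (induction n)
  case 0
  show ?case using one_le_iff_countable_ord[of 1] by simp
next
  case (Suc n)
  then have "\<omega> * 0 + \<omega> \<le> \<omega> * \<omega> ^ n" using mult_le_iff_countable_ord by blast
  then show ?case using omega_pos by simp
qed

text \<open>The class \<open>power\<close> multiplies by \<omega> on the left, while the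
  construction gains its factor \<omega> on the right. This inequality is the inductive step that
  converts a bound by \<open>omega_power\<close> into one by \<omega> ^ n.\<close>

lemma omega_mult_le: "\<omega> * omega_power n \<le> omega_power (Suc n)"
proof (induction n)
  case 0
  note omega_le
  moreover have "\<omega> * 1 \<le> \<omega>"
  proof -
    have "\<omega> * \<beta> + \<omega> \<le> \<omega>" if "\<beta> < 1" for \<beta>
    proof -
      have "\<beta> = 0" using that one_le_iff_countable_ord[of \<beta>] by (metis not_less order_le_less zero_le_countable_ord)
      then show ?thesis by simp
    qed
    then show ?thesis by (subst mult_le_iff_countable_ord) blast
  qed
  ultimately show ?case by simp
next
  case (Suc n)
  have "\<omega> * omega_power (Suc n) \<le> osup (range (\<lambda>k. \<omega> * mult_nat_ord (omega_power n) k))"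
    by (simp add: mult_osup_range_le)
  also have "\<dots> \<le> osup (range (mult_nat_ord (omega_power (Suc n))))"
    unfolding osup_range_le_iff
  proof
    fix k
    have "\<omega> * mult_nat_ord (omega_power n) k \<le> mult_nat_ord (\<omega> * omega_power n) k"
      by (rule mult_mult_nat_ord_le)
    also have "\<dots> \<le> mult_nat_ord (omega_power (Suc n)) k" by (rule mult_nat_ord_mono[OF Suc])
    also have "\<dots> \<le> osup (range (mult_nat_ord (omega_power (Suc n))))" by (rule le_osup_range)
    finally show "\<omega> * mult_nat_ord (omega_power n) k
        \<le> osup (range (mult_nat_ord (omega_power (Suc n))))" .
  qed
  finally show ?case by simp
qed

lemma power_omega_le: "\<omega> ^ n \<le> omega_power n"
proof (induction n)
  case (Suc n)
  have "\<omega> ^ Suc n \<le> \<omega> * omega_power n"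
    using mult_right_mono_countable_ord[OF Suc] by simp
  also have "\<dots> \<le> omega_power (Suc n)" by (rule omega_mult_le)
  finally show ?case .
qed simp

text \<open>Since \<open>omega_power n\<close> is at least 1, adding 1 twice stays below its third
  multiple, which is one of the finite multiples whose supremum is the next power.\<close>

lemma omega_power_add_two_le: "omega_power n + 2 \<le> omega_power (Suc n)"
proof -
  have one: "1 \<le> omega_power n"
  proof (induction n)
    case (Suc n)
    have "1 \<le> mult_nat_ord (omega_power n) 1" using Suc by simp
    also have "\<dots> \<le> omega_power (Suc n)" unfolding omega_power.simps by (rule le_osup_range)
    finally show ?case .
  qed simp
  have "omega_power n + 2 = omega_power n + 1 + 1"
    by (simp add: add.assoc flip: one_add_one)
  also have "\<dots> \<le> mult_nat_ord (omega_power n) 3"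
    using one by (auto simp: numeral_3_eq_3 intro: add_left_mono_countable_ord
        add_right_mono_countable_ord order_trans)
  also have "\<dots> \<le> omega_power (Suc n)" unfolding omega_power.simps by (rule le_osup_range)
  finally show ?thesis .
qed

section \<open>Topological groups\<close>

lemma subgrp_simps [simp]:
  "carrier (subgrp G H) = H"
  "mult (subgrp G H) = mult G"
  "one (subgrp G H) = one G"
  "topol (subgrp G H) = subtopology (topol G) H"
  by (simp_all add: subgrp_def)

lemma subgrp_subgrp: "B \<subseteq> A \<Longrightarrow> subgrp (subgrp G A) B = subgrp G B"
  by (simp add: subgrp_def subtopology_subtopology Int_absorb1)

text \<open>Being a group does not involve the topology, so library facts about the record with
  changed carrier can be reused for \<open>subgrp\<close>, which also changes the topology.\<close>

lemma group_cong:
  assumes "carrier G = carrier H" "mult G = mult H" "one G = one H" "group G"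
  shows "group H"
  using assms unfolding group_def monoid_def group_axioms_def Units_def by simp

lemma group_subgrp: "group G \<Longrightarrow> subgroup H G \<Longrightarrow> group (subgrp G H)"
  by (rule group_cong[of "G\<lparr>carrier := H\<rparr>"]) (simp_all add: subgroup.subgroup_is_group)

lemma inv_subgrp:
  assumes "group G" "subgroup H G" "x \<in> H"
  shows "inv\<^bsub>subgrp G H\<^esub> x = inv\<^bsub>G\<^esub> x"
  using assms
  by (intro group.inv_equality[OF group_subgrp])
    (auto simp: subgroup.m_inv_closed subgroup.mem_carrier group.l_inv)

lemma subgroup_subgrp_iff:
  assumes "group G" "subgroup A G"
  shows "subgroup B (subgrp G A) \<longleftrightarrow> subgroup B G \<and> B \<subseteq> A"
proof
  assume B: "subgroup B (subgrp G A)"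
  then have BA: "B \<subseteq> A" using subgroup.subset by fastforce
  have "subgroup B G"
  proof (rule group.subgroupI[OF assms(1)])
    show "B \<subseteq> carrier G" using BA assms(2) subgroup.subset by blast
    show "B \<noteq> {}" using B subgroup.one_closed by blast
    show "inv\<^bsub>G\<^esub> a \<in> B" if "a \<in> B" for a
      using subgroup.m_inv_closed[OF B that] inv_subgrp[OF assms, of a] that BA by auto
    show "a \<otimes>\<^bsub>G\<^esub> b \<in> B" if "a \<in> B" "b \<in> B" for a b
      using subgroup.m_closed[OF B that] by simp
  qed
  then show "subgroup B G \<and> B \<subseteq> A" using BA by blast
next
  assume B: "subgroup B G \<and> B \<subseteq> A"
  show "subgroup B (subgrp G A)"
  proof (rule group.subgroupI[OF group_subgrp[OF assms]])
    show "B \<noteq> {}" using B subgroup.one_closed by blast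
    show "inv\<^bsub>subgrp G A\<^esub> a \<in> B" if "a \<in> B" for a
      using B that by (subst inv_subgrp[OF assms]) (auto simp: subgroup.m_inv_closed)
    show "a \<otimes>\<^bsub>subgrp G A\<^esub> b \<in> B" if "a \<in> B" "b \<in> B" for a b
      using B that by (simp add: subgroup.m_closed)
  qed (use B in auto)
qed

lemma topological_group_subgrp:
  assumes G: "topological_group G" and H: "subgroup H G"
  shows "topological_group (subgrp G H)"
proof -
  have g: "group G" and ts: "topspace (topol G) = carrier G"
    and cm: "continuous_map (prod_topology (topol G) (topol G)) (topol G) (\<lambda>(x, y). x \<otimes>\<^bsub>G\<^esub> y)"
    and ci: "continuous_map (topol G) (topol G) (\<lambda>x. inv\<^bsub>G\<^esub> x)"
    using G by (auto simp: topological_group_def)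
  have HG: "H \<subseteq> carrier G" using H by (rule subgroup.subset)
  show ?thesis
    unfolding topological_group_def
  proof (intro conjI)
    show "group (subgrp G H)" by (rule group_subgrp[OF g H])
    show "topspace (topol (subgrp G H)) = carrier (subgrp G H)" using HG ts by auto
    have "continuous_map (prod_topology (subtopology (topol G) H) (subtopology (topol G) H))
        (topol G) (\<lambda>(x, y). x \<otimes>\<^bsub>G\<^esub> y)"
      unfolding prod_topology_subtopology(1) prod_topology_subtopology(2)
      by (intro continuous_map_from_subtopology cm)
    then show "continuous_map (prod_topology (topol (subgrp G H)) (topol (subgrp G H)))
        (topol (subgrp G H)) (\<lambda>(x, y). x \<otimes>\<^bsub>subgrp G H\<^esub> y)"
      using H HG ts by (auto simp: continuous_map_in_subtopology subgroup.m_closed)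
    have "continuous_map (subtopology (topol G) H) (subtopology (topol G) H) (\<lambda>x. inv\<^bsub>G\<^esub> x)"
      using continuous_map_from_subtopology[OF ci, of H] H
      by (auto simp: continuous_map_in_subtopology subgroup.m_inv_closed)
    then show "continuous_map (topol (subgrp G H)) (topol (subgrp G H)) (\<lambda>x. inv\<^bsub>subgrp G H\<^esub> x)"
      by (simp, rule continuous_map_eq) (use HG ts in \<open>auto simp: inv_subgrp[OF g H]\<close>)
  qed
qed

lemma totally_disconnected_space_subtopology:
  assumes "totally_disconnected_space X"
  shows "totally_disconnected_space (subtopology X S)"
  unfolding totally_disconnected_space_def
proof
  fix x assume x: "x \<in> topspace (subtopology X S)"
  let ?C = "connected_component_of_set (subtopology X S) x"
  have "connectedin (subtopology X S) ?C" by (rule connectedin_connected_component_of)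
  then have "connectedin X ?C" by (simp add: connectedin_subtopology)
  moreover have "x \<in> ?C" using x by (simp add: connected_component_of_refl)
  ultimately have "?C \<subseteq> connected_component_of_set X x"
    by (simp add: connected_component_of_maximal)
  also have "\<dots> = {x}" using x assms by (simp add: totally_disconnected_space_def)
  finally show "?C = {x}" using \<open>x \<in> ?C\<close> by blast
qed

lemma second_countable_space_subtopology:
  assumes "second_countable_space X"
  shows "second_countable_space (subtopology X S)"
proof -
  obtain \<B> where B: "countable \<B>" "\<forall>B\<in>\<B>. openin X B" "\<forall>U. openin X U \<longrightarrow> (\<exists>\<U>\<subseteq>\<B>. U = \<Union>\<U>)"
    using assms unfolding second_countable_space_def by blast
  show ?thesis
    unfolding second_countable_space_def
  proof (rule exI[of _ "(\<lambda>B. B \<inter> S) ` \<B>"], intro conjI ballI allI impI)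
    show "countable ((\<lambda>B. B \<inter> S) ` \<B>)" using B(1) by simp
    show "openin (subtopology X S) b" if "b \<in> (\<lambda>B. B \<inter> S) ` \<B>" for b
      using that B(2) by (auto simp: openin_subtopology)
    fix U assume "openin (subtopology X S) U"
    then obtain V where V: "openin X V" "U = V \<inter> S" by (auto simp: openin_subtopology)
    then obtain \<U> where "\<U> \<subseteq> \<B>" "V = \<Union>\<U>" using B(3) by blast
    then show "\<exists>\<U>\<subseteq>(\<lambda>B. B \<inter> S) ` \<B>. U = \<Union>\<U>"
      using V by (intro exI[of _ "(\<lambda>B. B \<inter> S) ` \<U>"]) auto
  qed
qed

lemma tdlcsc_group_subgrp:
  assumes "tdlcsc_group G" "subgroup H G" "closedin (topol G) H"
  shows "tdlcsc_group (subgrp G H)"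
  using assms
  by (simp add: tdlcsc_group_def topological_group_subgrp Hausdorff_space_subtopology
      totally_disconnected_space_subtopology second_countable_space_subtopology
      locally_compact_space_closed_subset)

lemma elementary_imp_tdlcsc: "elementary G \<Longrightarrow> tdlcsc_group G"
  by (induction rule: elementary.induct) (auto intro: tdlcsc_group_subgrp)

lemma elementary_imp_topological_group: "elementary G \<Longrightarrow> topological_group G"
  using elementary_imp_tdlcsc by (auto simp: tdlcsc_group_def)

lemma topological_group_group: "topological_group G \<Longrightarrow> group G"
  by (simp add: topological_group_def)

lemma topspace_topological_group: "topological_group G \<Longrightarrow> topspace (topol G) = carrier G"
  by (simp add: topological_group_def)

lemma continuous_map_translation:
  assumes "topological_group G" "a \<in> carrier G"
  shows "continuous_map (topol G) (topol G) (\<lambda>x. a \<otimes>\<^bsub>G\<^esub> x)"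
proof -
  have "continuous_map (topol G) (prod_topology (topol G) (topol G)) (\<lambda>x. (a, x))"
    using assms by (simp add: continuous_map_pairedI topological_group_def)
  then have "continuous_map (topol G) (topol G) ((\<lambda>(x, y). x \<otimes>\<^bsub>G\<^esub> y) \<circ> (\<lambda>x. (a, x)))"
    using assms by (auto simp: topological_group_def intro: continuous_map_compose)
  then show ?thesis by (simp add: o_def)
qed

lemma openin_translation:
  assumes G: "topological_group G" and a: "a \<in> carrier G" and V: "openin (topol G) V"
  shows "openin (topol G) ((\<lambda>x. a \<otimes>\<^bsub>G\<^esub> x) ` V)"
proof -
  interpret group G using G by (rule topological_group_group)
  have VG: "V \<subseteq> carrier G" using openin_subset[OF V] topspace_topological_group[OF G] by simp
  have "(\<lambda>x. a \<otimes>\<^bsub>G\<^esub> x) ` V = {x \<in> topspace (topol G). inv\<^bsub>G\<^esub> a \<otimes>\<^bsub>G\<^esub> x \<in> V}"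
  proof (intro subset_antisym subsetI)
    fix x assume "x \<in> (\<lambda>x. a \<otimes>\<^bsub>G\<^esub> x) ` V"
    then obtain v where "v \<in> V" "x = a \<otimes>\<^bsub>G\<^esub> v" by blast
    then show "x \<in> {x \<in> topspace (topol G). inv\<^bsub>G\<^esub> a \<otimes>\<^bsub>G\<^esub> x \<in> V}"
      using a VG by (auto simp: topspace_topological_group[OF G] subset_iff simp flip: m_assoc)
  next
    fix x assume "x \<in> {x \<in> topspace (topol G). inv\<^bsub>G\<^esub> a \<otimes>\<^bsub>G\<^esub> x \<in> V}"
    then have "x = a \<otimes>\<^bsub>G\<^esub> (inv\<^bsub>G\<^esub> a \<otimes>\<^bsub>G\<^esub> x)" "inv\<^bsub>G\<^esub> a \<otimes>\<^bsub>G\<^esub> x \<in> V"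
      using a by (auto simp: topspace_topological_group[OF G] simp flip: m_assoc)
    then show "x \<in> (\<lambda>x. a \<otimes>\<^bsub>G\<^esub> x) ` V" by blast
  qed
  then show ?thesis
    using openin_continuous_map_preimage[OF continuous_map_translation[OF G, of "inv\<^bsub>G\<^esub> a"] V] a
    by simp
qed

text \<open>For h in H and v in V the translate of V that moves v to h contains h and stays inside
  H.\<close>

lemma openin_subgroup_of_open_subset:
  assumes G: "topological_group G" and H: "subgroup H G"
    and V: "openin (topol G) V" "V \<noteq> {}" "V \<subseteq> H"
  shows "openin (topol G) H"
proof (subst openin_subopen, intro ballI)
  fix h assume h: "h \<in> H"
  interpret group G using G by (rule topological_group_group)
  obtain v where v: "v \<in> V" using V by blast
  have c: "h \<in> carrier G" "v \<in> carrier G" using h v V subgroup.subset[OF H] by blast+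
  let ?a = "h \<otimes>\<^bsub>G\<^esub> inv\<^bsub>G\<^esub> v"
  have "openin (topol G) ((\<lambda>x. ?a \<otimes>\<^bsub>G\<^esub> x) ` V)" by (rule openin_translation[OF G _ V(1)]) (use c in auto)
  moreover have "h \<in> (\<lambda>x. ?a \<otimes>\<^bsub>G\<^esub> x) ` V"
    using v c by (intro image_eqI[of _ _ v]) (auto simp: m_assoc)
  moreover have "(\<lambda>x. ?a \<otimes>\<^bsub>G\<^esub> x) ` V \<subseteq> H"
    using H V v h by (auto intro!: subgroup.m_closed[OF H] subgroup.m_inv_closed[OF H])
  ultimately show "\<exists>T. openin (topol G) T \<and> h \<in> T \<and> T \<subseteq> H" by blast
qed

text \<open>The complement is a union of left cosets, each of them open.\<close>

lemma closedin_open_subgroup: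
  assumes G: "topological_group G" and H: "subgroup H G" and o: "openin (topol G) H"
  shows "closedin (topol G) H"
  unfolding closedin_def
proof (intro conjI)
  interpret group G using G by (rule topological_group_group)
  show "H \<subseteq> topspace (topol G)" using o by (rule openin_subset)
  show "openin (topol G) (topspace (topol G) - H)"
  proof (subst openin_subopen, intro ballI)
    fix x assume "x \<in> topspace (topol G) - H"
    then have x: "x \<in> carrier G" "x \<notin> H" by (auto simp: topspace_topological_group[OF G])
    have "y \<notin> H" if "h \<in> H" "y = x \<otimes>\<^bsub>G\<^esub> h" for y h
    proof
      assume "y \<in> H"
      then have "y \<otimes>\<^bsub>G\<^esub> inv\<^bsub>G\<^esub> h \<in> H" using that by (intro subgroup.m_closed[OF H] subgroup.m_inv_closed[OF H])
      moreover have "h \<in> carrier G" by (rule subgroup.mem_carrier[OF H that(1)])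
      ultimately show False using x that by (simp add: m_assoc)
    qed
    moreover have "x \<in> (\<lambda>h. x \<otimes>\<^bsub>G\<^esub> h) ` H"
      using x H subgroup.one_closed by (intro image_eqI[of _ _ "\<one>\<^bsub>G\<^esub>"]) auto
    moreover have "openin (topol G) ((\<lambda>h. x \<otimes>\<^bsub>G\<^esub> h) ` H)" by (rule openin_translation[OF G x(1) o])
    moreover have "(\<lambda>h. x \<otimes>\<^bsub>G\<^esub> h) ` H \<subseteq> topspace (topol G)"
      using openin_subset calculation(3) by blast
    ultimately show "\<exists>T. openin (topol G) T \<and> x \<in> T \<and> T \<subseteq> topspace (topol G) - H"
      by blast
  qed
qed

lemma Res_subset: "group G \<Longrightarrow> topspace (topol G) = carrier G \<Longrightarrow> Res G \<subseteq> carrier G"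
  unfolding Res_def using group.normal_self openin_topspace by (metis Inter_lower mem_Collect_eq)

lemma normal_imp_subgroup': "N \<lhd> G \<Longrightarrow> subgroup N G"
  by (simp add: normal_def)

lemma subgroup_Res:
  assumes "group G" "topspace (topol G) = carrier G" shows "subgroup (Res G) G"
  unfolding Res_def
proof (rule group.subgroups_Inter[OF assms(1)])
  have "carrier G \<lhd> G" "openin (topol G) (carrier G)"
    using assms group.normal_self openin_topspace[of "topol G"] by auto
  then show "{N. N \<lhd> G \<and> openin (topol G) N} \<noteq> {}" by blast
qed (simp add: normal_imp_subgroup')

lemma closedin_Res:
  assumes "topological_group G" shows "closedin (topol G) (Res G)"
  unfolding Res_def
proof (rule closedin_Inter)
  have "carrier G \<lhd> G" "openin (topol G) (carrier G)"
    using assms group.normal_self openin_topspace[of "topol G"] by (auto simp: topological_group_def)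
  then show "{N. N \<lhd> G \<and> openin (topol G) N} \<noteq> {}" by blast
qed (auto intro: closedin_open_subgroup[OF assms] normal_imp_subgroup')

lemma subgroup_Res_subgrp:
  assumes G: "topological_group G" and U: "subgroup U G"
  shows "subgroup (Res (subgrp G U)) G" "Res (subgrp G U) \<subseteq> U"
proof -
  have g: "group G" using G by (rule topological_group_group)
  have "subgroup (Res (subgrp G U)) (subgrp G U)"
    using topological_group_subgrp[OF G U] by (intro subgroup_Res) (auto simp: topological_group_def)
  then show "subgroup (Res (subgrp G U)) G" "Res (subgrp G U) \<subseteq> U"
    by (simp_all add: subgroup_subgrp_iff[OF g U])
qed

lemma closedin_Res_subgrp:
  assumes G: "topological_group G" and U: "subgroup U G" "openin (topol G) U"
  shows "closedin (topol G) (Res (subgrp G U))"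
  using closedin_Res[OF topological_group_subgrp[OF G U(1)]] closedin_open_subgroup[OF assms]
  by (simp add: closedin_trans_full)

section \<open>Monotonicity of the decomposition rank\<close>

text \<open>The map need not be open onto its image. Rank comparison only takes preimages of open
  subgroups, and this weak notion restricts to residuals and to subgroups that are not
  closed.\<close>

definition cont_embedding :: "('a \<Rightarrow> 'b) \<Rightarrow> 'a topgroup \<Rightarrow> 'b topgroup \<Rightarrow> bool" where
  "cont_embedding \<phi> G H \<longleftrightarrow>
     \<phi> \<in> hom G H \<and> inj_on \<phi> (carrier G) \<and> continuous_map (topol G) (topol H) \<phi>"

text \<open>What compact generation contributes to rank comparison. Unlike compact generation it is
  a useful condition for groups that are not locally compact, which occur as domains of
  embeddings.\<close>

definition chain_stable :: "'a topgroup \<Rightarrow> bool" where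
  "chain_stable G \<longleftrightarrow> (\<forall>V::nat \<Rightarrow> 'a set.
     (\<forall>i. subgroup (V i) G \<and> openin (topol G) (V i) \<and> V i \<subseteq> V (Suc i)) \<longrightarrow>
     (\<Union>i. V i) = carrier G \<longrightarrow> (\<exists>i. V i = carrier G))"

lemma compactin_subset_of_chain:
  assumes "compactin X K" "\<And>i::nat. openin X (V i)" "\<And>i. V i \<subseteq> V (Suc i)" "K \<subseteq> (\<Union>i. V i)"
  shows "\<exists>i. K \<subseteq> V i"
proof -
  have mono: "i \<le> j \<Longrightarrow> V i \<subseteq> V j" for i j using assms(3) by (rule lift_Suc_mono_le)
  obtain \<F> where F: "finite \<F>" "\<F> \<subseteq> range V" "K \<subseteq> \<Union>\<F>"
    using assms compactinD[OF assms(1), of "range V"] by auto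
  then obtain I where I: "finite I" "\<F> = V ` I" by (meson finite_subset_image)
  have "V i \<subseteq> V (Max I)" if "i \<in> I" for i using I(1) that by (intro mono) auto
  then show ?thesis using F I by (intro exI[of _ "Max I"]) blast
qed

lemma compactly_generated_imp_chain_stable:
  assumes "group G" "compactly_generated G" shows "chain_stable G"
  unfolding chain_stable_def
proof (intro allI impI)
  fix V :: "nat \<Rightarrow> 'a set"
  assume V: "\<forall>i. subgroup (V i) G \<and> openin (topol G) (V i) \<and> V i \<subseteq> V (Suc i)"
    and u: "(\<Union>i. V i) = carrier G"
  obtain K where K: "compactin (topol G) K" "generate G K = carrier G"
    using assms(2) by (auto simp: compactly_generated_def)
  have "K \<subseteq> carrier G" using K(2) generate.incl by fastforce
  then obtain i where "K \<subseteq> V i" using compactin_subset_of_chain[OF K(1), of V] V u by auto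
  then have "carrier G \<subseteq> V i"
    using group.generate_subgroup_incl[OF assms(1), of K "V i"] V K(2) by simp
  then show "\<exists>i. V i = carrier G" using V subgroup.subset by blast
qed

lemma has_rank_imp_elementary: "has_rank G \<alpha> \<Longrightarrow> elementary G"
  by (erule has_rank.cases) auto

lemma subgrp_self: "topological_group G \<Longrightarrow> subgrp G (carrier G) = G"
  using subtopology_topspace[of "topol G"] by (simp add: subgrp_def topological_group_def)

text \<open>The two clauses for non-trivial groups are unified by constant sequences of subgroups.\<close>

lemma has_rank_cases:
  assumes "has_rank G \<beta>"
  obtains "carrier G = {\<one>\<^bsub>G\<^esub>}" "\<beta> = 1"
  | U \<alpha> where "carrier G \<noteq> {\<one>\<^bsub>G\<^esub>}" "\<And>i. subgroup (U i) G" "\<And>i. openin (topol G) (U i)"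
    "\<And>i. compactly_generated (subgrp G (U i))" "\<And>i. U i \<subseteq> U (Suc i)"
    "(\<Union>i::nat. U i) = carrier G" "\<And>i. has_rank (subgrp G (Res (subgrp G (U i)))) (\<alpha> i)"
    "\<beta> = osup (range \<alpha>) + 1"
  using assms
proof cases
  case trivial
  then show ?thesis using that(1) by blast
next
  case (comp_gen \<alpha>)
  have tg: "topological_group G" using comp_gen by (simp add: elementary_imp_topological_group)
  have "osup (range (\<lambda>i::nat. \<alpha>)) = \<alpha>"
    using osup_range_le_iff[of "\<lambda>i. \<alpha>" \<alpha>] le_osup_range[of "\<lambda>i. \<alpha>" 0] by (intro order_antisym) blast+
  moreover have "openin (topol G) (carrier G)"
    using openin_topspace[of "topol G"] topspace_topological_group[OF tg] by simp
  ultimately show ?thesis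
    using comp_gen tg group.subgroup_self[OF topological_group_group[OF tg]]
    by (intro that(2)[of "\<lambda>_. carrier G" "\<lambda>_. \<alpha>"]) (simp_all add: subgrp_self)
next
  case (increasing_union U \<alpha>)
  then show ?thesis by (intro that(2)[of U \<alpha>])
qed

lemma has_rank_ge_one: "has_rank G \<beta> \<Longrightarrow> 1 \<le> \<beta>"
  by (erule has_rank_cases) (auto simp: le_add_left_countable_ord)

lemma has_rank_ge_two: "has_rank G \<beta> \<Longrightarrow> carrier G \<noteq> {\<one>\<^bsub>G\<^esub>} \<Longrightarrow> 1 + 1 \<le> \<beta>"
proof (erule has_rank_cases)
  fix U and \<alpha> :: "nat \<Rightarrow> countable_ord" assume r: "\<And>i. has_rank (subgrp G (Res (subgrp G (U i)))) (\<alpha> i)"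
    and b: "\<beta> = osup (range \<alpha>) + 1"
  have "1 \<le> osup (range \<alpha>)" using has_rank_ge_one[OF r[of 0]] le_osup_range by (rule order_trans)
  then show "1 + 1 \<le> \<beta>" unfolding b by (rule add_left_mono_countable_ord)
qed auto

lemma group_hom_intro: "group G \<Longrightarrow> group H \<Longrightarrow> \<phi> \<in> hom G H \<Longrightarrow> group_hom G H \<phi>"
  by (simp add: group_hom_def group_hom_axioms_def)

lemma subgroup_vimage:
  assumes "group G" "group H" "\<phi> \<in> hom G H" "subgroup V H"
  shows "subgroup {x \<in> carrier G. \<phi> x \<in> V} G"
proof -
  interpret group_hom G H \<phi> using assms by (simp add: group_hom_intro)
  show ?thesis
    by (rule G.subgroupI)
      (auto simp: subgroup.m_closed[OF assms(4)] subgroup.m_inv_closed[OF assms(4)]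
        subgroup.one_closed[OF assms(4)] intro!: exI[of _ "\<one>\<^bsub>G\<^esub>"])
qed

text \<open>Preimages of open normal subgroups under a continuous homomorphism are open and
  normal.\<close>

lemma Res_image_subset:
  assumes G: "group G" and H: "group H" and \<phi>: "\<phi> \<in> hom G H" "continuous_map (topol G) (topol H) \<phi>"
    and ts: "topspace (topol G) = carrier G"
  shows "\<phi> ` Res G \<subseteq> Res H"
proof -
  interpret group_hom G H \<phi> using assms by (simp add: group_hom_intro)
  have "\<phi> x \<in> N" if x: "x \<in> Res G" and N: "N \<lhd> H" "openin (topol H) N" for x N
  proof -
    let ?M = "{x \<in> carrier G. \<phi> x \<in> N}"
    have "subgroup ?M G" using subgroup_vimage[OF G H \<phi>(1)] N normal_imp_subgroup' by blast
    then have "?M \<lhd> G"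
      using N normal.inv_op_closed2 by (fastforce simp: G.normal_inv_iff)
    moreover have "openin (topol G) ?M"
      using openin_continuous_map_preimage[OF \<phi>(2) N(2)] ts by simp
    ultimately have "Res G \<subseteq> ?M" unfolding Res_def by blast
    then show ?thesis using x by blast
  qed
  then show ?thesis by (auto simp: Res_def[of H])
qed

lemma cont_embedding_subgrp:
  assumes "cont_embedding \<phi> G H" "A \<subseteq> carrier G" "\<phi> ` A \<subseteq> B"
  shows "cont_embedding \<phi> (subgrp G A) (subgrp H B)"
  using assms unfolding cont_embedding_def
  by (auto simp: hom_def Pi_iff subset_iff inj_on_def continuous_map_in_subtopology
      continuous_map_from_subtopology)

text \<open>The preimages in C of the subgroups that compute the rank of H form an increasing open
  exhaustion of C, so the image of C lies in a single \<open>U i\<close>. The residual of C then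
  maps into the residual of \<open>U i\<close>, whose rank plus one is at most \<beta>. Both
  monotonicity of the rank and the lower bounds rest on this step.\<close>

lemma cont_embedding_rank_step:
  assumes C: "group C" "topspace (topol C) = carrier C" "carrier C \<noteq> {\<one>\<^bsub>C\<^esub>}" "chain_stable C"
    and \<phi>: "cont_embedding \<phi> C H" and r: "has_rank H \<beta>"
  obtains K \<alpha> where "has_rank (subgrp H K) \<alpha>" "\<alpha> + 1 \<le> \<beta>"
    "cont_embedding \<phi> (subgrp C (Res C)) (subgrp H K)"
proof -
  have tH: "topological_group H"
    using r by (simp add: has_rank_imp_elementary elementary_imp_topological_group)
  have H: "group H" using tH by (rule topological_group_group)
  have hom: "\<phi> \<in> hom C H" and inj: "inj_on \<phi> (carrier C)" and ct: "continuous_map (topol C) (topol H) \<phi>"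
    using \<phi> by (auto simp: cont_embedding_def)
  interpret group_hom C H \<phi> using C H hom by (simp add: group_hom_intro)
  from r show ?thesis
  proof (cases rule: has_rank_cases)
    case 1
    have "x = \<one>\<^bsub>C\<^esub>" if "x \<in> carrier C" for x
    proof -
      have "\<phi> x = \<phi> \<one>\<^bsub>C\<^esub>" using 1 that hom_closed by auto
      then show ?thesis using inj_onD[OF inj _ that G.one_closed] by simp
    qed
    then have "carrier C = {\<one>\<^bsub>C\<^esub>}" by blast
    then show ?thesis using C by blast
  next
    case (2 U \<alpha>)
    let ?V = "\<lambda>i. {x \<in> carrier C. \<phi> x \<in> U i}"
    have "\<forall>i. subgroup (?V i) C \<and> openin (topol C) (?V i) \<and> ?V i \<subseteq> ?V (Suc i)"
      using subgroup_vimage[OF C(1) H hom 2(2)] openin_continuous_map_preimage[OF ct 2(3)] C(2) 2(5)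
      by (auto simp: subset_iff)
    moreover have "(\<Union>i. ?V i) = carrier C" using 2(6) hom_closed by auto
    ultimately obtain i where "?V i = carrier C" using C(4) unfolding chain_stable_def by meson
    then have im: "\<phi> ` carrier C \<subseteq> U i" by blast
    have "cont_embedding \<phi> C (subgrp H (U i))"
      using \<phi> im unfolding cont_embedding_def
      by (auto simp: hom_def Pi_iff image_subset_iff continuous_map_in_subtopology C(2))
    then have "\<phi> ` Res C \<subseteq> Res (subgrp H (U i))"
      using C group_subgrp[OF H 2(2)] by (intro Res_image_subset) (auto simp: cont_embedding_def)
    then have "cont_embedding \<phi> (subgrp C (Res C)) (subgrp H (Res (subgrp H (U i))))"
      using \<phi> Res_subset[OF C(1,2)] by (intro cont_embedding_subgrp)
    moreover have "\<alpha> i + 1 \<le> \<beta>"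
      unfolding 2(8) by (intro add_left_mono_countable_ord le_osup_range)
    ultimately show ?thesis using that 2(7) by blast
  qed
qed

text \<open>Induction on the rank of the smaller group, with target and embedding arbitrary: each
  step passes to a pair of residuals. Applied to the identity it shows that the rank does not depend
  on the chosen sequence of subgroups.\<close>

lemma has_rank_mono:
  assumes "has_rank G \<alpha>" "has_rank H \<beta>" "cont_embedding \<phi> G H"
  shows "\<alpha> \<le> \<beta>"
  using assms
proof (induction arbitrary: H \<beta> \<phi> rule: has_rank.induct)
  case (trivial G)
  then show ?case by (simp add: has_rank_ge_one)
next
  case (comp_gen G \<alpha>)
  have G: "topological_group G" using comp_gen by (simp add: elementary_imp_topological_group)
  then have g: "group G" "topspace (topol G) = carrier G" by (auto simp: topological_group_def)
  obtain K \<alpha>' where "has_rank (subgrp H K) \<alpha>'" "\<alpha>' + 1 \<le> \<beta>"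
    "cont_embedding \<phi> (subgrp G (Res G)) (subgrp H K)"
    using cont_embedding_rank_step[OF g comp_gen(2) compactly_generated_imp_chain_stable[OF g(1) comp_gen(3)]
        comp_gen(7,6)] .
  then show ?case using comp_gen.IH add_left_mono_countable_ord order_trans by metis
next
  case (increasing_union G U \<alpha>)
  have G: "topological_group G" using increasing_union by (simp add: elementary_imp_topological_group)
  then have g: "group G" "topspace (topol G) = carrier G" by (auto simp: topological_group_def)
  have H: "topological_group H"
    using increasing_union by (simp add: has_rank_imp_elementary elementary_imp_topological_group)
  have ntH: "carrier H \<noteq> {\<one>\<^bsub>H\<^esub>}"
  proof
    assume *: "carrier H = {\<one>\<^bsub>H\<^esub>}"
    have "x = \<one>\<^bsub>G\<^esub>" if "x \<in> carrier G" for x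
      using increasing_union(11) * that monoid.one_closed[OF group.is_monoid[OF g(1)]]
      unfolding cont_embedding_def hom_def by (auto simp: inj_on_def Pi_iff)
    then have "carrier G = {\<one>\<^bsub>G\<^esub>}" using monoid.one_closed[OF group.is_monoid[OF g(1)]] by blast
    then show False using increasing_union by blast
  qed
  have "\<alpha> i + 1 \<le> \<beta>" for i
  \<comment> \<open>The comparison step excludes the trivial group. For trivial \<open>U i\<close>
    the residual has rank 1, and \<beta> is at least 2 because H is not trivial.\<close>
  proof (cases "U i = {\<one>\<^bsub>G\<^esub>}")
    case True
    have R: "carrier (subgrp G (Res (subgrp G (U i)))) = {\<one>\<^bsub>subgrp G (Res (subgrp G (U i)))\<^esub>}"
      using True subgroup_Res_subgrp[OF G increasing_union(3)[of i]] subgroup.one_closed by fastforce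
    have "\<alpha> i = 1"
      using increasing_union(8)[of i] R by (cases rule: has_rank_cases) auto
    then show ?thesis using has_rank_ge_two[OF increasing_union(10) ntH] by simp
  next
    case False
    let ?C = "subgrp G (U i)"
    have C: "topological_group ?C" by (rule topological_group_subgrp[OF G increasing_union(3)])
    then have C': "group ?C" "topspace (topol ?C) = carrier ?C" by (auto simp: topological_group_def)
    have "cont_embedding \<phi> ?C (subgrp H (carrier H))"
      using increasing_union(11) subgroup.subset[OF increasing_union(3)[of i]]
      by (intro cont_embedding_subgrp) (auto simp: cont_embedding_def hom_def)
    then have e: "cont_embedding \<phi> ?C H" using subgrp_self[OF H] by simp
    obtain K \<alpha>' where K: "has_rank (subgrp H K) \<alpha>'" "\<alpha>' + 1 \<le> \<beta>"
      "cont_embedding \<phi> (subgrp ?C (Res ?C)) (subgrp H K)"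
      using cont_embedding_rank_step[OF C' _ compactly_generated_imp_chain_stable[OF C'(1) increasing_union(5)]
          e increasing_union(10)] False by auto
    then have "\<alpha> i \<le> \<alpha>'"
      using increasing_union.IH subgroup_Res_subgrp(2)[OF G increasing_union(3)[of i]]
      by (simp add: subgrp_subgrp)
    then show ?thesis using K(2) add_left_mono_countable_ord order_trans by blast
  qed
  moreover obtain \<beta>' where "\<beta> = \<beta>' + 1"
    using increasing_union(10) ntH by (cases rule: has_rank_cases) auto
  ultimately have "osup (range \<alpha>) \<le> \<beta>'"
    by (auto simp: osup_range_le_iff add_one_le_iff less_add_one_iff)
  then show ?case using \<open>\<beta> = \<beta>' + 1\<close> by (simp add: add_left_mono_countable_ord)
qed

lemma has_rank_unique:
  assumes "has_rank G \<alpha>" "has_rank G \<beta>" shows "\<alpha> = \<beta>"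
proof -
  have "cont_embedding (\<lambda>x. x) G G"
    by (simp add: cont_embedding_def hom_def)
  then show ?thesis using has_rank_mono[OF assms] has_rank_mono[OF assms(2,1)] by fastforce
qed

lemma decomposition_rank_eq: "has_rank G \<alpha> \<Longrightarrow> \<xi> G = \<alpha>"
  unfolding decomposition_rank_def by (rule the_equality) (auto dest: has_rank_unique)

text \<open>The double successor makes the descent work. If \<gamma> + 2 is at most sup (\<alpha> i)
  + 1, then \<gamma> lies strictly below the supremum, so some \<alpha> i is at least \<gamma> + 1.
  Either \<alpha> i is still at least \<gamma> + 2 and the descent continues in that residual, or it
  equals \<gamma> + 1 and \<open>U i\<close> itself has rank \<gamma> + 2. For a limit value no
  single \<alpha> i need reach it.\<close>

lemma exists_compactly_generated_of_rank:
  assumes "has_rank G \<beta>" "\<gamma> + 1 + 1 \<le> \<beta>" "0 < \<gamma>"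
  shows "\<exists>H. elementary H \<and> compactly_generated H \<and> \<xi> H = \<gamma> + 1 + 1"
  using assms(1,2)
proof (induction rule: has_rank.induct)
  case (trivial G)
  then show ?case
    using le_add_left_countable_ord[of 1 \<gamma>] by (simp add: add_one_le_iff)
next
  case (comp_gen G \<alpha>)
  show ?case
  proof (cases "\<gamma> + 1 + 1 \<le> \<alpha>")
    case True
    then show ?thesis by (rule comp_gen.IH)
  next
    case False
    then have "\<alpha> = \<gamma> + 1"
      using comp_gen(6) by (metis add_one_le_iff less_add_one_iff not_less order_antisym)
    then have "\<xi> G = \<gamma> + 1 + 1"
      using comp_gen has_rank.comp_gen decomposition_rank_eq by blast
    then show ?thesis using comp_gen by blast
  qed
next
  case (increasing_union G U \<alpha>)
  have G: "topological_group G" using increasing_union by (simp add: elementary_imp_topological_group)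
  obtain i where i: "\<gamma> + 1 \<le> \<alpha> i"
    using increasing_union(10) by (auto simp: less_add_one_iff add_one_le_iff less_osup_range_iff)
  show ?case
  proof (cases "\<gamma> + 1 + 1 \<le> \<alpha> i")
    case True
    then show ?thesis by (rule increasing_union.IH)
  next
    case False
    let ?H = "subgrp G (U i)"
    have a: "\<alpha> i = \<gamma> + 1" using i False by (metis add_one_le_iff not_less order_antisym)
    have e: "elementary ?H"
      using increasing_union closedin_open_subgroup[OF G] by (intro elementary.subgroup) auto
    have r: "has_rank (subgrp ?H (Res ?H)) (\<gamma> + 1)"
      using increasing_union(8)[of i] a subgroup_Res_subgrp(2)[OF G increasing_union(3)[of i]]
      by (simp add: subgrp_subgrp)
    have "carrier ?H \<noteq> {\<one>\<^bsub>?H\<^esub>}"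
    proof
      assume t: "carrier ?H = {\<one>\<^bsub>?H\<^esub>}"
      have R: "Res ?H = {\<one>\<^bsub>G\<^esub>}"
        using t subgroup_Res_subgrp[OF G increasing_union(3)[of i]] subgroup.one_closed by fastforce
      from r have "\<gamma> + 1 = 1" by (rule has_rank_cases) (use R in simp_all)
      \<comment> \<open>A trivial \<open>U i\<close> would give a residual of rank 1, that is
        \<gamma> = 0.\<close>
      then show False using assms(3) by (metis add_left_zero_countable_ord add_one_eq_iff order_less_irrefl)
    qed
    then have "has_rank ?H (\<gamma> + 1 + 1)"
      by (rule has_rank.comp_gen[OF e _ increasing_union(5) r])
    then have "\<xi> ?H = \<gamma> + 1 + 1" by (rule decomposition_rank_eq)
    then show ?thesis using e increasing_union(5) by blast
  qed
qed

section \<open>Groups with a filter base of subgroups\<close>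

text \<open>The ambient group becomes a type, so that group computations are left to the simplifier.
  The groups under study are subsets of it, handled by predicates instead of records.\<close>

class mgroup = monoid_mult +
  fixes ginv :: "'a \<Rightarrow> 'a"
  assumes ginv_left [simp]: "ginv a * a = 1"
begin

lemma ginv_mult_cancel [simp]: "ginv a * (a * b) = b"
  by (simp flip: mult.assoc)

lemma ginv_right [simp]: "a * ginv a = 1"
  by (metis ginv_left ginv_mult_cancel mult_1_right)

lemma mult_ginv_cancel [simp]: "a * (ginv a * b) = b"
  by (simp flip: mult.assoc)

lemma ginv_unique: "a * b = 1 \<Longrightarrow> ginv a = b"
  by (metis ginv_mult_cancel mult_1_right)

lemma ginv_ginv [simp]: "ginv (ginv a) = a"
  by (rule ginv_unique) simp

lemma ginv_one [simp]: "ginv 1 = 1"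
  by (rule ginv_unique) simp

lemma ginv_mult: "ginv (a * b) = ginv b * ginv a"
  by (rule ginv_unique) (simp add: mult.assoc)

end

definition sgp :: "'a::mgroup set \<Rightarrow> bool" where
  "sgp S \<longleftrightarrow> 1 \<in> S \<and> (\<forall>x\<in>S. \<forall>y\<in>S. x * y \<in> S) \<and> (\<forall>x\<in>S. ginv x \<in> S)"

lemma sgpI:
  "1 \<in> S \<Longrightarrow> (\<And>x y. x \<in> S \<Longrightarrow> y \<in> S \<Longrightarrow> x * y \<in> S) \<Longrightarrow> (\<And>x. x \<in> S \<Longrightarrow> ginv x \<in> S) \<Longrightarrow> sgp S"
  by (simp add: sgp_def)

lemma sgp_one: "sgp S \<Longrightarrow> 1 \<in> S"
  and sgp_mult: "sgp S \<Longrightarrow> x \<in> S \<Longrightarrow> y \<in> S \<Longrightarrow> x * y \<in> S"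
  and sgp_ginv: "sgp S \<Longrightarrow> x \<in> S \<Longrightarrow> ginv x \<in> S"
  by (simp_all add: sgp_def)

lemma sgp_Int: "sgp S \<Longrightarrow> sgp T \<Longrightarrow> sgp (S \<inter> T)"
  by (auto simp: sgp_def)

lemma sgp_Inter: "(\<And>S. S \<in> \<S> \<Longrightarrow> sgp S) \<Longrightarrow> sgp (\<Inter>\<S>)"
  by (auto simp: sgp_def)

lemma sgp_trivial: "sgp {1}"
  by (simp add: sgp_def)

definition gen :: "'a::mgroup set \<Rightarrow> 'a set" where
  "gen X = \<Inter>{S. sgp S \<and> X \<subseteq> S}"

lemma sgp_gen: "sgp (gen X)"
  unfolding gen_def by (rule sgp_Inter) simp

lemma gen_superset: "X \<subseteq> gen X"
  unfolding gen_def by blast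

lemma gen_least: "sgp S \<Longrightarrow> X \<subseteq> S \<Longrightarrow> gen X \<subseteq> S"
  unfolding gen_def by blast

text \<open>The products of words in X and its inverses form a subgroup containing X.\<close>

lemma countable_gen:
  assumes "countable X" shows "countable (gen X)"
proof -
  let ?W = "prod_list ` lists (X \<union> ginv ` X)"
  have "sgp ?W"
  proof (rule sgpI)
    show "1 \<in> ?W" by (rule image_eqI[of _ _ "[]"]) auto
    show "x * y \<in> ?W" if xy: "x \<in> ?W" "y \<in> ?W" for x y
    proof -
      obtain xs ys where "xs \<in> lists (X \<union> ginv ` X)" "x = prod_list xs"
        "ys \<in> lists (X \<union> ginv ` X)" "y = prod_list ys" using xy by (auto elim!: imageE)
      then show ?thesis by (intro image_eqI[of _ _ "xs @ ys"]) auto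
    qed
    show "ginv x \<in> ?W" if x: "x \<in> ?W" for x
    proof -
      obtain xs where xs: "xs \<in> lists (X \<union> ginv ` X)" "x = prod_list xs" using x by blast
      have "ginv (prod_list xs) = prod_list (rev (map ginv xs))"
        by (induction xs) (simp_all add: ginv_mult)
      moreover have "rev (map ginv xs) \<in> lists (X \<union> ginv ` X)"
        using xs(1) by (auto simp: in_lists_conv_set image_iff)
      ultimately show ?thesis using xs by (intro image_eqI[of _ _ "rev (map ginv xs)"]) auto
    qed
  qed
  moreover have "X \<subseteq> ?W"
    by (intro subsetI, rule_tac x="[x]" in image_eqI) auto
  ultimately have "gen X \<subseteq> ?W" by (rule gen_least)
  moreover have "countable ?W" using assms by (intro countable_image countable_lists) auto
  ultimately show ?thesis by (rule countable_subset)
qed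

definition nrm :: "'a::mgroup set \<Rightarrow> 'a set \<Rightarrow> bool" where
  "nrm V C \<longleftrightarrow> (\<forall>c\<in>C. \<forall>v\<in>V. c * v * ginv c \<in> V)"

text \<open>Meant as a neighbourhood base of the identity. Compatibility with conjugation is a
  separate assumption, made in \<open>filtered_group\<close>, because it depends on the group in
  which one conjugates.\<close>

definition filter_base :: "'a::mgroup set set \<Rightarrow> bool" where
  "filter_base N \<longleftrightarrow> N \<noteq> {} \<and> (\<forall>n\<in>N. sgp n) \<and> (\<forall>n\<in>N. \<forall>m\<in>N. \<exists>k\<in>N. k \<subseteq> n \<inter> m)"

definition relopen :: "'a::mgroup set set \<Rightarrow> 'a set \<Rightarrow> 'a set \<Rightarrow> bool" where
  "relopen N C V \<longleftrightarrow> sgp V \<and> V \<subseteq> C \<and> (\<exists>n\<in>N. C \<inter> n \<subseteq> V)"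

text \<open>A weak form of compact generation, which passes to images under continuous homomorphisms and
  makes sense for subgroups that are not closed.\<close>

definition cg :: "'a::mgroup set set \<Rightarrow> 'a set \<Rightarrow> bool" where
  "cg N C \<longleftrightarrow> (\<forall>V::nat \<Rightarrow> 'a set. (\<forall>i. relopen N C (V i) \<and> V i \<subseteq> V (Suc i)) \<longrightarrow>
     (\<Union>i. V i) = C \<longrightarrow> (\<exists>i. V i = C))"

lemma cgD:
  "cg N C \<Longrightarrow> (\<And>i::nat. relopen N C (V i)) \<Longrightarrow> (\<And>i. V i \<subseteq> V (Suc i)) \<Longrightarrow> (\<Union>i. V i) = C \<Longrightarrow>
    \<exists>i. V i = C"
  by (simp add: cg_def)

definition res :: "'a::mgroup set set \<Rightarrow> 'a set \<Rightarrow> 'a set" where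
  "res N C = C \<inter> \<Inter>{V. relopen N C V \<and> nrm V C}"

text \<open>Only continuity at the identity is recorded; for homomorphisms this implies
  continuity.\<close>

definition conthom :: "('a::mgroup \<Rightarrow> 'b::mgroup) \<Rightarrow> 'a set \<Rightarrow> 'a set set \<Rightarrow> 'b set set \<Rightarrow> bool" where
  "conthom \<phi> S N M \<longleftrightarrow> sgp S \<and> (\<forall>x\<in>S. \<forall>y\<in>S. \<phi> (x * y) = \<phi> x * \<phi> y) \<and>
     (\<forall>m\<in>M. \<exists>n\<in>N. \<phi> ` (S \<inter> n) \<subseteq> m)"

lemma sgp_res: "sgp C \<Longrightarrow> sgp (res N C)"
  unfolding res_def by (intro sgp_Int sgp_Inter) (auto simp: relopen_def)

lemma res_subset: "res N C \<subseteq> C"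
  by (auto simp: res_def)

lemma conthom_mult: "conthom \<phi> S N M \<Longrightarrow> x \<in> S \<Longrightarrow> y \<in> S \<Longrightarrow> \<phi> (x * y) = \<phi> x * \<phi> y"
  by (simp add: conthom_def)

lemma conthom_one: assumes "conthom \<phi> S N M" shows "\<phi> 1 = 1"
proof -
  have "\<phi> 1 * \<phi> 1 = \<phi> 1" using assms sgp_one by (metis conthom_def mult_1)
  then show ?thesis by (metis ginv_left ginv_mult_cancel)
qed

lemma conthom_ginv: assumes "conthom \<phi> S N M" "x \<in> S" shows "\<phi> (ginv x) = ginv (\<phi> x)"
proof -
  have "\<phi> x * \<phi> (ginv x) = \<phi> (x * ginv x)"
    using assms by (simp add: conthom_mult conthom_def[of \<phi> S] sgp_ginv del: ginv_right)
  then show ?thesis using conthom_one[OF assms(1)] ginv_unique by fastforce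
qed

lemma conthom_subset: "conthom \<phi> S N M \<Longrightarrow> sgp T \<Longrightarrow> T \<subseteq> S \<Longrightarrow> conthom \<phi> T N M"
  unfolding conthom_def by (meson Int_mono image_mono order_trans subset_refl subsetD)

lemma sgp_vimage: "conthom \<phi> S N M \<Longrightarrow> sgp V \<Longrightarrow> sgp {x \<in> S. \<phi> x \<in> V}"
  by (rule sgpI) (auto simp: conthom_def conthom_one conthom_ginv sgp_one sgp_mult sgp_ginv)

lemma sgp_image: assumes "conthom \<phi> S N M" shows "sgp (\<phi> ` S)"
proof -
  have S: "sgp S" using assms by (simp add: conthom_def)
  show ?thesis
  proof (rule sgpI)
    show "1 \<in> \<phi> ` S" using conthom_one[OF assms] sgp_one[OF S] by force
    show "x * y \<in> \<phi> ` S" if "x \<in> \<phi> ` S" "y \<in> \<phi> ` S" for x y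
      using that conthom_mult[OF assms] sgp_mult[OF S] by (auto simp flip: image_eqI) (metis imageI)
    show "ginv x \<in> \<phi> ` S" if "x \<in> \<phi> ` S" for x
      using that conthom_ginv[OF assms] sgp_ginv[OF S] by auto (metis imageI)
  qed
qed

lemma relopen_vimage:
  assumes "conthom \<phi> S N M" "relopen M D V" "\<phi> ` S \<subseteq> D"
  shows "relopen N S {x \<in> S. \<phi> x \<in> V}"
proof -
  obtain m where "m \<in> M" "D \<inter> m \<subseteq> V" using assms(2) by (auto simp: relopen_def)
  moreover obtain n where "n \<in> N" "\<phi> ` (S \<inter> n) \<subseteq> m"
    using assms(1) \<open>m \<in> M\<close> by (auto simp: conthom_def)
  ultimately show ?thesis
    using assms sgp_vimage[OF assms(1)] unfolding relopen_def by blast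
qed

lemma nrm_vimage:
  assumes \<phi>: "conthom \<phi> S N M" and V: "nrm V D" "\<phi> ` S \<subseteq> D"
  shows "nrm {x \<in> S. \<phi> x \<in> V} S"
proof -
  have S: "sgp S" using \<phi> by (simp add: conthom_def)
  show ?thesis
    using V by (auto simp: nrm_def conthom_mult[OF \<phi>] conthom_ginv[OF \<phi>] sgp_mult[OF S] sgp_ginv[OF S])
qed

lemma cg_image: assumes \<phi>: "conthom \<phi> C N M" and cg: "cg N C" shows "cg M (\<phi> ` C)"
  unfolding cg_def
proof (intro allI impI)
  fix V :: "nat \<Rightarrow> 'b set"
  assume V: "\<forall>i. relopen M (\<phi> ` C) (V i) \<and> V i \<subseteq> V (Suc i)" and u: "(\<Union>i. V i) = \<phi> ` C"
  let ?W = "\<lambda>i. {x \<in> C. \<phi> x \<in> V i}"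
  have "relopen N C (?W i)" "?W i \<subseteq> ?W (Suc i)" for i
    using V relopen_vimage[OF \<phi>, of "\<phi> ` C" "V i"] by auto
  moreover have "(\<Union>i. ?W i) = C" using u by auto
  ultimately obtain i where "?W i = C" using cgD[OF cg, of ?W] by blast
  then have "V i = \<phi> ` C" using V by (auto simp: relopen_def)
  then show "\<exists>i. V i = \<phi> ` C" ..
qed

lemma res_image: assumes \<phi>: "conthom \<phi> C N M" shows "\<phi> ` res N C \<subseteq> res M (\<phi> ` C)"
proof -
  have "\<phi> x \<in> V" if x: "x \<in> res N C" and V: "relopen M (\<phi> ` C) V" "nrm V (\<phi> ` C)" for x V
    using x relopen_vimage[OF \<phi> V(1)] nrm_vimage[OF \<phi> V(2)] by (auto simp: res_def)
  then show ?thesis using res_subset[of N C] by (auto simp: res_def[of M])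
qed

lemma relopen_Int:
  assumes "relopen N S V" "sgp C" "C \<subseteq> S" shows "relopen N C (V \<inter> C)"
  using assms unfolding relopen_def by (auto intro: sgp_Int)

lemma cg_subset_chain:
  assumes "cg N C" "sgp C" "C \<subseteq> S" "\<And>i::nat. relopen N S (V i)" "\<And>i. V i \<subseteq> V (Suc i)" "(\<Union>i. V i) = S"
  shows "\<exists>i. C \<subseteq> V i"
proof -
  have "relopen N C (V i \<inter> C)" "V i \<inter> C \<subseteq> V (Suc i) \<inter> C" for i
    using relopen_Int[OF assms(4,2,3)] assms(5) by blast+
  moreover have "(\<Union>i. V i \<inter> C) = C" using assms by blast
  ultimately obtain i where "V i \<inter> C = C" using cgD[OF assms(1), of "\<lambda>i. V i \<inter> C"] by blast
  then show ?thesis by blast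
qed

text \<open>\<open>wfr\<close> says that iterating the passage from a group to the discrete residuals of its compactly
  generated subgroups is well-founded; this guarantees the existence of a decomposition rank.\<close>

inductive wfr :: "'a::mgroup set set \<Rightarrow> 'a set \<Rightarrow> bool" for N where
  wfrI: "(\<And>C. sgp C \<Longrightarrow> C \<subseteq> S \<Longrightarrow> cg N C \<Longrightarrow> C \<noteq> {1} \<Longrightarrow> wfr N (res N C)) \<Longrightarrow> wfr N S"

lemma wfrD: "wfr N S \<Longrightarrow> sgp C \<Longrightarrow> C \<subseteq> S \<Longrightarrow> cg N C \<Longrightarrow> C \<noteq> {1} \<Longrightarrow> wfr N (res N C)"
  by (erule wfr.cases) blast

lemma wfr_subset: "wfr N S \<Longrightarrow> T \<subseteq> S \<Longrightarrow> wfr N T"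
  by (rule wfrI) (meson wfrD order_trans)

lemma wfr_trivial: "wfr N {1}"
  by (rule wfrI) (auto dest: sgp_one)

text \<open>Induction along Q. A subgroup C with trivial image lies in the kernel. Otherwise the
  image of its residual lies in the residual of the image of C, where the induction hypothesis
  applies, and the kernel only shrinks.\<close>

lemma wfr_extension:
  assumes "wfr M Q" "conthom \<phi> S N M" "\<phi> ` S \<subseteq> Q" "wfr N {x \<in> S. \<phi> x = 1}"
  shows "wfr N S"
  using assms
proof (induction Q arbitrary: S rule: wfr.induct)
  case (wfrI Q)
  show ?case
  proof (rule wfr.wfrI)
    fix C assume C: "sgp C" "C \<subseteq> S" "cg N C" "C \<noteq> {1}"
    have \<phi>C: "conthom \<phi> C N M" using conthom_subset[OF wfrI(3) C(1,2)] .
    show "wfr N (res N C)"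
    proof (cases "\<phi> ` C = {1}")
      case True
      then have "C \<subseteq> {x \<in> S. \<phi> x = 1}" using C(2) by auto
      then show ?thesis using wfrD[OF wfrI(5) C(1) _ C(3,4)] by blast
    next
      case False
      show ?thesis
      proof (rule wfrI(2))
        show "sgp (\<phi> ` C)" by (rule sgp_image[OF \<phi>C])
        show "\<phi> ` C \<subseteq> Q" using wfrI(4) C(2) by blast
        show "cg M (\<phi> ` C)" by (rule cg_image[OF \<phi>C C(3)])
        show "conthom \<phi> (res N C) N M" by (rule conthom_subset[OF \<phi>C sgp_res[OF C(1)] res_subset])
        show "\<phi> ` res N C \<subseteq> res M (\<phi> ` C)" by (rule res_image[OF \<phi>C])
        show "wfr N {x \<in> res N C. \<phi> x = 1}"
          by (rule wfr_subset[OF wfrI(5)]) (use C(2) res_subset in blast)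
      qed (rule False)
    qed
  qed
qed

text \<open>Open normal subgroups of S separate every point from 1, and so do their traces on C,
  which makes every residual trivial after one step.\<close>

lemma wfr_residually_discrete:
  assumes "\<And>x. x \<in> S \<Longrightarrow> x \<noteq> 1 \<Longrightarrow> \<exists>V. relopen N S V \<and> nrm V S \<and> x \<notin> V"
  shows "wfr N S"
proof (rule wfrI)
  fix C assume C: "sgp C" "C \<subseteq> S"
  have "x = 1" if x: "x \<in> res N C" for x
  proof (rule ccontr)
    assume "x \<noteq> 1"
    moreover have "x \<in> C" using x res_subset by blast
    ultimately obtain V where V: "relopen N S V" "nrm V S" "x \<notin> V" using assms C by blast
    have "nrm (V \<inter> C) C"
      using V(2) C by (auto simp: nrm_def sgp_mult sgp_ginv)
    then show False using relopen_Int[OF V(1) C] V(3) x by (auto simp: res_def)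
  qed
  then have "res N C \<subseteq> {1}" by blast
  then show "wfr N (res N C)" by (rule wfr_subset[OF wfr_trivial])
qed

text \<open>A subgroup satisfying \<open>cg\<close> already lies in one member of the chain.\<close>

lemma wfr_chain_union:
  assumes "\<And>i::nat. relopen N S (V i)" "\<And>i. V i \<subseteq> V (Suc i)" "(\<Union>i. V i) = S" "\<And>i. wfr N (V i)"
  shows "wfr N S"
proof (rule wfrI)
  fix C assume C: "sgp C" "C \<subseteq> S" "cg N C" "C \<noteq> {1}"
  then obtain i where "C \<subseteq> V i" using cg_subset_chain[OF C(3,1,2) assms(1-3)] by blast
  then show "wfr N (res N C)" using wfrD[OF assms(4) C(1) _ C(3,4)] by blast
qed

text \<open>Lower bounds for the rank. The map \<open>orb\<close> is the orbit map of a base point with compact open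
  stabiliser, so \<open>infinite (orb ` C)\<close> expresses that \<open>C\<close> is not relatively compact.\<close>

inductive big :: "'a::mgroup set set \<Rightarrow> ('a \<Rightarrow> 'b) \<Rightarrow> 'a set \<Rightarrow> countable_ord \<Rightarrow> bool"
  for N orb where
  big_zero: "big N orb A 0"
| big_sup: "(\<And>i::nat. big N orb A (f i)) \<Longrightarrow> \<alpha> \<le> osup (range f) \<Longrightarrow> big N orb A \<alpha>"
| big_suc: "sgp C \<Longrightarrow> C \<subseteq> A \<Longrightarrow> cg N C \<Longrightarrow> infinite (orb ` C) \<Longrightarrow> big N orb (res N C) \<alpha> \<Longrightarrow>
    big N orb A (\<alpha> + 1)"

lemma big_subset:
  assumes "big N orb A \<alpha>" "A \<subseteq> B" shows "big N orb B \<alpha>"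
  using assms
proof (induction arbitrary: B)
  case (big_zero A)
  show ?case by (rule big.big_zero)
next
  case (big_sup A f \<alpha>)
  then show ?case by (meson big.big_sup)
next
  case (big_suc C A \<alpha>)
  then show ?case by (meson big.big_suc order_trans)
qed

text \<open>Images of residuals lie in residuals of images, so a bound passes forward along any
  continuous homomorphism that keeps infinite orbits infinite. This transports the bound for W to
  its permutation representation.\<close>

lemma big_image:
  assumes "big N orb A \<alpha>" "A \<subseteq> S" "conthom \<phi> S N M"
    and "\<And>C. C \<subseteq> S \<Longrightarrow> infinite (orb ` C) \<Longrightarrow> infinite (orb' ` \<phi> ` C)"
  shows "big M orb' (\<phi> ` A) \<alpha>"
  using assms(1,2)
proof induction
  case (big_zero A)
  show ?case by (rule big.big_zero)
next
  case (big_sup A f \<alpha>)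
  then show ?case by (meson big.big_sup)
next
  case (big_suc C A \<alpha>)
  have \<phi>C: "conthom \<phi> C N M" using conthom_subset[OF assms(3) big_suc(1)] big_suc by blast
  show ?case
  proof (rule big.big_suc)
    show "sgp (\<phi> ` C)" by (rule sgp_image[OF \<phi>C])
    show "cg M (\<phi> ` C)" by (rule cg_image[OF \<phi>C big_suc(3)])
    show "infinite (orb' ` \<phi> ` C)" using assms(4) big_suc by blast
    have "big M orb' (\<phi> ` res N C) \<alpha>"
      using big_suc res_subset by (metis order_trans)
    then show "big M orb' (res M (\<phi> ` C)) \<alpha>" using res_image[OF \<phi>C] by (rule big_subset)
  qed (use big_suc in blast)
qed

section \<open>The topology defined by a filter base\<close>

text \<open>Neighbourhoods are left translates of the traces on S of base members, so that one and
  the same N serves all subgroups of the ambient group.\<close>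

definition group_topology :: "'a::mgroup set set \<Rightarrow> 'a set \<Rightarrow> 'a topology" where
  "group_topology N S = topology (\<lambda>O'. O' \<subseteq> S \<and> (\<forall>g\<in>O'. \<exists>n\<in>N. \<forall>k\<in>S \<inter> n. g * k \<in> O'))"

definition TG :: "'a::mgroup set set \<Rightarrow> 'a set \<Rightarrow> 'a topgroup" where
  "TG N S = \<lparr>carrier = S, mult = (*), one = 1, topol = group_topology N S\<rparr>"

lemma TG_simps [simp]:
  "carrier (TG N S) = S" "x \<otimes>\<^bsub>TG N S\<^esub> y = x * y" "\<one>\<^bsub>TG N S\<^esub> = 1"
  "topol (TG N S) = group_topology N S"
  by (simp_all add: TG_def)

lemma openin_group_topology:
  assumes "filter_base N"
  shows "openin (group_topology N S) O' \<longleftrightarrow> O' \<subseteq> S \<and> (\<forall>g\<in>O'. \<exists>n\<in>N. \<forall>k\<in>S \<inter> n. g * k \<in> O')"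
proof -
  have "istopology (\<lambda>O'. O' \<subseteq> S \<and> (\<forall>g\<in>O'. \<exists>n\<in>N. \<forall>k\<in>S \<inter> n. g * k \<in> O'))"
    unfolding istopology_def
  proof (rule conjI, safe)
    fix A B g assume "\<forall>g\<in>A. \<exists>n\<in>N. \<forall>k\<in>S \<inter> n. g * k \<in> A" "\<forall>g\<in>B. \<exists>n\<in>N. \<forall>k\<in>S \<inter> n. g * k \<in> B"
      "g \<in> A" "g \<in> B"
    then obtain n m where nm: "n \<in> N" "m \<in> N" "\<forall>k\<in>S \<inter> n. g * k \<in> A" "\<forall>k\<in>S \<inter> m. g * k \<in> B"
      by blast
    obtain l where "l \<in> N" "l \<subseteq> n \<inter> m" using assms nm(1,2) unfolding filter_base_def by meson
    then show "\<exists>n\<in>N. \<forall>k\<in>S \<inter> n. g * k \<in> A \<inter> B" using nm by blast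
  next
    fix \<K> g A assume "\<forall>K\<in>\<K>. K \<subseteq> S \<and> (\<forall>g\<in>K. \<exists>n\<in>N. \<forall>k\<in>S \<inter> n. g * k \<in> K)" "g \<in> A" "A \<in> \<K>"
    then show "\<exists>n\<in>N. \<forall>k\<in>S \<inter> n. g * k \<in> \<Union>\<K>" by (meson UnionI)
  qed blast+
  then show ?thesis unfolding group_topology_def by (simp add: topology_inverse')
qed

lemma topspace_group_topology:
  assumes "filter_base N" "sgp S" shows "topspace (group_topology N S) = S"
proof -
  obtain n where "n \<in> N" using assms(1) by (auto simp: filter_base_def)
  then have "openin (group_topology N S) S"
    using assms(2) by (auto simp: openin_group_topology[OF assms(1)] sgp_mult)
  then show ?thesis
    by (metis assms(1) openin_group_topology openin_subset openin_topspace subset_antisym)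
qed

lemma group_TG: "sgp S \<Longrightarrow> group (TG N S)"
  by (rule groupI) (auto simp: sgp_one sgp_mult mult.assoc intro!: bexI[of _ "ginv _"] sgp_ginv)

lemma inv_TG: "sgp S \<Longrightarrow> x \<in> S \<Longrightarrow> inv\<^bsub>TG N S\<^esub> x = ginv x"
  by (rule group.inv_equality[OF group_TG]) (auto simp: sgp_ginv)

lemma subgroup_TG_iff: assumes "sgp S" shows "subgroup V (TG N S) \<longleftrightarrow> sgp V \<and> V \<subseteq> S"
proof
  assume V: "subgroup V (TG N S)"
  have VS: "V \<subseteq> S" using subgroup.subset[OF V] by simp
  show "sgp V \<and> V \<subseteq> S"
    using subgroup.one_closed[OF V] subgroup.m_closed[OF V] subgroup.m_inv_closed[OF V] VS
    by (metis (no_types, opaque_lifting) TG_simps(2,3) inv_TG[OF assms] sgpI subsetD)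
next
  assume "sgp V \<and> V \<subseteq> S"
  then show "subgroup V (TG N S)"
    by (intro group.subgroupI[OF group_TG[OF assms]])
      (auto simp: sgp_mult sgp_ginv inv_TG[OF assms] subset_iff dest: sgp_one)
qed

lemma normal_TG_iff: assumes "sgp S" shows "V \<lhd> TG N S \<longleftrightarrow> sgp V \<and> V \<subseteq> S \<and> nrm V S"
  using assms
  by (auto simp: group.normal_inv_iff[OF group_TG[OF assms]] subgroup_TG_iff nrm_def inv_TG)

lemma openin_subgroup_TG_iff:
  assumes "filter_base N" "sgp S" "sgp V" "V \<subseteq> S"
  shows "openin (group_topology N S) V \<longleftrightarrow> (\<exists>n\<in>N. S \<inter> n \<subseteq> V)"
proof
  assume "openin (group_topology N S) V"
  then obtain n where "n \<in> N" "\<forall>k\<in>S \<inter> n. 1 * k \<in> V"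
    using sgp_one[OF assms(3)] unfolding openin_group_topology[OF assms(1)] by blast
  then show "\<exists>n\<in>N. S \<inter> n \<subseteq> V" by auto
next
  assume "\<exists>n\<in>N. S \<inter> n \<subseteq> V"
  then obtain n where "n \<in> N" "S \<inter> n \<subseteq> V" by blast
  then have "\<forall>g\<in>V. \<exists>n\<in>N. \<forall>k\<in>S \<inter> n. g * k \<in> V"
    using sgp_mult[OF assms(3)] by (intro ballI bexI[of _ n]) auto
  then show "openin (group_topology N S) V"
    unfolding openin_group_topology[OF assms(1)] using assms(4) by blast
qed

lemma openin_filter_base:
  assumes "filter_base N" "sgp S" "n \<in> N" shows "openin (group_topology N S) (S \<inter> n)"
proof -
  have "sgp n" using assms by (simp add: filter_base_def)
  then show ?thesis
    by (intro iffD2[OF openin_subgroup_TG_iff[OF assms(1,2) sgp_Int]]) (use assms in auto)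
qed

lemma subtopology_group_topology:
  assumes N: "filter_base N" and S: "sgp S" and C: "sgp C" "C \<subseteq> S"
  shows "subtopology (group_topology N S) C = group_topology N C"
  unfolding topology_eq
proof (intro allI iffI)
  fix O' assume "openin (subtopology (group_topology N S) C) O'"
  then obtain P where P: "openin (group_topology N S) P" "O' = P \<inter> C" by (auto simp: openin_subtopology)
  have "\<exists>n\<in>N. \<forall>k\<in>C \<inter> n. g * k \<in> O'" if g: "g \<in> O'" for g
  proof -
    obtain n where "n \<in> N" "\<forall>k\<in>S \<inter> n. g * k \<in> P"
      using P g unfolding openin_group_topology[OF N] by blast
    then show ?thesis using g P(2) C sgp_mult[OF C(1)] by (intro bexI[of _ n]) auto
  qed
  then show "openin (group_topology N C) O'"
    unfolding openin_group_topology[OF N] using P(2) by blast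
next
  fix O' assume "openin (group_topology N C) O'"
  then have O': "O' \<subseteq> C" "\<forall>g\<in>O'. \<exists>n\<in>N. \<forall>k\<in>C \<inter> n. g * k \<in> O'"
    by (auto simp: openin_group_topology[OF N])
  then obtain m where m: "\<And>g. g \<in> O' \<Longrightarrow> m g \<in> N" "\<And>g k. g \<in> O' \<Longrightarrow> k \<in> C \<inter> m g \<Longrightarrow> g * k \<in> O'"
    by metis
  have sg: "sgp (m g)" if "g \<in> O'" for g using N m(1)[OF that] by (simp add: filter_base_def)
  \<comment> \<open>Every point of O' is thickened to a coset in S of a base subgroup that works for
    it. Such a coset meets C inside O', so the trace of the union on C is again O'.\<close>
  let ?P = "\<Union>g\<in>O'. (\<lambda>k. g * k) ` (S \<inter> m g)"
  have "openin (group_topology N S) ?P"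
    unfolding openin_group_topology[OF N]
  proof (intro conjI ballI)
    show "?P \<subseteq> S" using O'(1) C(2) S by (auto simp: sgp_mult subset_iff)
    fix x assume "x \<in> ?P"
    then obtain g k where gk: "g \<in> O'" "k \<in> S \<inter> m g" "x = g * k" by blast
    show "\<exists>n\<in>N. \<forall>l\<in>S \<inter> n. x * l \<in> ?P"
    proof (intro bexI[of _ "m g"] ballI)
      fix l assume "l \<in> S \<inter> m g"
      then have "x * l = g * (k * l)" "k * l \<in> S \<inter> m g"
        using gk S sg[OF gk(1)] by (auto simp: mult.assoc sgp_mult)
      then show "x * l \<in> ?P" using gk(1) by blast
    qed (rule m(1)[OF gk(1)])
  qed
  moreover have "O' = ?P \<inter> C"
  proof (intro subset_antisym subsetI)
    fix g assume "g \<in> O'"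
    then have "g \<in> (\<lambda>k. g * k) ` (S \<inter> m g)"
      using sgp_one[OF S] sgp_one[OF sg] by (intro image_eqI[of _ _ 1]) auto
    then show "g \<in> ?P \<inter> C" using \<open>g \<in> O'\<close> O'(1) by blast
  next
    fix x assume "x \<in> ?P \<inter> C"
    then obtain g k where gk: "g \<in> O'" "k \<in> S \<inter> m g" "x = g * k" "x \<in> C" by blast
    then have "ginv g * x \<in> C" using O'(1) by (intro sgp_mult[OF C(1)] sgp_ginv[OF C(1)]) auto
    then have "k \<in> C \<inter> m g" using gk(2) by (simp add: gk(3))
    then show "x \<in> O'" using m(2) gk by blast
  qed
  ultimately show "openin (subtopology (group_topology N S) C) O'"
    by (auto simp: openin_subtopology)
qed

lemma subgrp_TG:
  assumes "filter_base N" "sgp S" "sgp C" "C \<subseteq> S" shows "subgrp (TG N S) C = TG N C"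
  using subtopology_group_topology[OF assms] by (simp add: subgrp_def TG_def)

lemma Res_TG: assumes "filter_base N" "sgp S" shows "Res (TG N S) = res N S"
proof -
  have "{V. V \<lhd> TG N S \<and> openin (group_topology N S) V} = {V. relopen N S V \<and> nrm V S}"
    using assms openin_subgroup_TG_iff[OF assms]
    by (intro Collect_cong) (auto simp: normal_TG_iff relopen_def)
  moreover have "relopen N S S" "nrm S S"
    using assms by (auto simp: relopen_def filter_base_def nrm_def sgp_mult sgp_ginv)
  ultimately show ?thesis by (auto simp: Res_def res_def)
qed

lemma chain_stable_TG: assumes "filter_base N" "sgp S" "cg N S" shows "chain_stable (TG N S)"
  unfolding chain_stable_def TG_simps subgroup_TG_iff[OF assms(2)]
proof (intro allI impI)
  fix V :: "nat \<Rightarrow> 'a set"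
  assume V: "\<forall>i. (sgp (V i) \<and> V i \<subseteq> S) \<and> openin (group_topology N S) (V i) \<and> V i \<subseteq> V (Suc i)"
    and u: "(\<Union>i. V i) = S"
  have "relopen N S (V i)" for i
    using V openin_subgroup_TG_iff[OF assms(1,2), of "V i"] by (auto simp: relopen_def)
  then show "\<exists>i. V i = S" using cgD[OF assms(3), of V] V u by blast
qed

lemma continuous_map_conthom:
  assumes N: "filter_base N" and M: "filter_base M" and S: "sgp S" "sgp Q"
    and \<phi>: "conthom \<phi> S N M" "\<phi> ` S \<subseteq> Q"
  shows "continuous_map (group_topology N S) (group_topology M Q) \<phi>"
proof -
  have "\<exists>n\<in>N. \<forall>k\<in>S \<inter> n. \<phi> (g * k) \<in> O'"
    if g: "g \<in> S" "\<phi> g \<in> O'" and O': "\<forall>g\<in>O'. \<exists>m\<in>M. \<forall>k\<in>Q \<inter> m. g * k \<in> O'" for O' g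
  proof -
    obtain m where m: "m \<in> M" "\<forall>k\<in>Q \<inter> m. \<phi> g * k \<in> O'" using O' g(2) by blast
    obtain n where n: "n \<in> N" "\<phi> ` (S \<inter> n) \<subseteq> m" using \<phi>(1) m(1) unfolding conthom_def by blast
    have "\<phi> (g * k) \<in> O'" if "k \<in> S \<inter> n" for k
      using that m(2) n(2) \<phi>(2) conthom_mult[OF \<phi>(1) g(1)] by auto
    then show ?thesis using n(1) by blast
  qed
  then show ?thesis
    using \<phi>(2) S(1) unfolding continuous_map_def topspace_group_topology[OF N S(1)]
      topspace_group_topology[OF M S(2)] openin_group_topology[OF N] openin_group_topology[OF M]
    by (auto simp: sgp_mult)
qed

text \<open>Each use of \<open>big_suc\<close> is matched by one comparison step for C, which is
  non-trivial because its orbit is infinite.\<close>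

lemma big_imp_le_rank:
  assumes "big N orb A \<alpha>" "filter_base N" "sgp A" "cont_embedding \<phi> (TG N A) H" "has_rank H \<beta>"
  shows "\<alpha> \<le> \<beta>"
  using assms
proof (induction arbitrary: \<phi> H \<beta>)
  case (big_zero A)
  show ?case by simp
next
  case (big_sup A f \<alpha>)
  then have "osup (range f) \<le> \<beta>" by (auto simp: osup_range_le_iff)
  then show ?case using big_sup by simp
next
  case (big_suc C A \<alpha>)
  have tH: "topological_group H"
    using big_suc by (simp add: has_rank_imp_elementary elementary_imp_topological_group)
  have "cont_embedding \<phi> (subgrp (TG N A) C) (subgrp H (carrier H))"
    using big_suc by (intro cont_embedding_subgrp) (auto simp: cont_embedding_def hom_def)
  then have e: "cont_embedding \<phi> (TG N C) H"
    using big_suc by (simp add: subgrp_TG subgrp_self[OF tH])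
  have C: "group (TG N C)" "topspace (topol (TG N C)) = carrier (TG N C)" "chain_stable (TG N C)"
    using big_suc by (simp_all add: group_TG topspace_group_topology chain_stable_TG)
  have "C \<noteq> {1}" using big_suc(4) by auto
  then obtain K \<alpha>' where K: "has_rank (subgrp H K) \<alpha>'" "\<alpha>' + 1 \<le> \<beta>"
    "cont_embedding \<phi> (subgrp (TG N C) (Res (TG N C))) (subgrp H K)"
    using cont_embedding_rank_step[OF C(1,2) _ C(3) e big_suc(10)] by auto
  have "subgrp (TG N C) (Res (TG N C)) = TG N (res N C)"
    using big_suc by (simp add: Res_TG subgrp_TG sgp_res res_subset)
  then have "\<alpha> \<le> \<alpha>'" using big_suc.IH[of \<phi> "subgrp H K" \<alpha>'] K big_suc by (simp add: sgp_res)
  then show ?case using K(2) add_left_mono_countable_ord order_trans by blast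
qed

section \<open>Existence of the rank\<close>

text \<open>Choose a point in each non-empty member of a countable base. Every left coset of V is
  open, hence contains one of these points.\<close>

lemma countable_transversal_open_subgroup:
  assumes H: "tdlcsc_group H" and V: "subgroup V H" "openin (topol H) V"
  shows "\<exists>A. countable A \<and> A \<subseteq> carrier H \<and> (\<forall>x\<in>carrier H. \<exists>a\<in>A. inv\<^bsub>H\<^esub> a \<otimes>\<^bsub>H\<^esub> x \<in> V)"
proof -
  have tH: "topological_group H" and sc: "second_countable_space (topol H)"
    using H by (auto simp: tdlcsc_group_def)
  interpret group H using tH by (rule topological_group_group)
  obtain \<B> where B: "countable \<B>" "\<forall>B\<in>\<B>. openin (topol H) B"
    "\<forall>U. openin (topol H) U \<longrightarrow> (\<exists>\<U>\<subseteq>\<B>. U = \<Union>\<U>)"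
    using sc unfolding second_countable_space_def by blast
  define A where "A = (\<lambda>B. SOME b. b \<in> B) ` (\<B> - {{}})"
  have mem: "(SOME b. b \<in> B) \<in> B" if "B \<in> \<B> - {{}}" for B
    by (rule someI_ex) (use that in blast)
  have BH: "B \<subseteq> carrier H" if "B \<in> \<B>" for B
    using openin_subset[of "topol H" B] B(2) that topspace_topological_group[OF tH] by simp
  have "\<exists>a\<in>A. inv\<^bsub>H\<^esub> a \<otimes>\<^bsub>H\<^esub> x \<in> V" if x: "x \<in> carrier H" for x
  proof -
    let ?O = "(\<lambda>v. x \<otimes>\<^bsub>H\<^esub> v) ` V"
    have "openin (topol H) ?O" by (rule openin_translation[OF tH x V(2)])
    moreover have "x \<in> ?O"
      using x subgroup.one_closed[OF V(1)] by (intro image_eqI[of _ _ "\<one>\<^bsub>H\<^esub>"]) auto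
    moreover obtain \<U> where \<U>: "\<U> \<subseteq> \<B>" "?O = \<Union>\<U>"
      using B(3) calculation(1) by (meson)
    ultimately obtain b where "b \<in> \<U>" "x \<in> b" by (metis UnionE)
    then have b: "b \<in> \<B>" "x \<in> b" "b \<subseteq> ?O" using \<U>(1) by (auto simp only: \<U>(2))
    define a where "a = (SOME b'. b' \<in> b)"
    have a: "a \<in> b" "a \<in> A" using mem[of b] b by (auto simp: a_def A_def)
    obtain v where v: "v \<in> V" "a = x \<otimes>\<^bsub>H\<^esub> v" using a(1) b(3) by blast
    have vc: "v \<in> carrier H" by (rule subgroup.mem_carrier[OF V(1) v(1)])
    have "inv\<^bsub>H\<^esub> a \<otimes>\<^bsub>H\<^esub> x = inv\<^bsub>H\<^esub> v"
      using x vc by (simp add: v(2) inv_mult_group m_assoc)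
    then show ?thesis using a(2) subgroup.m_inv_closed[OF V(1) v(1)] by (intro bexI[of _ a]) simp_all
  qed
  moreover have "A \<subseteq> carrier H" using mem BH unfolding A_def by blast
  moreover have "countable A" unfolding A_def using B(1) by simp
  ultimately show ?thesis by blast
qed

text \<open>The subgroup \<open>U i\<close> is generated by V and the first i elements of a
  countable transversal. A compact set generates it, and it is open because it contains V.\<close>

lemma compactly_generated_exhaustion:
  assumes H: "tdlcsc_group H" and V: "subgroup V H" "openin (topol H) V" "compactin (topol H) V"
  obtains U :: "nat \<Rightarrow> 'a set" where "\<And>i. subgroup (U i) H" "\<And>i. openin (topol H) (U i)"
    "\<And>i. compactly_generated (subgrp H (U i))" "\<And>i. U i \<subseteq> U (Suc i)" "(\<Union>i. U i) = carrier H"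
proof -
  have tH: "topological_group H" using H by (simp add: tdlcsc_group_def)
  interpret group H using tH by (rule topological_group_group)
  obtain A where A: "countable A" "A \<subseteq> carrier H" "\<forall>x\<in>carrier H. \<exists>a\<in>A. inv\<^bsub>H\<^esub> a \<otimes>\<^bsub>H\<^esub> x \<in> V"
    using countable_transversal_open_subgroup[OF H V(1,2)] by blast
  define h where "h = from_nat_into (insert \<one>\<^bsub>H\<^esub> A)"
  have hr: "range h = insert \<one>\<^bsub>H\<^esub> A" unfolding h_def using A(1) by (simp add: range_from_nat_into)
  have hc: "h ` I \<subseteq> carrier H" for I
  proof -
    have "h ` I \<subseteq> range h" by blast
    also have "\<dots> \<subseteq> carrier H" unfolding hr using A(2) by simp
    finally show ?thesis .
  qed
  have VH: "V \<subseteq> carrier H" by (rule subgroup.subset[OF V(1)])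
  define K where "K i = V \<union> h ` {..<i}" for i
  have KH: "K i \<subseteq> carrier H" for i using VH hc by (auto simp: K_def)
  define U where "U i = generate H (K i)" for i
  have sub: "subgroup (U i) H" for i unfolding U_def by (rule generate_is_subgroup[OF KH])
  have KU: "K i \<subseteq> U i" for i unfolding U_def using generate.incl by fast
  have ne: "V \<noteq> {}" using subgroup.one_closed[OF V(1)] by blast
  have op: "openin (topol H) (U i)" for i
    by (rule openin_subgroup_of_open_subset[OF tH sub V(2) ne]) (use KU K_def in blast)
  have cgen: "compactly_generated (subgrp H (U i))" for i
    unfolding compactly_generated_def
  proof (intro exI conjI)
    have "compactin (topol H) (K i)" unfolding K_def
      using hc topspace_topological_group[OF tH]
      by (intro compactin_Un V finite_imp_compactin) auto
    then show "compactin (topol (subgrp H (U i))) (K i)" using KU by (simp add: compactin_subtopology)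
    have s: "subgroup (generate (subgrp H (U i)) (K i)) (subgrp H (U i))"
      by (rule group.generate_is_subgroup[OF group_subgrp[OF is_group sub]]) (use KU in simp)
    have "U i \<subseteq> generate (subgrp H (U i)) (K i)"
      unfolding U_def
    proof (rule generate_subgroup_incl)
      show "K i \<subseteq> generate (subgrp H (generate H (K i))) (K i)" using generate.incl by fast
      show "subgroup (generate (subgrp H (generate H (K i))) (K i)) H"
        using s by (simp add: subgroup_subgrp_iff[OF is_group sub] U_def[symmetric])
    qed
    then show "generate (subgrp H (U i)) (K i) = carrier (subgrp H (U i))"
      using subgroup.subset[OF s] by auto
  qed
  have incr: "U i \<subseteq> U (Suc i)" for i
    unfolding U_def by (rule mono_generate) (auto simp: K_def)
  have "(\<Union>i. U i) = carrier H"
  proof (intro subset_antisym subsetI)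
    show "x \<in> carrier H" if "x \<in> (\<Union>i. U i)" for x using that subgroup.subset[OF sub] by blast
    fix x assume x: "x \<in> carrier H"
    then obtain a where a: "a \<in> A" "inv\<^bsub>H\<^esub> a \<otimes>\<^bsub>H\<^esub> x \<in> V" using A(3) by blast
    obtain i where i: "h i = a" using hr a(1) by (metis insertI2 rangeE)
    have "a \<in> U (Suc i)" "inv\<^bsub>H\<^esub> a \<otimes>\<^bsub>H\<^esub> x \<in> U (Suc i)" using KU[of "Suc i"] i a(2) by (auto simp: K_def)
    then have "a \<otimes>\<^bsub>H\<^esub> (inv\<^bsub>H\<^esub> a \<otimes>\<^bsub>H\<^esub> x) \<in> U (Suc i)" by (rule subgroup.m_closed[OF sub])
    moreover have "a \<otimes>\<^bsub>H\<^esub> (inv\<^bsub>H\<^esub> a \<otimes>\<^bsub>H\<^esub> x) = x"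
      using a(1) A(2) x by (auto simp: subset_iff simp flip: m_assoc)
    ultimately show "x \<in> (\<Union>i. U i)" by auto
  qed
  then show ?thesis using that sub op cgen incr by blast
qed

text \<open>Induction on well-foundedness. The exhaustion of H by compactly generated open subgroups
  maps to subgroups of S satisfying \<open>cg\<close>, and each residual embeds into a residual to
  which the induction hypothesis applies. The compact open subgroup is part of the induction because
  the exhaustion needs one; its intersection with a closed residual serves for that
  residual.\<close>

lemma wfr_imp_has_rank:
  assumes "wfr N S" "filter_base N" "sgp S" "elementary H" "cont_embedding \<psi> H (TG N S)"
    and "subgroup V H" "openin (topol H) V" "compactin (topol H) V"
  shows "\<exists>\<alpha>. has_rank H \<alpha>"
  using assms
proof (induction S arbitrary: H \<psi> V rule: wfr.induct)
  case (wfrI S)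
  note N = \<open>filter_base N\<close> and S = \<open>sgp S\<close> and el = \<open>elementary H\<close> and \<psi> = \<open>cont_embedding \<psi> H (TG N S)\<close>
    and V = \<open>subgroup V H\<close> \<open>openin (topol H) V\<close> \<open>compactin (topol H) V\<close>
  have H: "topological_group H" using el by (rule elementary_imp_topological_group)
  have tH: "tdlcsc_group H" using el by (rule elementary_imp_tdlcsc)
  have g: "group H" using H by (rule topological_group_group)
  have gS: "group (TG N S)" by (rule group_TG[OF S])
  have hom: "\<psi> \<in> hom H (TG N S)" and inj: "inj_on \<psi> (carrier H)"
    and ct: "continuous_map (topol H) (group_topology N S) \<psi>"
    using \<psi> by (auto simp: cont_embedding_def)
  show ?case
  proof (cases "carrier H = {\<one>\<^bsub>H\<^esub>}")
    case True
    then show ?thesis using has_rank.trivial[OF el] by blast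
  next
    case False
    obtain U :: "nat \<Rightarrow> nat set set" where U: "\<And>i. subgroup (U i) H" "\<And>i. openin (topol H) (U i)"
      "\<And>i. compactly_generated (subgrp H (U i))" "\<And>i. U i \<subseteq> U (Suc i)" "(\<Union>i. U i) = carrier H"
      using compactly_generated_exhaustion[OF tH V] by blast
    have "\<exists>\<alpha>. has_rank (subgrp H (Res (subgrp H (U i)))) \<alpha>" for i
    proof -
      let ?U = "subgrp H (U i)" and ?R = "Res (subgrp H (U i))"
      let ?H = "subgrp H ?R" and ?C = "\<psi> ` U i"
      have R: "subgroup ?R H" "?R \<subseteq> U i" by (rule subgroup_Res_subgrp[OF H U(1)])+
      have cR: "closedin (topol H) ?R" by (rule closedin_Res_subgrp[OF H U(1,2)])
      have elR: "elementary ?H" by (rule elementary.subgroup[OF el R(1) cR])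
      have UH: "U i \<subseteq> carrier H" by (rule subgroup.subset[OF U(1)])
      have tU: "topological_group ?U" by (rule topological_group_subgrp[OF H U(1)])
      have gU: "group ?U" by (rule topological_group_group[OF tU])
      interpret group_hom H "TG N S" \<psi> by (rule group_hom_intro[OF g gS hom])
      have "subgroup ?C (TG N S)" by (rule subgroup_img_is_subgroup[OF U(1)])
      then have C: "sgp ?C" "?C \<subseteq> S" by (simp_all add: subgroup_TG_iff[OF S])
      have emb: "cont_embedding \<psi> ?U (TG N ?C)"
        using cont_embedding_subgrp[OF \<psi> UH, of ?C] by (simp add: subgrp_TG[OF N S C])
      have cgC: "cg N ?C"
        unfolding cg_def
      proof (intro allI impI)
        fix W :: "nat \<Rightarrow> 'a set" assume W: "\<forall>i. relopen N ?C (W i) \<and> W i \<subseteq> W (Suc i)"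
          and u: "(\<Union>i. W i) = ?C"
        have sW: "subgroup (W j) (TG N ?C)" "openin (topol (TG N ?C)) (W j)" for j
          using W N C(1) openin_subgroup_TG_iff[OF N C(1), of "W j"]
          by (auto simp: subgroup_TG_iff relopen_def)
        let ?X = "\<lambda>j. {x \<in> carrier ?U. \<psi> x \<in> W j}"
        have "subgroup (?X j) ?U" for j
          using emb by (intro subgroup_vimage[OF gU group_TG[OF C(1)] _ sW(1)]) (simp add: cont_embedding_def)
        moreover have "openin (topol ?U) (?X j)" for j
          using openin_continuous_map_preimage[OF _ sW(2)] emb topspace_topological_group[OF tU]
          by (fastforce simp: cont_embedding_def)
        moreover have "?X j \<subseteq> ?X (Suc j)" for j using W by blast
        moreover have "(\<Union>j. ?X j) = carrier ?U" using u by auto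
        ultimately have "\<exists>j. ?X j = carrier ?U"
          using compactly_generated_imp_chain_stable[OF gU U(3)] unfolding chain_stable_def by simp
        then obtain j where "?X j = carrier ?U" ..
        then have "?C \<subseteq> W j" by auto
        moreover have "W j \<subseteq> ?C" using u by blast
        ultimately show "\<exists>j. W j = ?C" by blast
      qed
      show ?thesis
      proof (cases "?C = {1}")
        case True
        have "x = \<one>\<^bsub>H\<^esub>" if "x \<in> U i" for x
        proof (rule inj_onD[OF inj])
          show "\<psi> x = \<psi> \<one>\<^bsub>H\<^esub>" using True that by auto
        qed (use that UH in auto)
        then have "?R = {\<one>\<^bsub>H\<^esub>}" using R subgroup.one_closed[OF R(1)] by blast
        then show ?thesis using has_rank.trivial[OF elR] by auto
      next
        case False
        have "\<psi> ` ?R \<subseteq> res N ?C"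
          using Res_image_subset[OF gU group_TG[OF C(1), of N], of \<psi>] emb topspace_topological_group[OF tU]
          by (simp add: cont_embedding_def Res_TG[OF N C(1)])
        then have e: "cont_embedding \<psi> ?H (TG N (res N ?C))"
          using cont_embedding_subgrp[OF emb, of ?R "res N ?C"] R(2)
          by (simp add: subgrp_subgrp subgrp_TG[OF N C(1) sgp_res[OF C(1)] res_subset])
        have sV: "subgroup (V \<inter> ?R) ?H"
          using group.subgroups_Inter_pair[OF g V(1) R(1)] by (simp add: subgroup_subgrp_iff[OF g R(1)])
        have oV: "openin (topol ?H) (V \<inter> ?R)"
          using V(2) by (auto simp: openin_subtopology)
        have "compactin (topol H) (V \<inter> ?R)" by (rule compact_Int_closedin[OF V(3) cR])
        then have kV: "compactin (topol ?H) (V \<inter> ?R)" by (simp add: compactin_subtopology)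
        show ?thesis
          by (rule wfrI(2)[OF C cgC False N sgp_res[OF C(1)] elR e sV oV kV])
      qed
    qed
    then obtain \<alpha> where "\<And>i. has_rank (subgrp H (Res (subgrp H (U i)))) (\<alpha> i)" by metis
    then show ?thesis using has_rank.increasing_union[OF el False U(1-3,4,5)] by blast
  qed
qed

section \<open>Topological isomorphisms and elementary groups\<close>

lemma topgroup_iso_sym:
  assumes G: "topological_group G" and H: "topspace (topol H) = carrier H" and iso: "G \<cong>\<^sub>t H"
  shows "H \<cong>\<^sub>t G"
proof -
  obtain f where f: "f \<in> iso G H" "homeomorphic_map (topol G) (topol H) f"
    using iso by (auto simp: topgroup_iso_def)
  obtain g where g: "homeomorphic_maps (topol G) (topol H) f g"
    using f(2) by (auto simp: homeomorphic_map_maps)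
  let ?g = "inv_into (carrier G) f"
  have i: "?g \<in> iso H G" by (rule group.iso_set_sym[OF topological_group_group[OF G] f(1)])
  have inj: "inj_on f (carrier G)" using f(1) by (auto simp: iso_def bij_betw_def)
  have eq: "g y = ?g y" if "y \<in> topspace (topol H)" for y
  proof -
    have "g y \<in> carrier G" "f (g y) = y"
      using g that topspace_topological_group[OF G]
      by (auto simp: homeomorphic_maps_def continuous_map_def)
    then show ?thesis using inv_into_f_f[OF inj, of "g y"] by simp
  qed
  have "homeomorphic_map (topol H) (topol G) g"
    using g homeomorphic_maps_map by blast
  then have "homeomorphic_map (topol H) (topol G) ?g"
    by (rule homeomorphic_map_eq) (rule eq)
  then show ?thesis using i by (auto simp: topgroup_iso_def)
qed

lemma topgroup_iso_trans: "G \<cong>\<^sub>t H \<Longrightarrow> H \<cong>\<^sub>t K \<Longrightarrow> G \<cong>\<^sub>t K"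
  unfolding topgroup_iso_def by (blast intro: homeomorphic_map_compose iso_set_trans)

lemma subgroup_iso_image:
  assumes "group G" "group H" "f \<in> iso G H" "subgroup C G" shows "subgroup (f ` C) H"
  using group_hom.subgroup_img_is_subgroup[OF group_hom_intro[OF assms(1,2)] assms(4), of f] assms(3)
  by (simp add: iso_def)

lemma subgrp_topgroup_iso:
  assumes C: "C \<subseteq> carrier G" and ts: "topspace (topol G) = carrier G"
    and f: "f \<in> iso G H" "homeomorphic_map (topol G) (topol H) f"
  shows "subgrp G C \<cong>\<^sub>t subgrp H (f ` C)"
proof -
  have "f ` carrier G = carrier H" using f(1) by (auto simp: iso_def bij_betw_def)
  moreover have "f ` topspace (topol G) = topspace (topol H)"
    using f(2) by (rule homeomorphic_imp_surjective_map)
  ultimately have "f ` (topspace (topol G) \<inter> C) = topspace (topol H) \<inter> f ` C"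
    using C ts by (auto simp: Int_absorb1)
  then have "homeomorphic_map (topol (subgrp G C)) (topol (subgrp H (f ` C))) f"
    using homeomorphic_map_subtopologies[OF f(2)] by simp
  moreover have "f \<in> iso (subgrp G C) (subgrp H (f ` C))"
    using f(1) C by (auto simp: iso_def hom_def bij_betw_def inj_on_def subset_iff)
  ultimately show ?thesis by (auto simp: topgroup_iso_def)
qed

lemma homeomorphic_map_imp_quotient_map: "homeomorphic_map X Y f \<Longrightarrow> quotient_map X Y f"
  by (simp add: homeomorphic_map_def)

text \<open>First isomorphism theorem in topological form: the coset projection and \<phi> are
  quotient maps with the same fibres.\<close>

lemma quotgrp_topgroup_iso:
  assumes H: "topological_group H" and Q: "topological_group Q" and hom: "\<phi> \<in> hom H Q"
    and qm: "quotient_map (topol H) (topol Q) \<phi>"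
  shows "quotgrp H (kernel H Q \<phi>) \<cong>\<^sub>t Q"
proof -
  let ?N = "kernel H Q \<phi>" and ?f = "\<lambda>X. the_elem (\<phi> ` X)"
  interpret group_hom H Q \<phi>
    by (rule group_hom_intro[OF topological_group_group[OF H] topological_group_group[OF Q] hom])
  have N: "?N \<lhd> H" by (rule normal_kernel)
  have surj: "\<phi> ` carrier H = carrier Q"
    using qm by (simp add: quotient_map_def topspace_topological_group[OF H] topspace_topological_group[OF Q])
  have iso: "?f \<in> iso (H Mod ?N) Q" by (rule FactGroup_iso_set[OF surj])
  have iso': "?f \<in> iso (quotgrp H ?N) Q"
    using iso by (simp add: iso_def hom_def FactGroup_def)
  have q: "quotient_map (topol H) (topol (quotgrp H ?N)) (\<lambda>x. ?N #>\<^bsub>H\<^esub> x)"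
    by (rule quotient_map_quotgrp[OF H N])
  have comp: "(?f \<circ> (\<lambda>x. ?N #>\<^bsub>H\<^esub> x)) x = \<phi> x" if "x \<in> topspace (topol H)" for x
  proof -
    have x: "x \<in> carrier H" using that by (simp add: topspace_topological_group[OF H])
    have "\<phi> ` (?N #>\<^bsub>H\<^esub> x) = {\<phi> x}"
      using x G.one_closed by (force simp: r_coset_def kernel_def image_iff)
    then show ?thesis by simp
  qed
  have "quotient_map (topol H) (topol Q) (?f \<circ> (\<lambda>x. ?N #>\<^bsub>H\<^esub> x))"
    using qm by (rule quotient_map_eq) (rule comp[symmetric])
  then have "quotient_map (topol (quotgrp H ?N)) (topol Q) ?f"
    using quotient_map_compose_eq[OF q] by blast
  moreover have "inj_on ?f (topspace (topol (quotgrp H ?N)))"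
  proof -
    have "topspace (topol (quotgrp H ?N)) = rcosets\<^bsub>H\<^esub> ?N"
      unfolding quotient_imp_surjective_map[OF q, symmetric] topspace_topological_group[OF H]
      unfolding RCOSETS_def by (rule UNION_singleton_eq_range[symmetric])
    then show ?thesis using iso by (simp add: iso_def bij_betw_def FactGroup_def)
  qed
  ultimately have "homeomorphic_map (topol (quotgrp H ?N)) (topol Q) ?f"
    unfolding homeomorphic_map_def by (rule conjI)
  then show ?thesis using iso' by (auto simp: topgroup_iso_def)
qed

text \<open>Invariance under isomorphism is not a rule of the class, but H is an extension of its
  trivial kernel by Q.\<close>

lemma elementary_topgroup_iso:
  assumes Q: "elementary Q" and H: "tdlcsc_group H" and iso: "H \<cong>\<^sub>t Q"
  shows "elementary H"
proof -
  have tH: "topological_group H" and hs: "Hausdorff_space (topol H)"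
    using H by (auto simp: tdlcsc_group_def)
  have tQ: "topological_group Q" using Q by (rule elementary_imp_topological_group)
  interpret group H using tH by (rule topological_group_group)
  obtain f where f: "f \<in> iso H Q" "homeomorphic_map (topol H) (topol Q) f"
    using iso by (auto simp: topgroup_iso_def)
  have fh: "f \<in> hom H Q" using f(1) by (simp add: iso_def)
  let ?N = "kernel H Q f"
  interpret group_hom H Q f by (rule group_hom_intro[OF is_group topological_group_group[OF tQ] fh])
  have N1: "?N = {\<one>\<^bsub>H\<^esub>}"
    using f(1) inj_iff_trivial_ker by (auto simp: iso_def bij_betw_def)
  have c: "closedin (topol H) ?N"
    unfolding N1 by (rule closedin_Hausdorff_singleton[OF hs]) (simp add: topspace_topological_group[OF tH])
  have "tdlcsc_group (subgrp H ?N)"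
    by (rule tdlcsc_group_subgrp[OF H _ c]) (simp add: subgroup_kernel)
  moreover have "compact_space (topol (subgrp H ?N))"
    unfolding N1 using topspace_topological_group[OF tH]
    by (simp add: compact_space_subtopology finite_imp_compactin)
  ultimately have "elementary (subgrp H ?N)" by (rule elementary.profinite)
  moreover have "quotgrp H ?N \<cong>\<^sub>t Q"
    by (rule quotgrp_topgroup_iso[OF tH tQ fh homeomorphic_map_imp_quotient_map[OF f(2)]])
  ultimately show ?thesis using elementary.extension[OF H normal_kernel c _ Q] by blast
qed

text \<open>The inductive class lives on the type \<open>nat set\<close>; this version speaks about
  groups on arbitrary types, such as permutation groups.\<close>

definition iso_elementary :: "'a topgroup \<Rightarrow> bool" where
  "iso_elementary G \<longleftrightarrow> (\<exists>H :: nat set topgroup. elementary H \<and> G \<cong>\<^sub>t H)"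

lemma iso_elementary_imp_Hausdorff:
  assumes "iso_elementary G" shows "Hausdorff_space (topol G)"
proof -
  obtain H where H: "elementary H" "G \<cong>\<^sub>t H" using assms by (auto simp: iso_elementary_def)
  have "Hausdorff_space (topol H)" using elementary_imp_tdlcsc[OF H(1)] by (simp add: tdlcsc_group_def)
  then show ?thesis
    using H(2) homeomorphic_Hausdorff_space homeomorphic_map_imp_homeomorphic_space
    unfolding topgroup_iso_def by blast
qed

lemma iso_elementary_compact:
  assumes "tdlcsc_group G" "compact_space (topol G)" shows "iso_elementary G"
proof -
  obtain H :: "nat set topgroup" where H: "tdlcsc_group H" "G \<cong>\<^sub>t H"
    using tdlcsc_group_universe[OF assms(1)] by blast
  then have "compact_space (topol H)"
    using assms(2) homeomorphic_compact_space homeomorphic_map_imp_homeomorphic_space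
    unfolding topgroup_iso_def by blast
  then show ?thesis using H elementary.profinite by (auto simp: iso_elementary_def)
qed

lemma iso_elementary_discrete:
  assumes G: "tdlcsc_group G" and "countable (carrier G)" "topol G = discrete_topology (carrier G)"
  shows "iso_elementary G"
proof -
  obtain H :: "nat set topgroup" where H: "tdlcsc_group H" "G \<cong>\<^sub>t H"
    using tdlcsc_group_universe[OF G] by blast
  then obtain f where f: "f \<in> iso G H" "homeomorphic_map (topol G) (topol H) f"
    by (auto simp: topgroup_iso_def)
  have im: "carrier H = f ` carrier G" using f(1) by (auto simp: iso_def bij_betw_def)
  have "topspace (topol H) = carrier H" using H(1) by (simp add: tdlcsc_group_def topological_group_def)
  moreover have "openin (topol H) {y}" if y: "y \<in> carrier H" for y
  proof -
    obtain x where "x \<in> carrier G" "y = f x" using y im by blast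
    then have "openin (topol H) (f ` {x})"
      using homeomorphic_map_openness[OF f(2), of "{x}"] assms(3) by simp
    then show ?thesis using \<open>y = f x\<close> by simp
  qed
  ultimately have "topol H = discrete_topology (carrier H)"
    using discrete_topology_unique[of "carrier H" "topol H"] by metis
  moreover have "countable (carrier H)" using im assms(2) by simp
  ultimately show ?thesis using H elementary.discrete by (auto simp: iso_elementary_def)
qed

lemma iso_elementary_subgroup:
  assumes G: "topological_group G" and el: "iso_elementary G"
    and C: "subgroup C G" "closedin (topol G) C"
  shows "iso_elementary (subgrp G C)"
proof -
  obtain H f where H: "elementary H" and f: "f \<in> iso G H" "homeomorphic_map (topol G) (topol H) f"
    using el by (auto simp: iso_elementary_def topgroup_iso_def)
  have gH: "group H" using H by (simp add: elementary_imp_topological_group topological_group_group)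
  have "subgroup (f ` C) H" by (rule subgroup_iso_image[OF topological_group_group[OF G] gH f(1) C(1)])
  moreover have "closedin (topol H) (f ` C)"
    using homeomorphic_map_closedness[OF f(2) closedin_subset[OF C(2)]] C(2) by simp
  ultimately have "elementary (subgrp H (f ` C))" by (rule elementary.subgroup[OF H])
  moreover have "subgrp G C \<cong>\<^sub>t subgrp H (f ` C)"
    by (rule subgrp_topgroup_iso[OF subgroup.subset[OF C(1)] topspace_topological_group[OF G] f])
  ultimately show ?thesis by (auto simp: iso_elementary_def)
qed

lemma iso_elementary_transfer:
  assumes G: "topological_group G" and H: "tdlcsc_group H" and GH: "G \<cong>\<^sub>t H" and el: "iso_elementary G"
  shows "elementary H"
proof -
  obtain Q where Q: "elementary Q" "G \<cong>\<^sub>t Q" using el by (auto simp: iso_elementary_def)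
  have "H \<cong>\<^sub>t G"
    using H GH by (intro topgroup_iso_sym[OF G]) (simp add: tdlcsc_group_def topological_group_def)
  then have "H \<cong>\<^sub>t Q" using Q(2) by (rule topgroup_iso_trans)
  then show ?thesis by (rule elementary_topgroup_iso[OF Q(1) H])
qed

lemma iso_elementary_union:
  assumes G: "tdlcsc_group G" and U: "\<And>i::nat. subgroup (U i) G" "\<And>i. openin (topol G) (U i)"
    "\<And>i. U i \<subseteq> U (Suc i)" "(\<Union>i. U i) = carrier G" and el: "\<And>i. iso_elementary (subgrp G (U i))"
  shows "iso_elementary G"
proof -
  have tG: "topological_group G" using G by (simp add: tdlcsc_group_def)
  have gG: "group G" using tG by (rule topological_group_group)
  obtain H :: "nat set topgroup" where H: "tdlcsc_group H" "G \<cong>\<^sub>t H"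
    using tdlcsc_group_universe[OF G] by blast
  then obtain f where f: "f \<in> iso G H" "homeomorphic_map (topol G) (topol H) f"
    by (auto simp: topgroup_iso_def)
  have tH: "topological_group H" using H(1) by (simp add: tdlcsc_group_def)
  have im: "carrier H = f ` carrier G" using f(1) by (auto simp: iso_def bij_betw_def)
  have s: "subgroup (f ` U i) H" for i
    by (rule subgroup_iso_image[OF gG topological_group_group[OF tH] f(1) U(1)])
  have o: "openin (topol H) (f ` U i)" for i
    using homeomorphic_map_openness[OF f(2) openin_subset[OF U(2)]] U(2) by simp
  have "elementary H"
  proof (rule elementary.increasing_union[OF H(1) s o])
    show "f ` U i \<subseteq> f ` U (Suc i)" for i by (rule image_mono[OF U(3)])
    show "(\<Union>i. f ` U i) = carrier H" unfolding im U(4)[symmetric] by (rule image_UN[symmetric])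
    show "elementary (subgrp H (f ` U i))" for i
    proof (rule iso_elementary_transfer[OF topological_group_subgrp[OF tG U(1)] _ _ el])
      show "tdlcsc_group (subgrp H (f ` U i))"
        by (rule tdlcsc_group_subgrp[OF H(1) s closedin_open_subgroup[OF tH s o]])
      show "subgrp G (U i) \<cong>\<^sub>t subgrp H (f ` U i)"
        by (rule subgrp_topgroup_iso[OF subgroup.subset[OF U(1)] topspace_topological_group[OF tG] f])
    qed
  qed
  then show ?thesis using H(2) by (auto simp: iso_elementary_def)
qed

lemma iso_elementary_split_extension:
  assumes G: "tdlcsc_group G" and Q: "topological_group Q" "iso_elementary Q"
    and hom: "\<phi> \<in> hom G Q" and ct: "continuous_map (topol G) (topol Q) \<phi>"
    and s: "continuous_map (topol Q) (topol G) s" "\<And>q. q \<in> carrier Q \<Longrightarrow> \<phi> (s q) = q"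
    and ker: "iso_elementary (subgrp G (kernel G Q \<phi>))"
  shows "iso_elementary G"
proof -
  have tG: "topological_group G" using G by (simp add: tdlcsc_group_def)
  have gG: "group G" using tG by (rule topological_group_group)
  have gQ: "group Q" using Q(1) by (rule topological_group_group)
  obtain H :: "nat set topgroup" where H: "tdlcsc_group H" "G \<cong>\<^sub>t H"
    using tdlcsc_group_universe[OF G] by blast
  obtain f where f: "f \<in> iso G H" "homeomorphic_map (topol G) (topol H) f"
    using H(2) by (auto simp: topgroup_iso_def)
  have tH: "topological_group H" using H(1) by (simp add: tdlcsc_group_def)
  have gH: "group H" using tH by (rule topological_group_group)
  have "H \<cong>\<^sub>t G" by (rule topgroup_iso_sym[OF tG topspace_topological_group[OF tH] H(2)])
  let ?g = "inv_into (carrier G) f"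
  have gi: "?g \<in> iso H G" by (rule group.iso_set_sym[OF gG f(1)])
  have bij: "bij_betw f (carrier G) (carrier H)" using f(1) by (auto simp: iso_def)
  obtain g' where g': "homeomorphic_maps (topol G) (topol H) f g'"
    using f(2) by (auto simp: homeomorphic_map_maps)
  have eq: "g' y = ?g y" if "y \<in> topspace (topol H)" for y
  proof -
    have "g' y \<in> carrier G" "f (g' y) = y"
      using g' that topspace_topological_group[OF tG]
      by (auto simp: homeomorphic_maps_def continuous_map_def)
    then show ?thesis using inv_into_f_f[of f "carrier G" "g' y"] bij by (simp add: bij_betw_def)
  qed
  have "homeomorphic_map (topol H) (topol G) g'" using g' homeomorphic_maps_map by blast
  then have gh: "homeomorphic_map (topol H) (topol G) ?g"
    by (rule homeomorphic_map_eq) (rule eq)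
  have "retraction_maps (topol G) (topol Q) \<phi> s"
    using ct s by (simp add: retraction_maps_def topspace_topological_group[OF Q(1)])
  then have "quotient_map (topol G) (topol Q) \<phi>"
    by (intro retraction_imp_quotient_map) (auto simp: retraction_map_def)
  then have qm: "quotient_map (topol H) (topol Q) (\<phi> \<circ> ?g)"
    using homeomorphic_map_imp_quotient_map[OF gh] quotient_map_compose by blast
  have hom': "\<phi> \<circ> ?g \<in> hom H Q" using gi hom by (auto simp: iso_def intro: hom_compose)
  let ?N = "kernel H Q (\<phi> \<circ> ?g)"
  interpret group_hom H Q "\<phi> \<circ> ?g" by (rule group_hom_intro[OF gH gQ hom'])
  have N: "?N = f ` kernel G Q \<phi>"
  proof (intro subset_antisym subsetI)
    fix x assume "x \<in> f ` kernel G Q \<phi>"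
    then show "x \<in> ?N" using bij by (auto simp: kernel_def bij_betw_def inv_into_f_f)
  next
    fix x assume x: "x \<in> ?N"
    then have "x = f (?g x)" "?g x \<in> carrier G"
      using bij by (auto simp: kernel_def bij_betw_def f_inv_into_f inv_into_into)
    then show "x \<in> f ` kernel G Q \<phi>" using x by (auto simp: kernel_def)
  qed
  obtain Q' where Q': "elementary Q'" "Q \<cong>\<^sub>t Q'" using Q(2) by (auto simp: iso_elementary_def)
  have hQ: "Hausdorff_space (topol Q)" by (rule iso_elementary_imp_Hausdorff[OF Q(2)])
  have "closedin (topol Q) {\<one>\<^bsub>Q\<^esub>}"
    by (rule closedin_Hausdorff_singleton[OF hQ]) (simp add: topspace_topological_group[OF Q(1)])
  then have "closedin (topol H) {x \<in> topspace (topol H). (\<phi> \<circ> ?g) x \<in> {\<one>\<^bsub>Q\<^esub>}}"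
    by (rule closedin_continuous_map_preimage[OF quotient_imp_continuous_map[OF qm]])
  moreover have "{x \<in> topspace (topol H). (\<phi> \<circ> ?g) x \<in> {\<one>\<^bsub>Q\<^esub>}} = ?N"
    by (auto simp: kernel_def topspace_topological_group[OF tH])
  ultimately have c: "closedin (topol H) ?N" by simp
  have kG: "subgroup (kernel G Q \<phi>) G"
    by (rule group_hom.subgroup_kernel[OF group_hom_intro[OF gG gQ hom]])
  have "subgrp G (kernel G Q \<phi>) \<cong>\<^sub>t subgrp H ?N"
    unfolding N by (rule subgrp_topgroup_iso[OF subgroup.subset[OF kG] topspace_topological_group[OF tG] f])
  then have elN: "elementary (subgrp H ?N)"
    using iso_elementary_transfer[OF topological_group_subgrp[OF tG kG]
        tdlcsc_group_subgrp[OF H(1) subgroup_kernel c] _ ker] by blast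
  have "quotgrp H ?N \<cong>\<^sub>t Q'"
    using quotgrp_topgroup_iso[OF tH Q(1) hom' qm] Q'(2) by (rule topgroup_iso_trans)
  then have "elementary H" by (rule elementary.extension[OF H(1) normal_kernel c elN Q'(1)])
  then show ?thesis using H(2) by (auto simp: iso_elementary_def)
qed

section \<open>Locally compact groups given by a filter base\<close>

text \<open>The assumption \<open>conj_nbhd\<close> is what continuity of multiplication and
  inversion uses; the remaining group topology axioms come from the base consisting of
  subgroups.\<close>

locale filtered_group =
  fixes N :: "'a::mgroup set set" and S :: "'a set"
  assumes filter_base: "filter_base N"
    and sgp_S: "sgp S"
    and conj_nbhd: "\<And>g n. g \<in> S \<Longrightarrow> n \<in> N \<Longrightarrow> \<exists>m\<in>N. \<forall>k\<in>S \<inter> m. g * k * ginv g \<in> n"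
begin

abbreviation T where "T \<equiv> group_topology N S"

lemma sgp_base: "n \<in> N \<Longrightarrow> sgp n"
  using filter_base by (simp add: filter_base_def)

lemma base_quotient: "n \<in> N \<Longrightarrow> a \<in> n \<Longrightarrow> b \<in> n \<Longrightarrow> ginv a * b \<in> n"
  by (simp add: sgp_base sgp_mult sgp_ginv)

lemma base_mult: "n \<in> N \<Longrightarrow> a \<in> n \<Longrightarrow> b \<in> n \<Longrightarrow> a * b \<in> n"
  by (simp add: sgp_base sgp_mult)

lemma topspace_T: "topspace T = S"
  by (rule topspace_group_topology[OF filter_base sgp_S])

lemma base_Int: "n \<in> N \<Longrightarrow> m \<in> N \<Longrightarrow> \<exists>k\<in>N. k \<subseteq> n \<inter> m"
  using filter_base unfolding filter_base_def by blast

definition coset :: "'a \<Rightarrow> 'a set \<Rightarrow> 'a set" where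
  "coset g n = (\<lambda>k. g * k) ` (S \<inter> n)"

lemma mem_coset_iff: "g \<in> S \<Longrightarrow> x \<in> coset g n \<longleftrightarrow> x \<in> S \<and> ginv g * x \<in> n"
  unfolding coset_def using sgp_S
  by (auto simp: sgp_mult sgp_ginv intro!: image_eqI[of _ _ "ginv g * x"])

lemma openin_coset: assumes "g \<in> S" "n \<in> N" shows "openin T (coset g n)"
  unfolding openin_group_topology[OF filter_base]
proof (intro conjI ballI)
  show "coset g n \<subseteq> S" using assms by (auto simp: mem_coset_iff)
  fix x assume "x \<in> coset g n"
  then show "\<exists>m\<in>N. \<forall>k\<in>S \<inter> m. x * k \<in> coset g n"
    using assms sgp_S sgp_base[OF assms(2)]
    by (intro bexI[of _ n]) (auto simp: mem_coset_iff sgp_mult simp flip: mult.assoc)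
qed

lemma self_mem_coset: "g \<in> S \<Longrightarrow> n \<in> N \<Longrightarrow> g \<in> coset g n"
  by (simp add: mem_coset_iff sgp_one sgp_base)

lemma openinD_coset:
  assumes "openin T O'" "g \<in> O'" obtains n where "n \<in> N" "coset g n \<subseteq> O'"
proof -
  obtain n where "n \<in> N" "\<forall>k\<in>S \<inter> n. g * k \<in> O'"
    using assms by (auto simp: openin_group_topology[OF filter_base])
  then show ?thesis by (intro that[of n]) (auto simp: coset_def)
qed

lemma openinI_coset:
  assumes "O' \<subseteq> S" "\<And>g. g \<in> O' \<Longrightarrow> \<exists>n\<in>N. coset g n \<subseteq> O'" shows "openin T O'"
  using assms by (simp add: openin_group_topology[OF filter_base] coset_def image_subset_iff)

lemma closedin_iff:
  assumes "C \<subseteq> S"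
  shows "closedin T C \<longleftrightarrow> (\<forall>g\<in>S - C. \<exists>n\<in>N. \<forall>k\<in>S \<inter> n. g * k \<notin> C)"
  using assms sgp_S unfolding closedin_def topspace_T openin_group_topology[OF filter_base]
  by (simp add: sgp_mult)

text \<open>The complement is a union of cosets of the same subgroup n. Clopen cosets later give
  total disconnectedness.\<close>

lemma closedin_coset: assumes "g \<in> S" "n \<in> N" shows "closedin T (coset g n)"
proof (subst closedin_iff)
  show "coset g n \<subseteq> S" using assms by (auto simp: mem_coset_iff)
  have "x * k \<notin> coset g n" if "x \<in> S - coset g n" "k \<in> S \<inter> n" for x k
  proof
    assume *: "x * k \<in> coset g n"
    have "ginv g * (x * k) * ginv k \<in> n"
      by (rule base_mult[OF assms(2)]) (use that * assms in \<open>auto simp: mem_coset_iff sgp_ginv sgp_base\<close>)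
    then show False using that assms by (simp add: mem_coset_iff mult.assoc)
  qed
  then show "\<forall>x\<in>S - coset g n. \<exists>n'\<in>N. \<forall>k\<in>S \<inter> n'. x * k \<notin> coset g n" using assms(2) by blast
qed

lemma topological_group_TG: "topological_group (TG N S)"
  unfolding topological_group_def
proof (intro conjI)
  show "group (TG N S)" by (rule group_TG[OF sgp_S])
  show "topspace (topol (TG N S)) = carrier (TG N S)" by (simp add: topspace_T)
  have "continuous_map (prod_topology T T) T (\<lambda>(x, y). x * y)"
    unfolding continuous_map_def
  proof (intro conjI allI impI)
    show "(\<lambda>(x, y). x * y) \<in> topspace (prod_topology T T) \<rightarrow> topspace T"
      by (auto simp: topspace_T sgp_mult[OF sgp_S])
    fix O' assume O': "openin T O'"
    show "openin (prod_topology T T) {p \<in> topspace (prod_topology T T). (case p of (x, y) \<Rightarrow> x * y) \<in> O'}"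
      unfolding openin_prod_topology_alt
    proof (intro allI impI)
      fix x y
      assume "(x, y) \<in> {p \<in> topspace (prod_topology T T). (case p of (x, y) \<Rightarrow> x * y) \<in> O'}"
      then have xy: "x \<in> S" "y \<in> S" "x * y \<in> O'" by (auto simp: topspace_T)
      obtain n where n: "n \<in> N" "coset (x * y) n \<subseteq> O'" using openinD_coset[OF O' xy(3)] .
      obtain m where m: "m \<in> N" "\<forall>k\<in>S \<inter> m. ginv y * k * ginv (ginv y) \<in> n"
        using conj_nbhd[OF sgp_ginv[OF sgp_S xy(2)] n(1)] by blast
      have "x' * y' \<in> O'" if "x' \<in> coset x m" "y' \<in> coset y n" for x' y'
      proof -
        have x': "x' \<in> S" "ginv x * x' \<in> S \<inter> m" and y': "y' \<in> S" "ginv y * y' \<in> n"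
          using that xy sgp_S by (auto simp: mem_coset_iff sgp_mult sgp_ginv)
        have "ginv (x * y) * (x' * y') = (ginv y * (ginv x * x') * ginv (ginv y)) * (ginv y * y')"
          by (simp add: ginv_mult mult.assoc)
        also have "\<dots> \<in> n" using m(2) x'(2) y'(2) by (intro base_mult[OF n(1), of "_ * _ * _"]) blast+
        finally have "x' * y' \<in> coset (x * y) n"
          using xy x' y' sgp_S by (simp add: mem_coset_iff sgp_mult)
        then show ?thesis using n(2) by blast
      qed
      then have "coset x m \<times> coset y n \<subseteq> {p \<in> topspace (prod_topology T T). (case p of (x, y) \<Rightarrow> x * y) \<in> O'}"
        using xy by (auto simp: topspace_T mem_coset_iff)
      then show "\<exists>A B. openin T A \<and> openin T B \<and> x \<in> A \<and> y \<in> B \<and>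
          A \<times> B \<subseteq> {p \<in> topspace (prod_topology T T). (case p of (x, y) \<Rightarrow> x * y) \<in> O'}"
        by (intro exI[of _ "coset x m"] exI[of _ "coset y n"] conjI openin_coset self_mem_coset xy n(1) m(1))
    qed
  qed
  then show "continuous_map (prod_topology (topol (TG N S)) (topol (TG N S))) (topol (TG N S))
      (\<lambda>(x, y). x \<otimes>\<^bsub>TG N S\<^esub> y)" by simp
  have "continuous_map T T ginv"
    unfolding continuous_map_def
  proof (intro conjI allI impI)
    show "ginv \<in> topspace T \<rightarrow> topspace T" by (auto simp: topspace_T sgp_ginv[OF sgp_S])
    fix O' assume O': "openin T O'"
    show "openin T {x \<in> topspace T. ginv x \<in> O'}"
    proof (rule openinI_coset)
      fix x assume "x \<in> {x \<in> topspace T. ginv x \<in> O'}"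
      then have x: "x \<in> S" "ginv x \<in> O'" by (auto simp: topspace_T)
      obtain n where n: "n \<in> N" "coset (ginv x) n \<subseteq> O'" using openinD_coset[OF O' x(2)] .
      obtain m where m: "m \<in> N" "\<forall>k\<in>S \<inter> m. x * k * ginv x \<in> n" using conj_nbhd[OF x(1) n(1)] by blast
      have "ginv y \<in> O'" if "y \<in> coset x m" for y
      proof -
        have y: "y \<in> S" "ginv x * y \<in> S \<inter> m" using that x(1) sgp_S by (auto simp: mem_coset_iff sgp_mult sgp_ginv)
        have "ginv (ginv x) * ginv y = ginv (x * (ginv x * y) * ginv x)"
          by (simp add: ginv_mult mult.assoc)
        also have "\<dots> \<in> n" using m(2) y(2) by (intro sgp_ginv[OF sgp_base[OF n(1)]]) blast
        finally have "ginv y \<in> coset (ginv x) n" using x y sgp_S by (simp add: mem_coset_iff sgp_ginv)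
        then show ?thesis using n(2) by blast
      qed
      then show "\<exists>n\<in>N. coset x n \<subseteq> {x \<in> topspace T. ginv x \<in> O'}"
        using m(1) x(1) by (intro bexI[of _ m]) (auto simp: topspace_T mem_coset_iff)
    qed (auto simp: topspace_T)
  qed
  then have "continuous_map T T (\<lambda>x. inv\<^bsub>TG N S\<^esub> x)"
    by (rule continuous_map_eq) (simp add: topspace_T inv_TG[OF sgp_S])
  then show "continuous_map (topol (TG N S)) (topol (TG N S)) (\<lambda>x. inv\<^bsub>TG N S\<^esub> x)" by simp
qed

end

text \<open>The assumptions \<open>finite_index\<close> and \<open>complete\<close> are total
  boundedness and sequential completeness of U; together with the countable base they make U
  compact. Countably many cosets of U then give second countability.\<close>

locale tdlc = filtered_group +
  fixes U :: "'a set"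
  assumes U_base: "U \<in> N" and U_subset: "U \<subseteq> S"
    and separated: "\<And>x. x \<in> S \<Longrightarrow> x \<noteq> 1 \<Longrightarrow> \<exists>n\<in>N. x \<notin> n"
    and finite_index: "\<And>n. n \<in> N \<Longrightarrow> \<exists>F. finite F \<and> F \<subseteq> U \<and> (\<forall>u\<in>U. \<exists>f\<in>F. ginv f * u \<in> n)"
    and complete: "\<And>u :: nat \<Rightarrow> 'a. (\<And>i. u i \<in> U) \<Longrightarrow>
      (\<And>n. n \<in> N \<Longrightarrow> \<exists>M. \<forall>m\<ge>M. ginv (u M) * u m \<in> n) \<Longrightarrow>
      \<exists>x\<in>U. \<forall>n\<in>N. \<exists>M. \<forall>m\<ge>M. ginv x * u m \<in> n"
    and countable_base: "\<exists>\<nu> :: nat \<Rightarrow> 'a set. (\<forall>i. \<nu> i \<in> N) \<and> (\<forall>n\<in>N. \<exists>i. \<nu> i \<subseteq> n)"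
    and countable_cosets: "\<exists>A. countable A \<and> A \<subseteq> S \<and> (\<forall>x\<in>S. \<exists>a\<in>A. ginv a * x \<in> U)"
begin

lemma base_finite_Inter: "finite F \<Longrightarrow> (\<And>f. f \<in> F \<Longrightarrow> m f \<in> N) \<Longrightarrow> \<exists>k\<in>N. \<forall>f\<in>F. k \<subseteq> m f"
proof (induction rule: finite_induct)
  case empty
  then show ?case using U_base by blast
next
  case (insert x F)
  then obtain k where k: "k \<in> N" "\<forall>f\<in>F. k \<subseteq> m f" by auto
  obtain l where "l \<in> N" "l \<subseteq> k \<inter> m x" using base_Int[OF k(1), of "m x"] insert(4) by auto
  then show ?case using k(2) by (intro bexI[of _ l]) auto
qed

lemma decreasing_base:
  "\<exists>\<mu> :: nat \<Rightarrow> 'a set. (\<forall>i. \<mu> i \<in> N) \<and> (\<forall>i. \<mu> i \<subseteq> U) \<and> (\<forall>i j. i \<le> j \<longrightarrow> \<mu> j \<subseteq> \<mu> i) \<and>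
    (\<forall>n\<in>N. \<exists>i. \<mu> i \<subseteq> n)"
proof -
  obtain \<nu> :: "nat \<Rightarrow> 'a set" where \<nu>: "\<forall>i. \<nu> i \<in> N" "\<forall>n\<in>N. \<exists>i. \<nu> i \<subseteq> n"
    using countable_base by blast
  have "\<exists>\<mu>. \<forall>i. (\<mu> i \<in> N \<and> \<mu> i \<subseteq> U) \<and> \<mu> (Suc i) \<subseteq> \<mu> i \<inter> \<nu> i"
  proof (rule dependent_nat_choice)
    show "\<exists>x. x \<in> N \<and> x \<subseteq> U" using U_base by blast
    fix x i assume x: "x \<in> N \<and> x \<subseteq> U"
    then obtain k where "k \<in> N" "k \<subseteq> x \<inter> \<nu> i" using base_Int[of x "\<nu> i"] \<nu>(1) by auto
    then show "\<exists>y. (y \<in> N \<and> y \<subseteq> U) \<and> y \<subseteq> x \<inter> \<nu> i" using x by (intro exI[of _ k]) auto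
  qed
  then obtain \<mu> where \<mu>: "\<forall>i. (\<mu> i \<in> N \<and> \<mu> i \<subseteq> U) \<and> \<mu> (Suc i) \<subseteq> \<mu> i \<inter> \<nu> i" ..
  have "\<mu> (Suc i) \<subseteq> \<mu> i" for i using \<mu> by (metis le_infE)
  then have "\<mu> j \<subseteq> \<mu> i" if "i \<le> j" for i j
    using that by (rule lift_Suc_antimono_le)
  moreover have "\<exists>i. \<mu> i \<subseteq> n" if n: "n \<in> N" for n
  proof -
    obtain i where "\<nu> i \<subseteq> n" using \<nu>(2) n by blast
    then have "\<mu> (Suc i) \<subseteq> n" using \<mu> by blast
    then show ?thesis ..
  qed
  ultimately show ?thesis using \<mu> by (intro exI[of _ \<mu>]) simp
qed

text \<open>Koenig's lemma along a decreasing sequence of basic subgroups: a coset without a finite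
  subcover contains a smaller one, and completeness provides a point in all of them.\<close>

lemma compactin_U: "compactin T U"
  unfolding compactin_def topspace_T
proof (intro conjI allI impI)
  show "U \<subseteq> S" by (rule U_subset)
  fix \<O> assume \<O>: "Ball \<O> (openin T) \<and> U \<subseteq> \<Union>\<O>"
  define bad where "bad A \<longleftrightarrow> \<not> (\<exists>\<F>. finite \<F> \<and> \<F> \<subseteq> \<O> \<and> A \<subseteq> \<Union>\<F>)" for A :: "'a set"
  obtain \<mu> :: "nat \<Rightarrow> 'a set" where \<mu>: "\<And>i. \<mu> i \<in> N" "\<And>i. \<mu> i \<subseteq> U" "\<And>i j. i \<le> j \<Longrightarrow> \<mu> j \<subseteq> \<mu> i"
    "\<And>n. n \<in> N \<Longrightarrow> \<exists>i. \<mu> i \<subseteq> n"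
    using decreasing_base by metis
  have bad_mono: "bad B" if "bad A" "A \<subseteq> B" for A B
    using that unfolding bad_def by (meson order_trans)
  have good_Un: "\<not> bad (A \<union> B)" if AB: "\<not> bad A" "\<not> bad B" for A B
  proof -
    obtain \<F> \<G> where "finite \<F>" "\<F> \<subseteq> \<O>" "A \<subseteq> \<Union>\<F>" "finite \<G>" "\<G> \<subseteq> \<O>" "B \<subseteq> \<Union>\<G>"
      using AB unfolding bad_def by auto
    then have "finite (\<F> \<union> \<G>)" "\<F> \<union> \<G> \<subseteq> \<O>" "A \<union> B \<subseteq> \<Union>(\<F> \<union> \<G>)" by auto
    then show ?thesis unfolding bad_def by (metis (no_types))
  qed
  have good_UN: "\<not> bad (\<Union>f\<in>F. B f)" if "finite F" "\<forall>f\<in>F. \<not> bad (B f)" for F and B :: "'a \<Rightarrow> 'a set"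
    using that
  proof (induction rule: finite_induct)
    case empty
    then show ?case by (auto simp: bad_def)
  next
    case (insert x F)
    then have "\<not> bad (B x \<union> (\<Union>f\<in>F. B f))" by (intro good_Un) auto
    then show ?case by simp
  qed
  have bad_Un: "\<exists>f\<in>F. bad (B f)" if "finite F" "bad A" "A \<subseteq> (\<Union>f\<in>F. B f)" for A F and B :: "'a \<Rightarrow> 'a set"
  proof (rule ccontr)
    assume "\<not> ?thesis"
    then have "\<not> bad (\<Union>f\<in>F. B f)" by (intro good_UN[OF that(1)]) simp
    then show False using bad_mono[OF that(2,3)] by simp
  qed
  have refine: "\<exists>v\<in>U \<inter> A. bad (A \<inter> coset v (\<mu> i))" if A: "bad A" "A \<subseteq> U" for A i
  proof -
    obtain F where F: "finite F" "F \<subseteq> U" "\<forall>u\<in>U. \<exists>f\<in>F. ginv f * u \<in> \<mu> i"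
      using finite_index[OF \<mu>(1)[of i]] by (elim exE conjE)
    have "A \<subseteq> (\<Union>f\<in>F. A \<inter> coset f (\<mu> i))"
    proof
      fix x assume x: "x \<in> A"
      then have "x \<in> U" using A(2) by (rule rev_subsetD)
      then obtain f where "f \<in> F" "ginv f * x \<in> \<mu> i" using F(3) by auto
      moreover have "f \<in> S" "x \<in> S" using F(2) U_subset calculation(1) \<open>x \<in> U\<close> by auto
      ultimately show "x \<in> (\<Union>f\<in>F. A \<inter> coset f (\<mu> i))" using x by (intro UN_I[of f]) (simp_all add: mem_coset_iff)
    qed
    then have "\<exists>f\<in>F. bad (A \<inter> coset f (\<mu> i))" by (rule bad_Un[OF F(1) A(1)])
    then obtain f where f: "f \<in> F" "bad (A \<inter> coset f (\<mu> i))" ..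
    \<comment> \<open>The representative f need not lie in A. Recentring the coset at a point v of A
      makes each new centre lie in the previous coset, which is what turns the centres into a Cauchy
      sequence.\<close>
    have "A \<inter> coset f (\<mu> i) \<noteq> {}" using f(2) by (auto simp: bad_def)
    then obtain v where v: "v \<in> A" "v \<in> coset f (\<mu> i)" by blast
    have fS: "f \<in> S" "v \<in> S" using f(1) F(2) U_subset v(1) A(2) by blast+
    have "coset f (\<mu> i) \<subseteq> coset v (\<mu> i)"
    proof
      fix x assume x: "x \<in> coset f (\<mu> i)"
      have "ginv (ginv f * v) * (ginv f * x) \<in> \<mu> i"
        by (rule base_quotient[OF \<mu>(1)]) (use x v(2) fS(1) in \<open>auto simp: mem_coset_iff\<close>)
      then show "x \<in> coset v (\<mu> i)" using x fS by (simp add: mem_coset_iff ginv_mult mult.assoc)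
    qed
    then have "bad (A \<inter> coset v (\<mu> i))" by (intro bad_mono[OF f(2)]) auto
    then show ?thesis using v(1) A(2) by blast
  qed
  show "\<exists>\<F>. finite \<F> \<and> \<F> \<subseteq> \<O> \<and> U \<subseteq> \<Union>\<F>"
  proof (rule ccontr)
    assume "\<not> ?thesis"
    then have badU: "bad U" by (simp add: bad_def)
    have "\<exists>u. \<forall>i. (u i \<in> U \<and> bad (U \<inter> coset (u i) (\<mu> i))) \<and> u (Suc i) \<in> coset (u i) (\<mu> i)"
    proof (rule dependent_nat_choice)
      show "\<exists>x. x \<in> U \<and> bad (U \<inter> coset x (\<mu> 0))" using refine[OF badU, of 0] by blast
      fix x i assume x: "x \<in> U \<and> bad (U \<inter> coset x (\<mu> i))"
      obtain v where v: "v \<in> U" "v \<in> coset x (\<mu> i)" "bad (U \<inter> coset x (\<mu> i) \<inter> coset v (\<mu> (Suc i)))"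
        using refine[of "U \<inter> coset x (\<mu> i)" "Suc i"] x by blast
      have "bad (U \<inter> coset v (\<mu> (Suc i)))" by (rule bad_mono[OF v(3)]) auto
      then show "\<exists>y. (y \<in> U \<and> bad (U \<inter> coset y (\<mu> (Suc i)))) \<and> y \<in> coset x (\<mu> i)" using v by blast
    qed
    then obtain u where u: "\<And>i. u i \<in> U" "\<And>i. bad (U \<inter> coset (u i) (\<mu> i))" "\<And>i. u (Suc i) \<in> coset (u i) (\<mu> i)"
      by blast
    have uS: "u i \<in> S" for i using u(1) U_subset by blast
    have cauchy: "ginv (u i) * u m \<in> \<mu> i" if "i \<le> m" for i m
      using that
    proof (induction m rule: dec_induct)
      case base
      show ?case by (simp add: sgp_one[OF sgp_base[OF \<mu>(1)]])
    next
      case (step m)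
      have "ginv (u m) * u (Suc m) \<in> \<mu> i"
        using u(3)[of m] \<mu>(3)[OF step(1)] uS by (auto simp: mem_coset_iff)
      then have "ginv (u i) * u m * (ginv (u m) * u (Suc m)) \<in> \<mu> i"
        by (rule base_mult[OF \<mu>(1) step.IH])
      then show ?case by (simp add: mult.assoc)
    qed
    have "\<exists>M. \<forall>m\<ge>M. ginv (u M) * u m \<in> n" if "n \<in> N" for n
      using \<mu>(4)[OF that] cauchy by blast
    then obtain x where x: "x \<in> U" "\<forall>n\<in>N. \<exists>M. \<forall>m\<ge>M. ginv x * u m \<in> n"
      using complete[of u] u(1) by blast
    obtain P where P: "P \<in> \<O>" "x \<in> P" using \<O> x(1) by blast
    have "openin T P" using \<O> P(1) by blast
    then obtain n where n: "n \<in> N" "coset x n \<subseteq> P" using openinD_coset P(2) by blast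
    obtain i where i: "\<mu> i \<subseteq> n" using \<mu>(4)[OF n(1)] by blast
    obtain M where M: "\<forall>m\<ge>M. ginv x * u m \<in> n" using x(2) n(1) by blast
    define m where "m = max M i"
    have xS: "x \<in> S" using x(1) U_subset by blast
    have "coset (u m) (\<mu> m) \<subseteq> coset x n"
    proof
      fix y assume y: "y \<in> coset (u m) (\<mu> m)"
      have "ginv (u m) * y \<in> n" using y uS \<mu>(3)[of i m] i by (auto simp: mem_coset_iff m_def)
      moreover have "ginv x * u m \<in> n" using M by (simp add: m_def)
      ultimately have "ginv x * u m * (ginv (u m) * y) \<in> n" by (intro base_mult[OF n(1), of "_ * _" "_ * _"])
      then show "y \<in> coset x n" using y uS xS by (simp add: mem_coset_iff mult.assoc)
    qed
    then have "U \<inter> coset (u m) (\<mu> m) \<subseteq> \<Union>{P}" using n(2) by blast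
    then show False using u(2)[of m] P(1) unfolding bad_def by (metis empty_subsetI finite.emptyI finite.insertI insert_subset)
  qed
qed

lemma tdlcsc_TG: "tdlcsc_group (TG N S)"
  unfolding tdlcsc_group_def TG_simps
proof (intro conjI)
  show "topological_group (TG N S)" by (rule topological_group_TG)
  have sep: "\<exists>n\<in>N. y \<notin> coset x n" if "x \<in> S" "y \<in> S" "x \<noteq> y" for x y
  proof -
    have "ginv x * y \<noteq> 1" using that(3) by (metis ginv_ginv ginv_unique)
    then show ?thesis
      using separated[of "ginv x * y"] that sgp_S by (auto simp: sgp_mult sgp_ginv mem_coset_iff)
  qed
  show "Hausdorff_space T"
    unfolding Hausdorff_space_def topspace_T
  proof (intro allI impI)
    fix x y assume "x \<in> S \<and> y \<in> S \<and> x \<noteq> y"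
    then obtain n where n: "x \<in> S" "y \<in> S" "n \<in> N" "y \<notin> coset x n" using sep by blast
    have "openin T (S - coset x n)" using closedin_coset[OF n(1,3)] by (simp add: closedin_def topspace_T)
    then show "\<exists>V W. openin T V \<and> openin T W \<and> x \<in> V \<and> y \<in> W \<and> disjnt V W"
      using openin_coset[OF n(1,3)] self_mem_coset[OF n(1,3)] n
      by (intro exI[of _ "coset x n"] exI[of _ "S - coset x n"]) (auto simp: disjnt_iff)
  qed
  show "totally_disconnected_space T"
    unfolding totally_disconnected_space_def topspace_T
  proof
    fix x assume x: "x \<in> S"
    let ?C = "connected_component_of_set T x"
    have C: "connectedin T ?C" "x \<in> ?C" "?C \<subseteq> S"
      using x connected_component_of_subset_topspace[of T x]
      by (simp_all add: connectedin_connected_component_of connected_component_of_refl topspace_T)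
    have "y = x" if y: "y \<in> ?C" for y
    proof (rule ccontr)
      assume "y \<noteq> x"
      then obtain n where n: "n \<in> N" "y \<notin> coset x n" using sep[of x y] x y C(3) by blast
      then have "?C \<subseteq> coset x n \<or> disjnt ?C (coset x n)"
        using connectedin_clopen_cases[OF C(1) closedin_coset[OF x n(1)] openin_coset[OF x n(1)]] by blast
      then show False using n y C(2) self_mem_coset[OF x n(1)] by (auto simp: disjnt_iff)
    qed
    then show "?C = {x}" using C(2) by blast
  qed
  show "locally_compact_space T"
    unfolding locally_compact_space_def topspace_T
  proof
    fix x assume x: "x \<in> S"
    have "continuous_map T T (\<lambda>y. x * y)"
      using continuous_map_translation[OF topological_group_TG, of x] x by simp
    then have "compactin T ((\<lambda>y. x * y) ` U)" by (rule image_compactin[OF compactin_U])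
    moreover have "(\<lambda>y. x * y) ` U = coset x U" using U_subset by (auto simp: coset_def)
    ultimately show "\<exists>V K. openin T V \<and> compactin T K \<and> x \<in> V \<and> V \<subseteq> K"
      using openin_coset[OF x U_base] self_mem_coset[OF x U_base] by auto
  qed
  show "second_countable_space T"
  proof -
    obtain \<mu> :: "nat \<Rightarrow> 'a set" where \<mu>: "\<And>i. \<mu> i \<in> N" "\<And>n. n \<in> N \<Longrightarrow> \<exists>i. \<mu> i \<subseteq> n"
      using decreasing_base by metis
    obtain A where A: "countable A" "A \<subseteq> S" "\<forall>x\<in>S. \<exists>a\<in>A. ginv a * x \<in> U" using countable_cosets by blast
    obtain F where F: "\<And>i. finite (F i)" "\<And>i. F i \<subseteq> U" "\<And>i u. u \<in> U \<Longrightarrow> \<exists>f\<in>F i. ginv f * u \<in> \<mu> i"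
      using finite_index[OF \<mu>(1)] by metis
    \<comment> \<open>A countable base: countably many cosets of U, each cut into finitely many
      cosets of \<open>\<mu> i\<close>, for every i.\<close>
    let ?B = "\<Union>i. (\<lambda>(a, f). coset (a * f) (\<mu> i)) ` (A \<times> F i)"
    have inS: "a * f \<in> S" if "a \<in> A" "f \<in> F i" for a f i
      using that A(2) F(2) U_subset by (intro sgp_mult[OF sgp_S]) blast+
    show ?thesis
      unfolding second_countable_space_def
    proof (rule exI[of _ ?B], intro conjI ballI allI impI)
      show "countable ?B"
        using A(1) F(1) by (intro countable_UN countable_image countable_SIGMA A(1) countable_finite[OF F(1)] countableI_type)
      show "openin T B" if "B \<in> ?B" for B using that inS \<mu>(1) by (auto intro: openin_coset)
      fix O' assume O': "openin T O'"
      have "\<exists>B\<in>?B. g \<in> B \<and> B \<subseteq> O'" if g: "g \<in> O'" for g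
      proof -
        have gS: "g \<in> S" using g openin_subset[OF O'] by (auto simp: topspace_T)
        obtain n where n: "n \<in> N" "coset g n \<subseteq> O'" using openinD_coset[OF O' g] .
        obtain i where i: "\<mu> i \<subseteq> n" using \<mu>(2)[OF n(1)] by blast
        obtain a where a: "a \<in> A" "ginv a * g \<in> U" using A(3) gS by blast
        obtain f where f: "f \<in> F i" "ginv f * (ginv a * g) \<in> \<mu> i" using F(3)[OF a(2)] by blast
        have e: "ginv (a * f) * g \<in> \<mu> i" using f(2) by (simp add: ginv_mult mult.assoc)
        have "coset (a * f) (\<mu> i) \<subseteq> coset g n"
        proof
          fix y assume y: "y \<in> coset (a * f) (\<mu> i)"
          have "ginv (ginv (a * f) * g) * (ginv (a * f) * y) \<in> \<mu> i"
            by (rule base_quotient[OF \<mu>(1) e]) (use y inS[OF a(1) f(1)] in \<open>simp add: mem_coset_iff\<close>)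
          then show "y \<in> coset g n" using y gS inS[OF a(1) f(1)] i by (auto simp: mem_coset_iff ginv_mult mult.assoc)
        qed
        moreover have "g \<in> coset (a * f) (\<mu> i)" using gS inS[OF a(1) f(1)] e by (simp add: mem_coset_iff)
        moreover have "coset (a * f) (\<mu> i) \<in> ?B"
          using a(1) f(1) by (intro UN_I[of i] image_eqI[of _ _ "(a, f)"]) auto
        ultimately show ?thesis using n(2) order_trans by (intro bexI[of _ "coset (a * f) (\<mu> i)"] conjI) fast+
      qed
      then have "O' \<subseteq> \<Union>{B \<in> ?B. B \<subseteq> O'}" by (intro subsetI) (metis (no_types, lifting) UnionI mem_Collect_eq)
      then have "O' = \<Union>{B \<in> ?B. B \<subseteq> O'}" by (intro subset_antisym Sup_least) simp_all
      moreover have "{B \<in> ?B. B \<subseteq> O'} \<subseteq> ?B" by (rule Collect_restrict)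
      ultimately show "\<exists>\<U>\<subseteq>?B. O' = \<Union>\<U>" by (intro exI[of _ "{B \<in> ?B. B \<subseteq> O'}"] conjI)
    qed
  qed
qed

end

section \<open>Closed subgroups that are elementary and well-founded\<close>

context filtered_group
begin

lemma topological_group_TG_subset: "sgp C \<Longrightarrow> C \<subseteq> S \<Longrightarrow> topological_group (TG N C)"
  using topological_group_subgrp[OF topological_group_TG, of C] sgp_S
  by (simp add: subgroup_TG_iff subgrp_TG[OF filter_base])

definition closed_sgp :: "'a set \<Rightarrow> bool" where
  "closed_sgp C \<longleftrightarrow> sgp C \<and> C \<subseteq> S \<and> closedin T C"

lemma closed_sgp_self: "closed_sgp S"
  using closedin_topspace[of T] by (simp add: closed_sgp_def sgp_S topspace_T)

text \<open>Open subgroups are closed, so relative openness in a closed subgroup suffices. Most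
  closedness claims below are obtained this way.\<close>

lemma closed_sgp_relopen:
  assumes "closed_sgp C" "relopen N C V" shows "closed_sgp V"
proof -
  have C: "sgp C" "C \<subseteq> S" "closedin T C" and V: "sgp V" "V \<subseteq> C"
    using assms by (auto simp: closed_sgp_def relopen_def)
  have "openin (topol (TG N C)) V"
    using assms(2) by (auto simp: relopen_def openin_subgroup_TG_iff[OF filter_base C(1)])
  then have "closedin (topol (TG N C)) V"
    using topological_group_TG_subset[OF C(1,2)] V
    by (intro closedin_open_subgroup) (simp_all add: subgroup_TG_iff[OF C(1)])
  then have "closedin (subtopology T C) V"
    by (simp add: subtopology_group_topology[OF filter_base sgp_S C(1,2)])
  then show ?thesis using C V closedin_trans_full[of T C V] by (auto simp: closed_sgp_def)
qed

lemma conthom_continuous: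
  assumes "closed_sgp C" "filter_base M" "sgp Q" "conthom \<phi> C N M" "\<phi> ` C \<subseteq> Q"
  shows "continuous_map (group_topology N C) (group_topology M Q) \<phi>"
  using assms by (intro continuous_map_conthom[OF filter_base]) (auto simp: closed_sgp_def)

text \<open>Comparing with the trivial homomorphism gives closedness of kernels, and comparing a
  retraction with the identity gives closedness of its image.\<close>

lemma closed_sgp_equalizer:
  assumes C: "closed_sgp C" and M: "filter_base M" "sgp Q" "Hausdorff_space (group_topology M Q)"
    and \<phi>: "conthom \<phi> C N M" "\<phi> ` C \<subseteq> Q" and \<psi>: "conthom \<psi> C N M" "\<psi> ` C \<subseteq> Q"
  shows "closed_sgp {x \<in> C. \<phi> x = \<psi> x}"
proof -
  have c: "sgp C" "C \<subseteq> S" "closedin T C" using C by (auto simp: closed_sgp_def)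
  have "closedin (group_topology N C) {x \<in> topspace (group_topology N C). \<phi> x = \<psi> x}"
    by (rule closedin_continuous_maps_eq[OF M(3) conthom_continuous[OF C M(1,2) \<phi>]
          conthom_continuous[OF C M(1,2) \<psi>]])
  then have "closedin (subtopology T C) {x \<in> C. \<phi> x = \<psi> x}"
    by (simp add: topspace_group_topology[OF filter_base c(1)]
        subtopology_group_topology[OF filter_base sgp_S c(1,2)])
  moreover have "sgp {x \<in> C. \<phi> x = \<psi> x}"
    using c(1) \<phi>(1) \<psi>(1)
    by (intro sgpI) (auto simp: sgp_one sgp_mult sgp_ginv conthom_one conthom_ginv conthom_mult)
  ultimately show ?thesis using c closedin_trans_full[of T C] by (auto simp: closed_sgp_def)
qed

lemma conthom_trivial: "sgp C \<Longrightarrow> filter_base M \<Longrightarrow> conthom (\<lambda>x. 1) C N M"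
  using filter_base by (fastforce simp: conthom_def filter_base_def sgp_one)

text \<open>Both properties are inherited along the same operations (closed subgroups, split
  extensions, increasing unions, compact and discrete groups), and together they guarantee that a
  rank exists.\<close>

definition good :: "'a set \<Rightarrow> bool" where
  "good C \<longleftrightarrow> iso_elementary (TG N C) \<and> wfr N C"

lemma good_subset:
  assumes "good C" "closed_sgp C" "closed_sgp D" "D \<subseteq> C" shows "good D"
proof -
  have C: "sgp C" "C \<subseteq> S" "closedin T C" and D: "sgp D" "closedin T D"
    using assms by (auto simp: closed_sgp_def)
  have "closedin (subtopology T C) D" by (rule closedin_subset_topspace[OF D(2) assms(4)])
  then have "iso_elementary (subgrp (TG N C) D)"
    using assms(1) topological_group_TG_subset[OF C(1,2)] D(1) assms(4)
    by (intro iso_elementary_subgroup)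
      (auto simp: good_def subgroup_TG_iff[OF C(1)] subtopology_group_topology[OF filter_base sgp_S C(1,2)])
  then show ?thesis
    using assms wfr_subset by (auto simp: good_def subgrp_TG[OF filter_base C(1) D(1) assms(4)])
qed

end

context tdlc
begin

lemma tdlcsc_closed_sgp: assumes "closed_sgp C" shows "tdlcsc_group (TG N C)"
proof -
  have C: "sgp C" "C \<subseteq> S" "closedin T C" using assms by (auto simp: closed_sgp_def)
  show ?thesis
    using tdlcsc_group_subgrp[OF tdlcsc_TG, of C] C
    by (simp add: subgroup_TG_iff[OF sgp_S] subgrp_TG[OF filter_base sgp_S C(1,2)])
qed

lemma Hausdorff_closed_sgp: "closed_sgp C \<Longrightarrow> Hausdorff_space (group_topology N C)"
  using tdlcsc_closed_sgp by (auto simp: tdlcsc_group_def)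

text \<open>Profinite groups are residually discrete: the intersection of all conjugates of n under
  U is still open, since finitely many coset representatives of n account for all
  conjugates.\<close>

lemma wfr_U: "wfr N U"
proof (rule wfr_residually_discrete)
  fix x assume x: "x \<in> U" "x \<noteq> 1"
  then obtain n where n: "n \<in> N" "x \<notin> n" using separated U_subset by blast
  have sU: "sgp U" and sn: "sgp n" using U_base n(1) sgp_base by blast+
  let ?V = "{v \<in> U. \<forall>u\<in>U. u * v * ginv u \<in> n}"
  obtain F where F: "finite F" "F \<subseteq> U" "\<forall>u\<in>U. \<exists>f\<in>F. ginv f * u \<in> n" using finite_index[OF n(1)] by blast
  have "\<exists>m\<in>N. \<forall>k\<in>S \<inter> m. ginv f * k * ginv (ginv f) \<in> n" if "f \<in> F" for f
    using conj_nbhd[of "ginv f" n] n(1) that F(2) U_subset sgp_ginv[OF sU] by blast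
  then obtain m where m: "\<And>f. f \<in> F \<Longrightarrow> m f \<in> N"
    "\<And>f k. f \<in> F \<Longrightarrow> k \<in> S \<inter> m f \<Longrightarrow> ginv f * k * ginv (ginv f) \<in> n"
    by metis
  obtain l where l: "l \<in> N" "\<forall>f\<in>F. l \<subseteq> m f" using base_finite_Inter[OF F(1), of m] m(1) by blast
  have "U \<inter> l \<subseteq> ?V"
  proof
    fix v assume v: "v \<in> U \<inter> l"
    have "u * v * ginv u \<in> n" if u: "u \<in> U" for u
    proof -
      obtain f where f: "f \<in> F" "ginv f * ginv u \<in> n" using F(3) sgp_ginv[OF sU u] by blast
      have a: "ginv (ginv f * ginv u) \<in> n" using f(2) by (rule sgp_ginv[OF sn])
      have "ginv f * v * ginv (ginv f) \<in> n" using m(2)[OF f(1)] v l(2) f(1) U_subset by blast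
      then have "ginv (ginv f * ginv u) * (ginv f * v * ginv (ginv f)) * (ginv f * ginv u) \<in> n"
        using a f(2) by (intro sgp_mult[OF sn, of "_ * (_ * _)"] sgp_mult[OF sn, of "ginv (_ * _)"])
      then show ?thesis by (simp add: ginv_mult mult.assoc)
    qed
    then show "v \<in> ?V" using v by blast
  qed
  moreover have "sgp ?V"
  proof (rule sgpI)
    show "1 \<in> ?V" using sgp_one[OF sU] sgp_one[OF sn] by simp
    show "a * b \<in> ?V" if "a \<in> ?V" "b \<in> ?V" for a b
    proof -
      have "u * (a * b) * ginv u \<in> n" if "u \<in> U" for u
      proof -
        have "(u * a * ginv u) * (u * b * ginv u) \<in> n"
          using \<open>a \<in> ?V\<close> \<open>b \<in> ?V\<close> that by (intro sgp_mult[OF sn, of "_ * _ * _"]) blast+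
        then show ?thesis by (simp add: mult.assoc)
      qed
      then show ?thesis using that sgp_mult[OF sU] by blast
    qed
    show "ginv a \<in> ?V" if "a \<in> ?V" for a
    proof -
      have "u * ginv a * ginv u \<in> n" if "u \<in> U" for u
      proof -
        have "ginv (u * a * ginv u) \<in> n" using \<open>a \<in> ?V\<close> that by (intro sgp_ginv[OF sn]) blast
        then show ?thesis by (simp add: ginv_mult mult.assoc)
      qed
      then show ?thesis using that sgp_ginv[OF sU] by blast
    qed
  qed
  ultimately have "relopen N U ?V" using l(1) by (auto simp: relopen_def)
  moreover have "nrm ?V U"
    unfolding nrm_def
  proof (intro ballI)
    fix c v assume c: "c \<in> U" and v: "v \<in> ?V"
    have "u * (c * v * ginv c) * ginv u \<in> n" if "u \<in> U" for u
    proof -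
      have "(u * c) * v * ginv (u * c) \<in> n" using v sgp_mult[OF sU that c] by blast
      then show ?thesis by (simp add: ginv_mult mult.assoc)
    qed
    moreover have "c * v * ginv c \<in> U" using c v by (simp add: sgp_mult[OF sU] sgp_ginv[OF sU])
    ultimately show "c * v * ginv c \<in> ?V" by blast
  qed
  moreover have "x \<notin> ?V"
  proof
    assume "x \<in> ?V"
    then have "1 * x * ginv 1 \<in> n" using sgp_one[OF sU] by blast
    then show False using n(2) by simp
  qed
  ultimately show "\<exists>V. relopen N U V \<and> nrm V U \<and> x \<notin> V" by blast
qed

lemma good_compact: assumes "closed_sgp C" "C \<subseteq> U" shows "good C"
proof -
  have C: "sgp C" "C \<subseteq> S" "closedin T C" using assms by (auto simp: closed_sgp_def)
  have "compactin T C" by (rule closed_compactin[OF compactin_U assms(2) C(3)])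
  then have "compact_space (topol (TG N C))"
    by (simp add: compact_space_subtopology flip: subtopology_group_topology[OF filter_base sgp_S C(1,2)])
  then show ?thesis
    using iso_elementary_compact[OF tdlcsc_closed_sgp[OF assms(1)]] wfr_subset[OF wfr_U assms(2)]
    by (simp add: good_def)
qed

lemma good_extension:
  assumes C: "closed_sgp C" and M: "filter_base M" "sgp Q" "topological_group (TG M Q)"
    and Q: "iso_elementary (TG M Q)" "wfr M Q"
    and \<phi>: "conthom \<phi> C N M" "\<phi> ` C \<subseteq> Q"
    and s: "conthom s Q M N" "s ` Q \<subseteq> C" "\<And>q. q \<in> Q \<Longrightarrow> \<phi> (s q) = q"
    and ker: "good {x \<in> C. \<phi> x = 1}"
  shows "good C"
proof -
  have c: "sgp C" using C by (auto simp: closed_sgp_def)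
  have sk: "sgp {x \<in> C. \<phi> x = 1}"
    using sgp_vimage[OF \<phi>(1) sgp_trivial] by simp
  have k: "kernel (TG N C) (TG M Q) \<phi> = {x \<in> C. \<phi> x = 1}"
    by (auto simp: kernel_def)
  have "iso_elementary (TG N C)"
  proof (rule iso_elementary_split_extension[OF tdlcsc_closed_sgp[OF C] M(3) Q(1)])
    show "\<phi> \<in> hom (TG N C) (TG M Q)" using \<phi> by (auto simp: hom_def conthom_mult[OF \<phi>(1)])
    show "continuous_map (topol (TG N C)) (topol (TG M Q)) \<phi>"
      using conthom_continuous[OF C M(1,2) \<phi>] by simp
    show "continuous_map (topol (TG M Q)) (topol (TG N C)) s"
      using continuous_map_conthom[OF M(1) filter_base M(2) c s(1,2)] by simp
    show "\<phi> (s q) = q" if "q \<in> carrier (TG M Q)" for q using that s(3) by simp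
    show "iso_elementary (subgrp (TG N C) (kernel (TG N C) (TG M Q) \<phi>))"
      unfolding k using ker by (simp add: subgrp_TG[OF filter_base c sk] good_def)
  qed
  moreover have "wfr N C" using wfr_extension[OF Q(2) \<phi>] ker by (simp add: good_def)
  ultimately show ?thesis by (simp add: good_def)
qed

lemma good_chain_union:
  assumes C: "closed_sgp C" and V: "\<And>i::nat. relopen N C (V i)" "\<And>i. V i \<subseteq> V (Suc i)" "(\<Union>i. V i) = C"
    and g: "\<And>i. good (V i)"
  shows "good C"
proof -
  have c: "sgp C" using C by (auto simp: closed_sgp_def)
  have v: "sgp (V i)" "V i \<subseteq> C" for i using V(1) by (auto simp: relopen_def)
  have "iso_elementary (TG N C)"
  proof (rule iso_elementary_union[OF tdlcsc_closed_sgp[OF C], of V])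
    show "subgroup (V i) (TG N C)" for i using v by (simp add: subgroup_TG_iff[OF c])
    show "openin (topol (TG N C)) (V i)" for i
      using V(1)[of i] by (auto simp: relopen_def openin_subgroup_TG_iff[OF filter_base c])
    show "iso_elementary (subgrp (TG N C) (V i))" for i
      using g[of i] by (simp add: subgrp_TG[OF filter_base c v] good_def)
  qed (use V in auto)
  moreover have "wfr N C" using wfr_chain_union[OF V] g by (simp add: good_def)
  ultimately show ?thesis by (simp add: good_def)
qed

lemma good_discrete:
  assumes "{1} \<in> N" "countable S" shows "good S"
proof -
  have "openin T {x}" if "x \<in> S" for x
    using that assms(1) unfolding openin_group_topology[OF filter_base] by (auto intro!: bexI[of _ "{1}"])
  then have "T = discrete_topology S"
    using discrete_topology_unique[of S T] topspace_T by auto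
  then have "iso_elementary (TG N S)"
    using iso_elementary_discrete[OF tdlcsc_TG] assms(2) by simp
  moreover have "wfr N S"
  proof (rule wfr_residually_discrete)
    have "relopen N S {1}" "nrm {1} S"
      using assms(1) sgp_one[OF sgp_S] sgp_trivial by (auto simp: relopen_def nrm_def)
    then show "\<exists>V. relopen N S V \<and> nrm V S \<and> x \<notin> V" if "x \<noteq> 1" for x using that by blast
  qed
  ultimately show ?thesis by (simp add: good_def)
qed

end

section \<open>Permutation groups\<close>

typedef 'a sym = "{f :: 'a \<Rightarrow> 'a. bij f}"
  morphisms app Sym by (auto intro: bij_id)

notation app  (infixr \<open>\<cdot>\<close> 75)

setup_lifting type_definition_sym

instantiation sym :: (type) mgroup
begin

lift_definition one_sym :: "'a sym" is id by (rule bij_id)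
lift_definition times_sym :: "'a sym \<Rightarrow> 'a sym \<Rightarrow> 'a sym" is "\<lambda>p q x. p (q x)"
  using bij_comp by (auto simp: o_def)
lift_definition ginv_sym :: "'a sym \<Rightarrow> 'a sym" is "inv_into UNIV" by (rule bij_imp_bij_inv)

instance
proof
  fix a b c :: "'a sym"
  show "a * b * c = a * (b * c)" by transfer (rule refl)
  show "1 * a = a" by transfer simp
  show "a * 1 = a" by transfer simp
  show "ginv a * a = 1" by transfer (simp add: fun_eq_iff bij_is_inj)
qed

end

lemma sym_eqI: "(\<And>x. p \<cdot> x = q \<cdot> x) \<Longrightarrow> p = q"
  by transfer blast

lemma one_app [simp]: "1 \<cdot> x = x"
  by transfer simp

lemma mult_app [simp]: "(p * q) \<cdot> x = p \<cdot> q \<cdot> x"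
  by transfer simp

lemma ginv_app [simp]: "ginv p \<cdot> p \<cdot> x = x"
  by (simp flip: mult_app)

lemma app_ginv [simp]: "p \<cdot> ginv p \<cdot> x = x"
  by (simp flip: mult_app)

lemma app_eq_iff [simp]: "p \<cdot> x = p \<cdot> y \<longleftrightarrow> x = y"
  by (metis ginv_app)

lemma Sym_app: "(\<And>x. g (f x) = x) \<Longrightarrow> (\<And>x. f (g x) = x) \<Longrightarrow> Sym f \<cdot> x = f x"
  using o_bij[of g f] by (simp add: Sym_inverse fun_eq_iff)

definition fix_pts :: "'a set \<Rightarrow> 'a sym set" where
  "fix_pts F = {p. \<forall>x\<in>F. p \<cdot> x = x}"

text \<open>This base defines the topology of pointwise convergence.\<close>

definition perm_base :: "'a sym set set" where
  "perm_base = fix_pts ` {F. finite F}"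

lemma sgp_fix_pts: "sgp (fix_pts F)"
  unfolding fix_pts_def by (rule sgpI) (auto, metis ginv_app)

lemma fix_pts_Un: "fix_pts (E \<union> F) = fix_pts E \<inter> fix_pts F"
  by (auto simp: fix_pts_def)

lemma filter_base_perm_base: "filter_base perm_base"
  unfolding filter_base_def perm_base_def
proof (intro conjI ballI)
  fix n m assume "n \<in> fix_pts ` {F :: 'a set. finite F}" "m \<in> fix_pts ` {F :: 'a set. finite F}"
  then obtain E F :: "'a set" where "finite E" "finite F" "n = fix_pts E" "m = fix_pts F" by blast
  then show "\<exists>k\<in>fix_pts ` {F. finite F}. k \<subseteq> n \<inter> m"
    by (intro bexI[of _ "fix_pts (E \<union> F)"]) (simp add: fix_pts_Un, rule image_eqI[of _ _ "E \<union> F"], simp_all)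
qed (auto simp: sgp_fix_pts)

lemma filtered_group_perm_base: assumes "sgp G" shows "filtered_group perm_base G"
proof
  show "filter_base perm_base" by (rule filter_base_perm_base)
  show "sgp G" by (rule assms)
  fix g :: "'a sym" and n :: "'a sym set" assume "n \<in> perm_base"
  then obtain F where F: "finite F" "n = fix_pts F" by (auto simp: perm_base_def)
  have "g * k * ginv g \<in> n" if "k \<in> fix_pts ((\<lambda>x. ginv g \<cdot> x) ` F)" for k
    using that by (simp add: F(2) fix_pts_def)
  then show "\<exists>m\<in>perm_base. \<forall>k\<in>G \<inter> m. g * k * ginv g \<in> n"
    using F(1) by (intro bexI[of _ "fix_pts ((\<lambda>x. ginv g \<cdot> x) ` F)"]) (auto simp: perm_base_def)
qed

text \<open>The stabiliser of \<open>0\<close> is a compact open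
  subgroup, and \<open>normal_generation\<close> says that it generates \<open>G\<close> as a normal subgroup.\<close>

locale stage =
  fixes G :: "nat sym set"
  assumes sgp_G: "sgp G"
    and transitive: "\<And>x. \<exists>g\<in>G. g \<cdot> 0 = x"
    and finite_orbits: "\<And>x. finite {u \<cdot> x |u. u \<in> G \<and> u \<cdot> 0 = 0}"
    and closed: "\<And>h. (\<And>F. finite F \<Longrightarrow> \<exists>g\<in>G. \<forall>x\<in>F. g \<cdot> x = h \<cdot> x) \<Longrightarrow> h \<in> G"
    and cg_G: "cg perm_base G"
    and normal_generation: "\<And>V. sgp V \<Longrightarrow> V \<subseteq> G \<Longrightarrow> nrm V G \<Longrightarrow>
      (\<And>u. u \<in> G \<Longrightarrow> u \<cdot> 0 = 0 \<Longrightarrow> u \<in> V) \<Longrightarrow> V = G"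
    and wfr_G: "wfr perm_base G"
    and iso_elementary_G: "iso_elementary (TG perm_base G)"
    and compact_open: "\<exists>V. sgp V \<and> V \<subseteq> G \<and> openin (group_topology perm_base G) V \<and>
      compactin (group_topology perm_base G) V"

abbreviation big_perm :: "nat sym set \<Rightarrow> countable_ord \<Rightarrow> bool" where
  "big_perm \<equiv> big perm_base (\<lambda>g. g \<cdot> 0)"

definition lcoset :: "'a::mgroup set \<Rightarrow> 'a \<Rightarrow> 'a set" where
  "lcoset U g = (\<lambda>u. g * u) ` U"

lemma lcoset_eq_iff: "sgp U \<Longrightarrow> lcoset U g = lcoset U h \<longleftrightarrow> ginv g * h \<in> U"
proof
  assume U: "sgp U" and "lcoset U g = lcoset U h"
  moreover have "h \<in> lcoset U h" using sgp_one[OF U] by (force simp: lcoset_def)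
  ultimately obtain u where "u \<in> U" "h = g * u" by (auto simp: lcoset_def)
  then show "ginv g * h \<in> U" by simp
next
  assume U: "sgp U" and gh: "ginv g * h \<in> U"
  have "lcoset U b \<subseteq> lcoset U a" if "ginv a * b \<in> U" for a b
  proof
    fix x assume "x \<in> lcoset U b"
    then obtain u where "u \<in> U" "x = b * u" by (auto simp: lcoset_def)
    then have "x = a * (ginv a * b * u)" "ginv a * b * u \<in> U"
      using sgp_mult[OF U that] by (simp_all add: mult.assoc)
    then show "x \<in> lcoset U a" unfolding lcoset_def by blast
  qed
  moreover have "ginv h * g \<in> U" using sgp_ginv[OF U gh] by (simp add: ginv_mult)
  ultimately show "lcoset U g = lcoset U h" using gh by blast
qed

lemma lcoset_image: "(\<lambda>x. g * x) ` lcoset U h = lcoset U (g * h)"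
  by (simp add: lcoset_def image_image mult.assoc)

text \<open>The action of S on the cosets of U, with cosets numbered by the naturals. The hypothesis
  \<open>small\<close> says that finite intersections of conjugates of U are cofinal in N; this
  makes the action faithful and a homeomorphism onto its image, and with completeness of U it makes
  the image closed.\<close>

lemma (in tdlc) stage_of_cosets:
  assumes small: "\<And>n. n \<in> N \<Longrightarrow> \<exists>F. finite F \<and> F \<subseteq> S \<and> (\<forall>g\<in>S. (\<forall>a\<in>F. ginv a * g * a \<in> U) \<longrightarrow> g \<in> n)"
    and inf: "infinite (lcoset U ` S)"
    and cgS: "cg N S"
    and norm: "\<And>V. sgp V \<Longrightarrow> V \<subseteq> S \<Longrightarrow> nrm V S \<Longrightarrow> U \<subseteq> V \<Longrightarrow> V = S"
    and goodS: "good S"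
    and bigS: "big N (lcoset U) S \<alpha>"
  shows "\<exists>G. stage G \<and> big_perm G \<alpha>"
proof -
  let ?P = "lcoset U ` S"
  have sU: "sgp U" by (rule sgp_base[OF U_base])
  have one: "1 \<in> S" by (rule sgp_one[OF sgp_S])
  have "countable ?P"
  proof -
    obtain A where A: "countable A" "A \<subseteq> S" "\<forall>x\<in>S. \<exists>a\<in>A. ginv a * x \<in> U" using countable_cosets by blast
    have "?P \<subseteq> lcoset U ` A"
    proof (intro image_subsetI)
      fix x assume "x \<in> S"
      then obtain a where "a \<in> A" "ginv a * x \<in> U" using A(3) by blast
      then show "lcoset U x \<in> lcoset U ` A" using lcoset_eq_iff[OF sU, of a x] by (metis imageI)
    qed
    then show ?thesis using A(1) by (rule countable_subset[OF _ countable_image])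
  qed
  then have b0: "bij_betw (to_nat_on ?P) ?P UNIV" using inf by (rule to_nat_on_infinite)
  \<comment> \<open>The transposition corrects the numbering so that the coset U itself gets the
    number 0, the base point of a stage.\<close>
  define b where "b X = Transposition.transpose 0 (to_nat_on ?P (lcoset U 1)) (to_nat_on ?P X)" for X
  have bij: "bij_betw b ?P UNIV"
    unfolding b_def using bij_betw_trans[OF b0, of "Transposition.transpose 0 (to_nat_on ?P (lcoset U 1))" UNIV]
    by (simp add: o_def)
  have b1: "b (lcoset U 1) = 0" by (simp add: b_def)
  define c where "c = inv_into ?P b"
  have cb: "c (b X) = X" if "X \<in> ?P" for X
    using bij that unfolding c_def by (simp add: bij_betw_def)
  have cP: "c m \<in> ?P" and bc: "b (c m) = m" for m
    using bij unfolding c_def by (simp_all add: bij_betw_def inv_into_into f_inv_into_f)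
  have b_eq: "b (lcoset U g) = b (lcoset U h) \<longleftrightarrow> ginv g * h \<in> U" if "g \<in> S" "h \<in> S" for g h
    using bij that lcoset_eq_iff[OF sU, of g h] by (auto simp: bij_betw_def dest: inj_onD)
  have ex: "\<exists>h\<in>S. m = b (lcoset U h)" for m
    using cP[of m] bc[of m] by (metis imageE)
  define \<rho> where "\<rho> g = Sym (\<lambda>m. b ((\<lambda>x. g * x) ` c m))" for g
  have P_act: "(\<lambda>x. g * x) ` X \<in> ?P" if "g \<in> S" "X \<in> ?P" for g X
    using that by (auto simp: lcoset_image sgp_mult[OF sgp_S])
  have \<rho>_app: "\<rho> g \<cdot> m = b ((\<lambda>x. g * x) ` c m)" if g: "g \<in> S" for g m
    unfolding \<rho>_def
  proof (rule Sym_app[of "\<lambda>m. b ((\<lambda>x. ginv g * x) ` c m)"])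
    have gi: "ginv g \<in> S" by (rule sgp_ginv[OF sgp_S g])
    show "b ((\<lambda>x. ginv g * x) ` c (b ((\<lambda>x. g * x) ` c m))) = m" for m
      using P_act[OF g cP] by (simp add: cb image_image bc)
    show "b ((\<lambda>x. g * x) ` c (b ((\<lambda>x. ginv g * x) ` c m))) = m" for m
      using P_act[OF gi cP] by (simp add: cb image_image bc)
  qed
  have \<rho>_coset: "\<rho> g \<cdot> b (lcoset U h) = b (lcoset U (g * h))" if "g \<in> S" "h \<in> S" for g h
    using that by (simp add: \<rho>_app cb lcoset_image)
  have \<rho>_mult: "\<rho> (g * h) = \<rho> g * \<rho> h" if gh: "g \<in> S" "h \<in> S" for g h
  proof (rule sym_eqI)
    fix m obtain k where "k \<in> S" "m = b (lcoset U k)" using ex by blast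
    then show "\<rho> (g * h) \<cdot> m = (\<rho> g * \<rho> h) \<cdot> m"
      using gh by (simp add: \<rho>_coset sgp_mult[OF sgp_S] mult.assoc)
  qed
  have fix_iff: "\<rho> g \<cdot> b (lcoset U h) = b (lcoset U h) \<longleftrightarrow> ginv h * g * h \<in> U" if "g \<in> S" "h \<in> S" for g h
  proof -
    have "\<rho> g \<cdot> b (lcoset U h) = b (lcoset U h) \<longleftrightarrow> b (lcoset U h) = b (lcoset U (g * h))"
      using that by (auto simp: \<rho>_coset)
    then show ?thesis using b_eq[of h "g * h"] that by (simp add: sgp_mult[OF sgp_S] mult.assoc)
  qed
  have \<rho>_cont: "\<exists>n\<in>N. \<rho> ` (S \<inter> n) \<subseteq> m" if m: "m \<in> perm_base" for m
  proof -
    obtain F where F: "finite F" "m = fix_pts F" using m by (auto simp: perm_base_def)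
    have "\<exists>n\<in>N. \<forall>g\<in>S \<inter> n. \<rho> g \<cdot> x = x" for x
    proof -
      obtain h where h: "h \<in> S" "x = b (lcoset U h)" using ex[of x] by blast
      obtain n where "n \<in> N" "\<forall>k\<in>S \<inter> n. ginv h * k * ginv (ginv h) \<in> U"
        using conj_nbhd[OF sgp_ginv[OF sgp_S h(1)] U_base] by blast
      then show ?thesis using fix_iff[OF _ h(1)] h(2) by (intro bexI[of _ n]) auto
    qed
    then obtain n where n: "\<And>x. n x \<in> N" "\<And>x g. g \<in> S \<inter> n x \<Longrightarrow> \<rho> g \<cdot> x = x" by metis
    obtain k where k: "k \<in> N" "\<forall>x\<in>F. k \<subseteq> n x" using base_finite_Inter[OF F(1), of n] n(1) by blast
    have "\<rho> ` (S \<inter> k) \<subseteq> m" using n(2) k(2) by (auto simp: F(2) fix_pts_def)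
    then show ?thesis using k(1) by blast
  qed
  have \<rho>: "conthom \<rho> S N perm_base"
    using \<rho>_mult \<rho>_cont sgp_S by (auto simp: conthom_def)
  \<comment> \<open>The counterpart of continuity: fixing finitely many cosets forces membership in
    n, hence \<rho> is injective and its inverse is continuous.\<close>
  have small': "\<exists>F. finite F \<and> (\<forall>g\<in>S. \<rho> g \<in> fix_pts F \<longrightarrow> g \<in> n)" if n: "n \<in> N" for n
  proof -
    obtain F where F: "finite F" "F \<subseteq> S" "\<forall>g\<in>S. (\<forall>a\<in>F. ginv a * g * a \<in> U) \<longrightarrow> g \<in> n"
      using small[OF n] by blast
    have "g \<in> n" if g: "g \<in> S" "\<rho> g \<in> fix_pts ((\<lambda>a. b (lcoset U a)) ` F)" for g
    proof -
      have "ginv a * g * a \<in> U" if "a \<in> F" for a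
        using g that F(2) fix_iff[of g a] by (auto simp: fix_pts_def)
      then show ?thesis using F(3) g(1) by blast
    qed
    then show ?thesis using F(1) by (intro exI[of _ "(\<lambda>a. b (lcoset U a)) ` F"]) auto
  qed
  have inj: "inj_on \<rho> S"
  proof (rule inj_onI)
    fix g h assume gh: "g \<in> S" "h \<in> S" "\<rho> g = \<rho> h"
    have k: "ginv g * h \<in> S" using gh by (intro sgp_mult[OF sgp_S] sgp_ginv[OF sgp_S])
    have "\<rho> (ginv g * h) = 1"
      using gh by (simp add: \<rho>_mult sgp_ginv[OF sgp_S] conthom_ginv[OF \<rho>])
    then have "ginv g * h \<in> n" if "n \<in> N" for n
      using small'[OF that] k sgp_one[OF sgp_fix_pts] by metis
    then have "ginv g * h = 1" using separated[OF k] by blast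
    then show "g = h" by (metis ginv_ginv ginv_unique)
  qed
  define \<sigma> where "\<sigma> = inv_into S \<rho>"
  have \<sigma>\<rho>: "\<sigma> (\<rho> g) = g" if "g \<in> S" for g using inj that by (simp add: \<sigma>_def)
  let ?G = "\<rho> ` S"
  have sG: "sgp ?G" by (rule sgp_image[OF \<rho>])
  have \<sigma>: "conthom \<sigma> ?G perm_base N"
    unfolding conthom_def
  proof (intro conjI ballI)
    show "sgp ?G" by (rule sG)
    show "\<sigma> (x * y) = \<sigma> x * \<sigma> y" if xy: "x \<in> ?G" "y \<in> ?G" for x y
    proof -
      obtain g h where "g \<in> S" "h \<in> S" "x = \<rho> g" "y = \<rho> h" using xy by blast
      then show ?thesis using sgp_mult[OF sgp_S] by (simp add: \<sigma>\<rho> flip: \<rho>_mult)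
    qed
    fix n assume "n \<in> N"
    then obtain F where F: "finite F" "\<forall>g\<in>S. \<rho> g \<in> fix_pts F \<longrightarrow> g \<in> n" using small' by blast
    then have "\<sigma> ` (?G \<inter> fix_pts F) \<subseteq> n" by (auto simp: \<sigma>\<rho>)
    then show "\<exists>m\<in>perm_base. \<sigma> ` (?G \<inter> m) \<subseteq> n" using F(1) by (auto simp: perm_base_def)
  qed
  have hm: "homeomorphic_maps (group_topology N S) (group_topology perm_base ?G) \<rho> \<sigma>"
    unfolding homeomorphic_maps_def
  proof (intro conjI ballI)
    show "continuous_map (group_topology N S) (group_topology perm_base ?G) \<rho>"
      by (rule continuous_map_conthom[OF filter_base filter_base_perm_base sgp_S sG \<rho>]) simp
    show "continuous_map (group_topology perm_base ?G) (group_topology N S) \<sigma>"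
      by (rule continuous_map_conthom[OF filter_base_perm_base filter_base sG sgp_S \<sigma>]) (auto simp: \<sigma>\<rho>)
  qed (auto simp: topspace_T topspace_group_topology[OF filter_base_perm_base sG] \<sigma>\<rho>)
  have iso: "TG N S \<cong>\<^sub>t TG perm_base ?G"
  proof -
    have "\<rho> \<in> iso (TG N S) (TG perm_base ?G)"
      using inj \<rho>_mult by (auto simp: iso_def hom_def bij_betw_def)
    then show ?thesis
      using hm unfolding topgroup_iso_def by (intro bexI[of _ \<rho>]) (simp_all add: homeomorphic_maps_map)
  qed
  interpret G: filtered_group perm_base ?G by (rule filtered_group_perm_base[OF sG])
  have "stage ?G"
  proof
    show "sgp ?G" by (rule sG)
    show "\<exists>g\<in>?G. g \<cdot> 0 = x" for x
    proof -
      obtain h where "h \<in> S" "x = b (lcoset U h)" using ex by blast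
      then show ?thesis using \<rho>_coset[of h 1] one b1 by (intro bexI[of _ "\<rho> h"]) auto
    qed
    show "finite {u \<cdot> x |u. u \<in> ?G \<and> u \<cdot> 0 = 0}" for x
    proof -
      obtain h where h: "h \<in> S" "x = b (lcoset U h)" using ex by blast
      obtain n where n: "n \<in> N" "\<forall>k\<in>S \<inter> n. ginv h * k * ginv (ginv h) \<in> U"
        using conj_nbhd[OF sgp_ginv[OF sgp_S h(1)] U_base] by blast
      obtain F where F: "finite F" "F \<subseteq> U" "\<forall>u\<in>U. \<exists>f\<in>F. ginv f * u \<in> n" using finite_index[OF n(1)] by blast
      have "{u \<cdot> x |u. u \<in> ?G \<and> u \<cdot> 0 = 0} \<subseteq> (\<lambda>f. b (lcoset U (f * h))) ` F"
      proof
        fix y assume "y \<in> {u \<cdot> x |u. u \<in> ?G \<and> u \<cdot> 0 = 0}"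
        then obtain g where g: "g \<in> S" "\<rho> g \<cdot> 0 = 0" "y = \<rho> g \<cdot> x" by blast
        have "g \<in> U" using fix_iff[OF g(1) one] g(2) b1 by simp
        then obtain f where f: "f \<in> F" "ginv f * g \<in> n" using F(3) by blast
        have fS: "f \<in> S" using f(1) F(2) U_subset by blast
        have "ginv f * g \<in> S" using fS g(1) by (intro sgp_mult[OF sgp_S] sgp_ginv[OF sgp_S])
        then have "ginv h * (ginv f * g) * ginv (ginv h) \<in> U" using n(2) f(2) by blast
        then have "b (lcoset U (f * h)) = b (lcoset U (g * h))"
          using b_eq[of "f * h" "g * h"] fS g(1) h(1) by (simp add: sgp_mult[OF sgp_S] ginv_mult mult.assoc)
        then show "y \<in> (\<lambda>f. b (lcoset U (f * h))) ` F" using g h f(1) by (intro image_eqI[of _ _ f]) (simp_all add: \<rho>_coset)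
      qed
      then show ?thesis using F(1) finite_surj by blast
    qed
    \<comment> \<open>The elements \<open>g m\<close> agree with p on {..m}. All of them agree at 0,
      so every \<open>ginv (g 0) * g m\<close> lies in U; by \<open>small\<close> these form a
      Cauchy sequence, and completeness of U supplies its limit.\<close>
    show "p \<in> ?G" if p: "\<And>F. finite F \<Longrightarrow> \<exists>g\<in>?G. \<forall>x\<in>F. g \<cdot> x = p \<cdot> x" for p
    proof -
      have "\<exists>g\<in>S. \<forall>x\<le>m. \<rho> g \<cdot> x = p \<cdot> x" for m using p[of "{..m}"] by auto
      then obtain g where g: "\<And>m. g m \<in> S" "\<And>m x. x \<le> m \<Longrightarrow> \<rho> (g m) \<cdot> x = p \<cdot> x" by metis
      have eq: "ginv a * (ginv (g k) * g m) * a \<in> U"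
        if "a \<in> S" "b (lcoset U a) \<le> k" "b (lcoset U a) \<le> m" for a k m
      proof -
        have k: "ginv (g k) * g m \<in> S" by (intro sgp_mult[OF sgp_S] sgp_ginv[OF sgp_S] g(1))
        have "\<rho> (ginv (g k) * g m) = ginv (\<rho> (g k)) * \<rho> (g m)"
          using g(1) by (simp add: \<rho>_mult sgp_ginv[OF sgp_S] conthom_ginv[OF \<rho>])
        moreover have "\<rho> (g m) \<cdot> b (lcoset U a) = \<rho> (g k) \<cdot> b (lcoset U a)" using that g(2) by simp
        ultimately have "\<rho> (ginv (g k) * g m) \<cdot> b (lcoset U a) = b (lcoset U a)" by simp
        then show ?thesis using fix_iff[OF k that(1)] by blast
      qed
      have near: "\<exists>M. \<forall>k\<ge>M. \<forall>m\<ge>M. ginv (g k) * g m \<in> n" if n: "n \<in> N" for n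
      proof -
        obtain F where F: "finite F" "F \<subseteq> S" "\<forall>g\<in>S. (\<forall>a\<in>F. ginv a * g * a \<in> U) \<longrightarrow> g \<in> n"
          using small[OF n] by blast
        let ?M = "Max (insert 0 ((\<lambda>a. b (lcoset U a)) ` F))"
        have "b (lcoset U a) \<le> ?M" if "a \<in> F" for a using F(1) that by simp
        then have "ginv (g k) * g m \<in> n" if "k \<ge> ?M" "m \<ge> ?M" for k m
          using F(2,3) eq[of _ k m] that g(1) sgp_mult[OF sgp_S] sgp_ginv[OF sgp_S]
          by (meson order_trans subsetD)
        then show ?thesis by blast
      qed
      have uU: "ginv (g 0) * g m \<in> U" for m
        using eq[of 1 0 m] one b1 by simp
      have "\<exists>x\<in>U. \<forall>n\<in>N. \<exists>M. \<forall>m\<ge>M. ginv x * (ginv (g 0) * g m) \<in> n"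
      proof (rule complete[OF uU])
        fix n assume "n \<in> N"
        then obtain M where "\<forall>k\<ge>M. \<forall>m\<ge>M. ginv (g k) * g m \<in> n" using near by blast
        then show "\<exists>M. \<forall>m\<ge>M. ginv (ginv (g 0) * g M) * (ginv (g 0) * g m) \<in> n"
          by (intro exI[of _ M]) (simp add: ginv_mult mult.assoc)
      qed
      then obtain x where x: "x \<in> U" "\<forall>n\<in>N. \<exists>M. \<forall>m\<ge>M. ginv x * (ginv (g 0) * g m) \<in> n" by blast
      let ?h = "g 0 * x"
      have hS: "?h \<in> S" using x(1) U_subset g(1) by (intro sgp_mult[OF sgp_S]) blast+
      have "\<rho> ?h = p"
      proof (rule sym_eqI)
        fix y obtain a where a: "a \<in> S" "y = b (lcoset U a)" using ex by blast
        obtain n where n: "n \<in> N" "\<forall>k\<in>S \<inter> n. ginv a * k * ginv (ginv a) \<in> U"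
          using conj_nbhd[OF sgp_ginv[OF sgp_S a(1)] U_base] by blast
        obtain M where M: "\<forall>m\<ge>M. ginv x * (ginv (g 0) * g m) \<in> n" using x(2) n(1) by blast
        define m where "m = max M y"
        have k: "ginv ?h * g m \<in> S" by (intro sgp_mult[OF sgp_S] sgp_ginv[OF sgp_S] g(1) hS)
        moreover have "ginv ?h * g m \<in> n" using M by (simp add: m_def ginv_mult mult.assoc)
        ultimately have "ginv a * (ginv ?h * g m) * a \<in> U" using n(2) by auto
        then have "b (lcoset U (?h * a)) = b (lcoset U (g m * a))"
          using b_eq[OF sgp_mult[OF sgp_S hS a(1)] sgp_mult[OF sgp_S g(1) a(1)]]
          by (simp add: ginv_mult mult.assoc)
        then have "\<rho> ?h \<cdot> y = \<rho> (g m) \<cdot> y" using a hS g(1) by (simp add: \<rho>_coset)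
        then show "\<rho> ?h \<cdot> y = p \<cdot> y" using g(2)[of y m] by (simp add: m_def)
      qed
      then show ?thesis using hS by blast
    qed
    show "cg perm_base ?G" by (rule cg_image[OF \<rho> cgS])
    show "V = ?G" if V: "sgp V" "V \<subseteq> ?G" "nrm V ?G" "\<And>u. u \<in> ?G \<Longrightarrow> u \<cdot> 0 = 0 \<Longrightarrow> u \<in> V" for V
    proof -
      have "{x \<in> S. \<rho> x \<in> V} = S"
      proof (rule norm)
        show "sgp {x \<in> S. \<rho> x \<in> V}" by (rule sgp_vimage[OF \<rho> V(1)])
        show "nrm {x \<in> S. \<rho> x \<in> V} S" by (rule nrm_vimage[OF \<rho> V(3)]) simp
        show "U \<subseteq> {x \<in> S. \<rho> x \<in> V}"
        proof
          fix u assume "u \<in> U"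
          moreover have "u \<in> S" using calculation U_subset by blast
          moreover have "\<rho> u \<cdot> 0 = 0" using fix_iff[OF calculation(2) one] calculation(1) b1 by simp
          ultimately show "u \<in> {x \<in> S. \<rho> x \<in> V}" using V(4) by blast
        qed
      qed blast
      then show ?thesis using V(2) by blast
    qed
    \<comment> \<open>Well-foundedness is transported along the inverse map, seen as an extension
      with trivial kernel.\<close>
    show "wfr perm_base ?G"
    proof (rule wfr_extension[OF _ \<sigma>])
      show "wfr N S" using goodS by (simp add: good_def)
      show "\<sigma> ` ?G \<subseteq> S" by (auto simp: \<sigma>\<rho>)
      have "{x \<in> ?G. \<sigma> x = 1} \<subseteq> {1}" using conthom_one[OF \<rho>] by (auto simp: \<sigma>\<rho>)
      then show "wfr perm_base {x \<in> ?G. \<sigma> x = 1}" by (rule wfr_subset[OF wfr_trivial])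
    qed
    have "TG perm_base ?G \<cong>\<^sub>t TG N S"
      by (rule topgroup_iso_sym[OF topological_group_TG _ iso]) (simp add: G.topspace_T)
    then show "iso_elementary (TG perm_base ?G)"
      using goodS topgroup_iso_trans unfolding good_def iso_elementary_def by blast
    have U: "openin T U" "compactin T U"
      using openin_filter_base[OF filter_base sgp_S U_base] U_subset compactin_U by (simp_all add: Int_absorb1)
    have "homeomorphic_map T (group_topology perm_base ?G) \<rho>" using hm homeomorphic_maps_map by blast
    then have "openin (group_topology perm_base ?G) (\<rho> ` U)"
      using U(1) U_subset by (simp add: homeomorphic_map_openness topspace_T)
    moreover have "compactin (group_topology perm_base ?G) (\<rho> ` U)"
      using hm by (intro image_compactin[OF U(2)]) (simp add: homeomorphic_maps_def)
    moreover have "sgp (\<rho> ` U)" by (rule sgp_image[OF conthom_subset[OF \<rho> sU U_subset]])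
    ultimately show "\<exists>V. sgp V \<and> V \<subseteq> ?G \<and> openin (group_topology perm_base ?G) V \<and>
        compactin (group_topology perm_base ?G) V"
      using U_subset by (intro exI[of _ "\<rho> ` U"]) auto
  qed
  moreover have "big_perm ?G \<alpha>"
  proof (rule big_image[OF bigS order_refl \<rho>])
    fix C assume C: "C \<subseteq> S" "infinite (lcoset U ` C)"
    have "\<rho> g \<cdot> 0 = b (lcoset U g)" if "g \<in> S" for g using \<rho>_coset[OF that one] b1 by simp
    then have "(\<lambda>g. g \<cdot> 0) ` \<rho> ` C = b ` lcoset U ` C"
      using C(1) by (force simp: image_image)
    moreover have "inj_on b (lcoset U ` C)"
      using bij C(1) inj_on_subset by (meson bij_betw_def image_mono)
    ultimately show "infinite ((\<lambda>g. g \<cdot> 0) ` \<rho> ` C)" using C(2) by (simp add: finite_image_iff)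
  qed
  ultimately show ?thesis by blast
qed

section \<open>The affine symmetric group\<close>

text \<open>The affine symmetric group on three letters, acting on the integers. It preserves the order
  generated by \<open>i < i + 3\<close>, contains elements with \<open>i\<close> strictly below its image, and is generated as a
  normal subgroup by an involution.\<close>

definition refl :: "int \<Rightarrow> int sym" where
  "refl c = Sym (\<lambda>i. if (i - c) mod 3 = 0 then i + 1 else if (i - c) mod 3 = 1 then i - 1 else i)"

lemma refl_app:
  "refl c \<cdot> i = (if (i - c) mod 3 = 0 then i + 1 else if (i - c) mod 3 = 1 then i - 1 else i)"
proof -
  have [simp]: "(i + 1 - c) mod 3 = 1" if "(i - c) mod 3 = 0" for i using that by presburger
  have [simp]: "(i - 1 - c) mod 3 = 0" if "(i - c) mod 3 = 1" for i using that by presburger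
  show ?thesis
    unfolding refl_def by (rule Sym_app[of "\<lambda>i. if (i - c) mod 3 = 0 then i + 1 else if (i - c) mod 3 = 1 then i - 1 else i"]) auto
qed

lemma refl_involution [simp]: "refl c * refl c = 1"
proof (rule sym_eqI)
  fix i
  have "(i + 1 - c) mod 3 = 1" if "(i - c) mod 3 = 0" using that by presburger
  moreover have "(i - 1 - c) mod 3 = 0" if "(i - c) mod 3 = 1" using that by presburger
  ultimately show "(refl c * refl c) \<cdot> i = 1 \<cdot> i" by (simp add: refl_app)
qed

lemma ginv_refl: "ginv (refl c) = refl c"
  by (rule ginv_unique) simp

text \<open>The braid relation of neighbouring reflections; three letters are the smallest number
  for which all generators are linked by such relations. The two sides are compared separately on
  the three residue classes.\<close>

lemma refl_braid: "refl c * (refl (c + 1) * refl c) = refl (c + 1) * (refl c * refl (c + 1))"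
proof (rule sym_eqI)
  fix i :: int
  have "(i - c) mod 3 = 0 \<or> (i - c) mod 3 = 1 \<or> (i - c) mod 3 = 2" by presburger
  then consider "(i - c) mod 3 = 0" | "(i - c) mod 3 = 1" | "(i - c) mod 3 = 2" by blast
  then show "(refl c * (refl (c + 1) * refl c)) \<cdot> i = (refl (c + 1) * (refl c * refl (c + 1))) \<cdot> i"
  proof cases
    case 1
    then have "(i + 1 - c) mod 3 = 1" "(i - (c + 1)) mod 3 = 2" "(i + 1 - (c + 1)) mod 3 = 0"
      "(2 + i - c) mod 3 = 2" "(i + 2 - (c + 1)) mod 3 = 1" by presburger+
    then show ?thesis using 1 by (simp add: refl_app)
  next
    case 2
    then have "(i - 1 - c) mod 3 = 0" "(i - 1 - (c + 1)) mod 3 = 2" "(i - (c + 1)) mod 3 = 0"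
      "(i + 1 - c) mod 3 = 2" "(i + 1 - (c + 1)) mod 3 = 1" by presburger+
    then show ?thesis using 2 by (simp add: refl_app)
  next
    case 3
    then have "(i - (c + 1)) mod 3 = 1" "(i - 1 - c) mod 3 = 1" "(i - 2 - c) mod 3 = 0"
      "(i - 2 - (c + 1)) mod 3 = 2" "(i - 1 - (c + 1)) mod 3 = 0" by presburger+
    then show ?thesis using 3 by (simp add: refl_app)
  qed
qed

text \<open>With s and t for the two reflections, s t s t s = t s t t s = t by the braid
  relation.\<close>

lemma refl_conj: "refl (c + 1) = (refl c * refl (c + 1)) * refl c * ginv (refl c * refl (c + 1))"
proof -
  have "(refl c * refl (c + 1)) * refl c * ginv (refl c * refl (c + 1)) =
      (refl c * (refl (c + 1) * refl c)) * (refl (c + 1) * refl c)"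
    by (simp add: ginv_mult ginv_refl mult.assoc)
  also have "\<dots> = refl (c + 1) * (refl c * (refl (c + 1) * refl (c + 1)) * refl c)"
    unfolding refl_braid by (simp only: mult.assoc)
  finally show ?thesis by simp
qed

definition D :: "int sym set" where
  "D = gen {refl 0, refl 1, refl 2}"

lemma sgp_D: "sgp D"
  unfolding D_def by (rule sgp_gen)

lemma refl_in_D: "refl 0 \<in> D" "refl 1 \<in> D" "refl 2 \<in> D"
  using gen_superset[of "{refl 0, refl 1, refl 2}"] unfolding D_def by simp_all

lemma countable_D: "countable D"
  unfolding D_def by (rule countable_gen) simp

lemma finite_subset_of_chain:
  assumes "finite X" "\<And>i::nat. V i \<subseteq> V (Suc i)" "X \<subseteq> (\<Union>i. V i)" shows "\<exists>i. X \<subseteq> V i"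
  using compactin_subset_of_chain[of "discrete_topology UNIV" X V] assms by (simp add: compactin_discrete_topology)

text \<open>Each of the finitely many pieces lies in some member of the chain, and the largest index
  takes them all.\<close>

lemma cg_gen_UN:
  fixes X :: "'i \<Rightarrow> 'a::mgroup set"
  assumes I: "finite I" and X: "\<And>i. i \<in> I \<Longrightarrow> sgp (X i) \<and> cg N (X i)"
  shows "cg N (gen (\<Union>i\<in>I. X i))"
  unfolding cg_def
proof (intro allI impI)
  let ?C = "gen (\<Union>i\<in>I. X i)"
  fix V :: "nat \<Rightarrow> 'a set"
  assume V: "\<forall>i. relopen N ?C (V i) \<and> V i \<subseteq> V (Suc i)" and u: "(\<Union>i. V i) = ?C"
  have incr: "V i \<subseteq> V (Suc i)" for i using V by simp
  have "\<exists>k. X i \<subseteq> V k" if "i \<in> I" for i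
  proof (rule cg_subset_chain[of N "X i" ?C V])
    show "X i \<subseteq> ?C" using gen_superset[of "\<Union>i\<in>I. X i"] that by blast
  qed (use X[OF that] V u in auto)
  then obtain k where k: "\<And>i. i \<in> I \<Longrightarrow> X i \<subseteq> V (k i)" by metis
  have mono: "V i \<subseteq> V j" if "i \<le> j" for i j using incr that by (rule lift_Suc_mono_le)
  have "X i \<subseteq> V (Max (k ` I))" if "i \<in> I" for i
    using k[OF that] mono[of "k i" "Max (k ` I)"] I that by simp
  then have "?C \<subseteq> V (Max (k ` I))" using V by (intro gen_least UN_least) (simp_all add: relopen_def)
  moreover have "V (Max (k ` I)) \<subseteq> ?C" using V by (simp add: relopen_def)
  ultimately show "\<exists>i. V i = ?C" by (intro exI subset_antisym)
qed

lemma cg_gen_finite: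
  assumes "finite X" shows "cg N (gen X)"
  unfolding cg_def
proof (intro allI impI)
  fix V :: "nat \<Rightarrow> 'a set"
  assume V: "\<forall>i. relopen N (gen X) (V i) \<and> V i \<subseteq> V (Suc i)" and u: "(\<Union>i. V i) = gen X"
  have "V i \<subseteq> V (Suc i)" for i using V by simp
  moreover have "X \<subseteq> (\<Union>i. V i)" unfolding u by (rule gen_superset)
  ultimately obtain i where "X \<subseteq> V i" using finite_subset_of_chain[OF assms] by blast
  then have "gen X \<subseteq> V i" using V by (intro gen_least) (simp_all add: relopen_def)
  moreover have "V i \<subseteq> gen X" using V by (simp add: relopen_def)
  ultimately show "\<exists>i. V i = gen X" by (intro exI subset_antisym)
qed

lemma D_shift: "d \<in> D \<Longrightarrow> d \<cdot> (i + 3) = d \<cdot> i + 3"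
proof -
  let ?S = "{d :: int sym. \<forall>i. d \<cdot> (i + 3) = d \<cdot> i + 3}"
  have "sgp ?S"
  proof (rule sgpI)
    show "ginv x \<in> ?S" if "x \<in> ?S" for x
    proof -
      have "ginv x \<cdot> (i + 3) = ginv x \<cdot> i + 3" for i
      proof -
        have "x \<cdot> (ginv x \<cdot> i + 3) = i + 3" using that by simp
        then show ?thesis by (metis ginv_app)
      qed
      then show ?thesis by simp
    qed
  qed auto
  moreover have "refl c \<in> ?S" for c
  proof -
    have "(i + 3 - c) mod 3 = (i - c) mod 3" for i by presburger
    then show ?thesis by (simp add: refl_app)
  qed
  ultimately have "D \<subseteq> ?S" unfolding D_def by (intro gen_least) auto
  then show "d \<in> D \<Longrightarrow> d \<cdot> (i + 3) = d \<cdot> i + 3" by blast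
qed

lemma D_transitive: "\<exists>d\<in>D. d \<cdot> 0 = i"
proof (induction i rule: int_induct[of _ 0])
  case base
  then show ?case using sgp_one[OF sgp_D] by force
next
  case (step1 i)
  then obtain d where d: "d \<in> D" "d \<cdot> 0 = i" by blast
  have "i mod 3 = 0 \<or> i mod 3 = 1 \<or> i mod 3 = 2" by presburger
  \<comment> \<open>The reflection \<open>refl c\<close> exchanges i and i + 1 whenever i and c are
    congruent modulo 3.\<close>
  then have "refl (i mod 3) \<in> D" using refl_in_D by auto
  moreover have "(i - i mod 3) mod 3 = 0" by presburger
  ultimately show ?case using d sgp_mult[OF sgp_D]
    by (intro bexI[of _ "refl (i mod 3) * d"]) (auto simp: refl_app)
next
  case (step2 i)
  then obtain d where d: "d \<in> D" "d \<cdot> 0 = i" by blast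
  have "(i - 1) mod 3 = 0 \<or> (i - 1) mod 3 = 1 \<or> (i - 1) mod 3 = 2" by presburger
  then have "refl ((i - 1) mod 3) \<in> D" using refl_in_D by auto
  moreover have "(i - (i - 1) mod 3) mod 3 = 1" by presburger
  ultimately show ?case using d sgp_mult[OF sgp_D]
    by (intro bexI[of _ "refl ((i - 1) mod 3) * d"]) (auto simp: refl_app)
qed

text \<open>By \<open>refl_conj\<close> a normal subgroup that contains \<open>refl 0\<close> also
  contains \<open>refl 1\<close>, and then \<open>refl 2\<close>. The finite group generated by
  \<open>refl 0\<close> can therefore play the part of the compact open subgroup.\<close>

lemma D_normal_generation:
  assumes V: "sgp V" "V \<subseteq> D" "nrm V D" "refl 0 \<in> V" shows "V = D"
proof -
  have step: "refl (c + 1) \<in> V" if "refl c \<in> V" "refl (c + 1) \<in> D" for c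
  proof -
    have "refl c * refl (c + 1) \<in> D" using that V(2) by (intro sgp_mult[OF sgp_D]) auto
    then have "(refl c * refl (c + 1)) * refl c * ginv (refl c * refl (c + 1)) \<in> V"
      using V(3) that(1) unfolding nrm_def by blast
    then show ?thesis using refl_conj[of c] by simp
  qed
  have "refl 1 \<in> V" using step[of 0] V(4) refl_in_D by simp
  then have "refl 2 \<in> V" using step[of 1] refl_in_D by simp
  then have "D \<subseteq> V" unfolding D_def using V(1,4) \<open>refl 1 \<in> V\<close> by (intro gen_least) auto
  then show ?thesis using V(2) by blast
qed

definition le3 :: "int \<Rightarrow> int \<Rightarrow> bool" where
  "le3 i j \<longleftrightarrow> (\<exists>k::nat. j = i + 3 * int k)"

definition lt3 :: "int \<Rightarrow> int \<Rightarrow> bool" where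
  "lt3 i j \<longleftrightarrow> le3 i j \<and> i \<noteq> j"

lemma le3_iff: "le3 i j \<longleftrightarrow> i \<le> j \<and> 3 dvd (j - i)"
proof
  assume "i \<le> j \<and> 3 dvd (j - i)"
  then obtain k where "j - i = 3 * k" "0 \<le> k" by (auto elim!: dvdE)
  then show "le3 i j" unfolding le3_def by (intro exI[of _ "nat k"]) simp
qed (auto simp: le3_def)

lemma le3_refl [simp]: "le3 i i"
  by (simp add: le3_iff)

lemma lt3_irrefl [simp]: "\<not> lt3 i i"
  by (simp add: lt3_def)

lemma le3_trans: "le3 i j \<Longrightarrow> le3 j k \<Longrightarrow> le3 i k"
  unfolding le3_iff by (metis diff_add_cancel add_diff_eq dvd_add order_trans)

lemma le3_antisym: "le3 i j \<Longrightarrow> le3 j i \<Longrightarrow> i = j"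
  by (simp add: le3_iff)

lemma le3_lt3: "le3 i j \<longleftrightarrow> i = j \<or> lt3 i j"
  by (auto simp: lt3_def)

lemma lt3_le3_trans: "lt3 i j \<Longrightarrow> le3 j k \<Longrightarrow> lt3 i k"
  using le3_trans le3_antisym unfolding lt3_def by metis

lemma le3_D: assumes "d \<in> D" shows "le3 (d \<cdot> i) (d \<cdot> j) \<longleftrightarrow> le3 i j"
proof -
  have sh: "d \<cdot> (i + 3 * int k) = d \<cdot> i + 3 * int k" if "d \<in> D" for d i k
  proof (induction k)
    case (Suc k)
    have "d \<cdot> (i + 3 * int (Suc k)) = d \<cdot> ((i + 3 * int k) + 3)" by (simp add: algebra_simps)
    also have "\<dots> = d \<cdot> (i + 3 * int k) + 3" by (rule D_shift[OF that])
    finally show ?case using Suc by simp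
  qed simp
  show ?thesis
  proof
    assume "le3 (d \<cdot> i) (d \<cdot> j)"
    then obtain k where "d \<cdot> j = d \<cdot> i + 3 * int k" by (auto simp: le3_def)
    then have "d \<cdot> j = d \<cdot> (i + 3 * int k)" using sh[OF assms] by simp
    then show "le3 i j" by (auto simp: le3_def)
  next
    assume "le3 i j"
    then show "le3 (d \<cdot> i) (d \<cdot> j)" using sh[OF assms] by (auto simp: le3_def)
  qed
qed

lemma lt3_D: "d \<in> D \<Longrightarrow> lt3 (d \<cdot> i) (d \<cdot> j) \<longleftrightarrow> lt3 i j"
  by (simp add: lt3_def le3_D)

section \<open>Triangular permutations of finitely supported functions\<close>

text \<open>The vertices of a forest with three components: a vertex on level \<open>i\<close> is given by the
  coordinates above \<open>i\<close> of a finitely supported function, and its children by the coordinate at \<open>i\<close>.\<close>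

type_synonym fs = "int \<Rightarrow>\<^sub>0 nat"

abbreviation lookup :: "fs \<Rightarrow> int \<Rightarrow> nat" where
  "lookup \<equiv> Poly_Mapping.lookup"

abbreviation keys :: "fs \<Rightarrow> int set" where
  "keys \<equiv> Poly_Mapping.keys"

abbreviation upd :: "int \<Rightarrow> nat \<Rightarrow> fs \<Rightarrow> fs" where
  "upd \<equiv> Poly_Mapping.update"

lift_definition mix :: "int set \<Rightarrow> fs \<Rightarrow> fs \<Rightarrow> fs" is "\<lambda>A f g i. if i \<in> A then f i else g i"
proof -
  fix A and f g :: "int \<Rightarrow> nat" assume "finite {i. f i \<noteq> 0}" "finite {i. g i \<noteq> 0}"
  then have "finite ({i. f i \<noteq> 0} \<union> {i. g i \<noteq> 0})" by simp
  then show "finite {i. (if i \<in> A then f i else g i) \<noteq> 0}"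
    by (rule finite_subset[rotated]) auto
qed

lift_definition shiftf :: "int sym \<Rightarrow> fs \<Rightarrow> fs" is "\<lambda>d f i. f (ginv d \<cdot> i)"
proof -
  fix d :: "int sym" and f :: "int \<Rightarrow> nat" assume "finite {i. f i \<noteq> 0}"
  then have "finite ((\<lambda>i. d \<cdot> i) ` {i. f i \<noteq> 0})" by simp
  moreover have "{i. f (ginv d \<cdot> i) \<noteq> 0} \<subseteq> (\<lambda>i. d \<cdot> i) ` {i. f i \<noteq> 0}"
    by (auto intro!: image_eqI[of _ _ "ginv d \<cdot> _"])
  ultimately show "finite {i. f (ginv d \<cdot> i) \<noteq> 0}" by (rule finite_subset[rotated])
qed

lemma lookup_mix [simp]: "lookup (mix A f g) i = (if i \<in> A then lookup f i else lookup g i)"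
  by transfer simp

lemma lookup_shiftf [simp]: "lookup (shiftf d f) i = lookup f (ginv d \<cdot> i)"
  by transfer simp

lemma lookup_upd [simp]: "lookup (upd i x f) j = (if j = i then x else lookup f j)"
  by (simp add: lookup_update)

lemma countable_fs: "countable (UNIV :: fs set)"
proof -
  let ?g = "\<lambda>f :: fs. (\<lambda>i. (i, lookup f i)) ` keys f"
  have "inj ?g"
  proof (rule injI, rule poly_mapping_eqI)
    fix f g :: fs and i assume *: "?g f = ?g g"
    have "lookup f i = x \<longleftrightarrow> (i, x) \<in> ?g f" if "x \<noteq> 0" for f :: fs and x
      using that by (auto simp: in_keys_iff)
    then show "lookup f i = lookup g i" using * by metis
  qed
  moreover have "countable (range ?g)"
    by (rule countable_subset[OF _ countable_Collect_finite]) auto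
  ultimately show ?thesis using countable_image_inj_on by blast
qed

text \<open>The vertex on level i that f passes through, with all coordinates not belonging to it
  normalised to 0.\<close>

definition trunc :: "int \<Rightarrow> fs \<Rightarrow> fs" where
  "trunc i f = mix {j. lt3 i j} f 0"

lemma lookup_trunc [simp]: "lookup (trunc i f) j = (if lt3 i j then lookup f j else 0)"
  by (simp add: trunc_def)

lemma trunc_eq_iff: "trunc i f = trunc i g \<longleftrightarrow> (\<forall>j. lt3 i j \<longrightarrow> lookup f j = lookup g j)"
  by (auto simp: poly_mapping_eq_iff fun_eq_iff)

lemma trunc_trunc [simp]: "trunc i (trunc i f) = trunc i f"
  by (simp add: trunc_eq_iff)

lemma trunc_upd [simp]: "\<not> lt3 i j \<Longrightarrow> trunc i (upd j x f) = trunc i f"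
  by (auto simp: trunc_eq_iff)

lemma trunc_zero [simp]: "trunc i 0 = 0"
  by (simp add: poly_mapping_eq_iff fun_eq_iff)

lemma upd_lookup [simp]: "upd i (lookup f i) f = f"
  by (simp add: poly_mapping_eq_iff fun_eq_iff)

lemma upd_upd [simp]: "upd i x (upd i y f) = upd i x f"
  by (simp add: poly_mapping_eq_iff fun_eq_iff)

text \<open>Agreement of f and g on the vertex of level i together with the child chosen
  there.\<close>

definition eqa :: "int \<Rightarrow> fs \<Rightarrow> fs \<Rightarrow> bool" where
  "eqa i f g \<longleftrightarrow> (\<forall>j. le3 i j \<longrightarrow> lookup f j = lookup g j)"

lemma eqa_iff: "eqa i f g \<longleftrightarrow> trunc i f = trunc i g \<and> lookup f i = lookup g i"
  by (auto simp: eqa_def trunc_eq_iff le3_lt3)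

text \<open>Such an h is an automorphism of the forest that covers the permutation d of the levels.
  The condition is an equivalence so that it passes to inverses.\<close>

definition tri :: "int sym \<Rightarrow> fs sym \<Rightarrow> bool" where
  "tri d h \<longleftrightarrow> d \<in> D \<and> (\<forall>i f g. eqa (d \<cdot> i) (h \<cdot> f) (h \<cdot> g) \<longleftrightarrow> eqa i f g)"

lemma tri_eqa: "tri d h \<Longrightarrow> eqa (d \<cdot> i) (h \<cdot> f) (h \<cdot> g) \<longleftrightarrow> eqa i f g"
  by (simp add: tri_def)

lemma tri_D: "tri d h \<Longrightarrow> d \<in> D"
  by (simp add: tri_def)

lemma tri_one: "tri 1 1"
  by (simp add: tri_def sgp_one[OF sgp_D])

lemma tri_mult: "tri d h \<Longrightarrow> tri e k \<Longrightarrow> tri (d * e) (h * k)"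
  by (simp add: tri_def sgp_mult[OF sgp_D])

lemma tri_ginv: assumes "tri d h" shows "tri (ginv d) (ginv h)"
  using assms tri_eqa[OF assms, of "ginv d \<cdot> _" "ginv h \<cdot> _" "ginv h \<cdot> _"]
  by (simp add: tri_def[of "ginv d"] tri_D sgp_ginv[OF sgp_D])

lemma triI:
  assumes "d \<in> D" "\<And>i f g. eqa i f g \<Longrightarrow> eqa (d \<cdot> i) (h \<cdot> f) (h \<cdot> g)"
    "\<And>i f g. eqa i f g \<Longrightarrow> eqa (ginv d \<cdot> i) (ginv h \<cdot> f) (ginv h \<cdot> g)"
  shows "tri d h"
  unfolding tri_def using assms by (metis ginv_app)

lemma tri_trunc:
  assumes "tri d h" shows "trunc (d \<cdot> i) (h \<cdot> f) = trunc (d \<cdot> i) (h \<cdot> g) \<longleftrightarrow> trunc i f = trunc i g"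
proof -
  have *: "trunc i f = trunc i g \<longleftrightarrow> (\<forall>j. lt3 i j \<longrightarrow> eqa j f g)" for i f g
    unfolding trunc_eq_iff eqa_def using lt3_le3_trans le3_refl by blast
  have "(\<forall>j. lt3 (d \<cdot> i) j \<longrightarrow> eqa j (h \<cdot> f) (h \<cdot> g)) \<longleftrightarrow> (\<forall>j. lt3 i j \<longrightarrow> eqa j f g)"
    using tri_eqa[OF assms] lt3_D[OF tri_D[OF assms]] by (metis app_ginv)
  then show ?thesis by (simp add: *)
qed

text \<open>The level permutation can be read off from h: the zero function and a function supported
  at a single level j agree from level i upwards exactly when j is not above or equal to i.\<close>

lemma tri_unique:
  assumes "tri d h" "tri e h" shows "d = e"
proof (rule sym_eqI)
  fix i
  have *: "eqa (d \<cdot> i) f g \<longleftrightarrow> eqa (e \<cdot> i) f g" for f g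
    using tri_eqa[OF assms(1), of i "ginv h \<cdot> f" "ginv h \<cdot> g"]
      tri_eqa[OF assms(2), of i "ginv h \<cdot> f" "ginv h \<cdot> g"] by simp
  have t: "eqa i 0 (upd j 1 0) \<longleftrightarrow> \<not> le3 i j" for i j
    by (auto simp: eqa_def)
  have "le3 (e \<cdot> i) (d \<cdot> i)" "le3 (d \<cdot> i) (e \<cdot> i)"
    using *[of 0 "upd (d \<cdot> i) 1 0"] *[of 0 "upd (e \<cdot> i) 1 0"] unfolding t by simp_all
  then show "d \<cdot> i = e \<cdot> i" by (intro le3_antisym)
qed

text \<open>The local action of \<open>h\<close> at the vertex on level \<open>i\<close> determined by \<open>f\<close>.\<close>

definition loc :: "fs sym \<Rightarrow> int sym \<Rightarrow> int \<Rightarrow> fs \<Rightarrow> nat sym" where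
  "loc h d i f = Sym (\<lambda>x. lookup (h \<cdot> upd i x f) (d \<cdot> i))"

text \<open>The value of \<open>Sym\<close> is meaningful only for bijections; the inverse of a
  local action is the local action of the inverse automorphism at the image vertex.\<close>

lemma loc_app: assumes h: "tri d h" shows "loc h d i f \<cdot> x = lookup (h \<cdot> upd i x f) (d \<cdot> i)"
proof -
  have inv: "lookup (ginv h \<cdot> upd (d \<cdot> i) (lookup (h \<cdot> upd i x f) (d \<cdot> i)) (h \<cdot> f)) i = x"
    if h: "tri d h" for h d i f x
  proof -
    have "trunc (d \<cdot> i) (h \<cdot> upd i x f) = trunc (d \<cdot> i) (h \<cdot> f)" by (simp add: tri_trunc[OF h])
    then have "eqa (d \<cdot> i) (upd (d \<cdot> i) (lookup (h \<cdot> upd i x f) (d \<cdot> i)) (h \<cdot> f)) (h \<cdot> upd i x f)"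
      by (simp add: eqa_iff)
    then have "eqa i (ginv h \<cdot> upd (d \<cdot> i) (lookup (h \<cdot> upd i x f) (d \<cdot> i)) (h \<cdot> f)) (upd i x f)"
      using tri_eqa[OF h, of i "ginv h \<cdot> _"] by simp
    then show ?thesis by (simp add: eqa_iff)
  qed
  show ?thesis unfolding loc_def
  proof (rule Sym_app[of "\<lambda>y. lookup (ginv h \<cdot> upd (d \<cdot> i) y (h \<cdot> f)) i"])
    show "lookup (ginv h \<cdot> upd (d \<cdot> i) (lookup (h \<cdot> upd i x f) (d \<cdot> i)) (h \<cdot> f)) i = x" for x
      by (rule inv[OF h])
    show "lookup (h \<cdot> upd i (lookup (ginv h \<cdot> upd (d \<cdot> i) x (h \<cdot> f)) i) f) (d \<cdot> i) = x" for x
      using inv[OF tri_ginv[OF h], of "d \<cdot> i" x "h \<cdot> f"] by simp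
  qed
qed

lemma lookup_tri: "tri d h \<Longrightarrow> lookup (h \<cdot> f) (d \<cdot> i) = loc h d i f \<cdot> lookup f i"
  by (simp add: loc_app)

lemma loc_trunc:
  assumes h: "tri d h" and "trunc i f = trunc i g" shows "loc h d i f = loc h d i g"
proof (rule sym_eqI)
  fix x
  have "eqa i (upd i x f) (upd i x g)" using assms(2) by (simp add: eqa_iff)
  then have "eqa (d \<cdot> i) (h \<cdot> upd i x f) (h \<cdot> upd i x g)" by (simp add: tri_eqa[OF h])
  then show "loc h d i f \<cdot> x = loc h d i g \<cdot> x" by (simp add: loc_app[OF h] eqa_iff)
qed

lemma loc_one [simp]: "loc 1 1 i f = 1"
  by (rule sym_eqI) (simp add: loc_app[OF tri_one])

text \<open>The chain rule for local actions. Every later computation with W goes through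
  it.\<close>

lemma loc_mult:
  assumes h: "tri d h" and k: "tri e k"
  shows "loc (h * k) (d * e) i f = loc h d (e \<cdot> i) (k \<cdot> f) * loc k e i f"
proof (rule sym_eqI)
  fix x
  have "trunc (e \<cdot> i) (k \<cdot> upd i x f) = trunc (e \<cdot> i) (k \<cdot> f)" by (simp add: tri_trunc[OF k])
  then have "eqa (e \<cdot> i) (k \<cdot> upd i x f) (upd (e \<cdot> i) (lookup (k \<cdot> upd i x f) (e \<cdot> i)) (k \<cdot> f))"
    by (simp add: eqa_iff)
  then have "eqa (d \<cdot> e \<cdot> i) (h \<cdot> k \<cdot> upd i x f) (h \<cdot> upd (e \<cdot> i) (lookup (k \<cdot> upd i x f) (e \<cdot> i)) (k \<cdot> f))"
    by (simp add: tri_eqa[OF h])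
  then show "loc (h * k) (d * e) i f \<cdot> x = (loc h d (e \<cdot> i) (k \<cdot> f) * loc k e i f) \<cdot> x"
    by (simp add: loc_app[OF h] loc_app[OF k] loc_app[OF tri_mult[OF h k]] eqa_iff)
qed

lemma loc_ginv:
  assumes h: "tri d h" shows "loc (ginv h) (ginv d) (d \<cdot> i) (h \<cdot> f) = ginv (loc h d i f)"
proof -
  have "loc (ginv h) (ginv d) (d \<cdot> i) (h \<cdot> f) * loc h d i f = 1"
    using loc_mult[OF tri_ginv[OF h] h, of i f] by simp
  then show ?thesis by (metis ginv_ginv ginv_unique)
qed

lemma loc_ginv': 
  assumes h: "tri d h" shows "loc (ginv h) (ginv d) i f = ginv (loc h d (ginv d \<cdot> i) (ginv h \<cdot> f))"
  using loc_ginv[OF h, of "ginv d \<cdot> i" "ginv h \<cdot> f"] by simp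

definition vertices :: "(int \<times> fs) set" where
  "vertices = {(i, v). trunc i v = v}"

definition vmap :: "fs sym \<Rightarrow> int sym \<Rightarrow> int \<times> fs \<Rightarrow> int \<times> fs" where
  "vmap h d = (\<lambda>(i, v). (d \<cdot> i, trunc (d \<cdot> i) (h \<cdot> v)))"

lemma finite_vmap_vimage:
  assumes "tri d h" "finite B" shows "finite {p \<in> vertices. vmap h d p \<in> B}"
proof (rule inj_on_finite[OF _ _ assms(2)])
  show "inj_on (vmap h d) {p \<in> vertices. vmap h d p \<in> B}"
  proof (rule inj_onI, clarsimp simp: vertices_def vmap_def)
    fix i v w assume "trunc i v = v" "trunc i w = w" "trunc (d \<cdot> i) (h \<cdot> v) = trunc (d \<cdot> i) (h \<cdot> w)"
    then show "v = w" using tri_trunc[OF assms(1), of i v w] by simp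
  qed
qed auto

text \<open>The vertices where the local action leaves the compact point stabiliser; W will require
  this set to be finite.\<close>

definition bad :: "fs sym \<Rightarrow> int sym \<Rightarrow> (int \<times> fs) set" where
  "bad h d = {(i, v) \<in> vertices. loc h d i v \<cdot> 0 \<noteq> 0}"

lemma trunc_mem_bad_iff: "tri d h \<Longrightarrow> (i, trunc i f) \<in> bad h d \<longleftrightarrow> loc h d i f \<cdot> 0 \<noteq> 0"
  using loc_trunc[of d h i "trunc i f" f] by (simp add: bad_def vertices_def)

lemma bad_empty_iff: "tri d h \<Longrightarrow> bad h d = {} \<longleftrightarrow> (\<forall>i f. loc h d i f \<cdot> 0 = 0)"
proof -
  assume h: "tri d h"
  show ?thesis
  proof
    assume "bad h d = {}"
    then show "\<forall>i f. loc h d i f \<cdot> 0 = 0" using trunc_mem_bad_iff[OF h] by blast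
  qed (auto simp: bad_def)
qed

text \<open>By the chain rule a vertex that is good for k and whose image is good for h is good for
  the product.\<close>

lemma bad_mult:
  assumes h: "tri d h" and k: "tri e k"
  shows "bad (h * k) (d * e) \<subseteq> bad k e \<union> {p \<in> vertices. vmap k e p \<in> bad h d}"
proof
  fix p assume p: "p \<in> bad (h * k) (d * e)"
  obtain i v where iv: "p = (i, v)" by (cases p)
  have v: "trunc i v = v" "loc h d (e \<cdot> i) (k \<cdot> v) \<cdot> loc k e i v \<cdot> 0 \<noteq> 0"
    using p by (auto simp: bad_def vertices_def iv loc_mult[OF h k])
  show "p \<in> bad k e \<union> {p \<in> vertices. vmap k e p \<in> bad h d}"
  proof (cases "loc k e i v \<cdot> 0 = 0")
    case True
    then have "(e \<cdot> i, trunc (e \<cdot> i) (k \<cdot> v)) \<in> bad h d" using v(2) by (simp add: trunc_mem_bad_iff[OF h])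
    then show ?thesis using v(1) by (simp add: iv vertices_def vmap_def)
  qed (use v(1) in \<open>simp add: bad_def vertices_def iv\<close>)
qed

lemma bad_ginv:
  assumes h: "tri d h"
  shows "bad (ginv h) (ginv d) \<subseteq> {p \<in> vertices. vmap (ginv h) (ginv d) p \<in> bad h d}"
proof
  fix p assume p: "p \<in> bad (ginv h) (ginv d)"
  obtain i v where iv: "p = (i, v)" by (cases p)
  have v: "trunc i v = v" "ginv (loc h d (ginv d \<cdot> i) (ginv h \<cdot> v)) \<cdot> 0 \<noteq> 0"
    using p by (auto simp: bad_def vertices_def iv loc_ginv'[OF h])
  have "loc h d (ginv d \<cdot> i) (ginv h \<cdot> v) \<cdot> 0 \<noteq> 0" using v(2) by (metis ginv_app)
  then show "p \<in> {p \<in> vertices. vmap (ginv h) (ginv d) p \<in> bad h d}"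
    using v(1) by (simp add: iv vertices_def vmap_def trunc_mem_bad_iff[OF h])
qed

definition shift :: "int sym \<Rightarrow> fs sym" where
  "shift d = Sym (shiftf d)"

lemma shift_app: "shift d \<cdot> f = shiftf d f"
  unfolding shift_def by (rule Sym_app[of "shiftf (ginv d)"]) (simp_all add: poly_mapping_eq_iff fun_eq_iff)

lemma shift_mult: "shift (d * e) = shift d * shift e"
  by (rule sym_eqI) (simp add: shift_app poly_mapping_eq_iff fun_eq_iff ginv_mult)

lemma shift_one: "shift 1 = 1"
  by (rule sym_eqI) (simp add: shift_app poly_mapping_eq_iff fun_eq_iff)

lemma shift_ginv: "shift (ginv d) = ginv (shift d)"
proof -
  have "shift d * shift (ginv d) = 1" by (simp add: shift_one flip: shift_mult)
  then show ?thesis using ginv_unique by metis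
qed

lemma tri_shift: assumes "d \<in> D" shows "tri d (shift d)"
proof -
  have "eqa (d \<cdot> i) (shift d \<cdot> f) (shift d \<cdot> g)" if "d \<in> D" "eqa i f g" for d i f g
    unfolding eqa_def
  proof (intro allI impI)
    fix j assume "le3 (d \<cdot> i) j"
    then have "le3 i (ginv d \<cdot> j)" using le3_D[OF that(1), of i "ginv d \<cdot> j"] by simp
    then show "lookup (shift d \<cdot> f) j = lookup (shift d \<cdot> g) j"
      using that(2) by (simp add: shift_app eqa_def)
  qed
  then show ?thesis using assms sgp_ginv[OF sgp_D assms] by (intro triI) (auto simp flip: shift_ginv)
qed

lemma loc_shift: "d \<in> D \<Longrightarrow> loc (shift d) d i f = 1"
  by (rule sym_eqI) (simp add: loc_app[OF tri_shift] shift_app)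

text \<open>A copy of g acting at a single vertex: only the coordinate at level i changes, and only
  for functions passing through v.\<close>

definition root :: "int \<Rightarrow> fs \<Rightarrow> nat sym \<Rightarrow> fs sym" where
  "root i v g = Sym (\<lambda>f. if trunc i f = v then upd i (g \<cdot> lookup f i) f else f)"

lemma root_app: "root i v g \<cdot> f = (if trunc i f = v then upd i (g \<cdot> lookup f i) f else f)"
  unfolding root_def
  by (rule Sym_app[of "\<lambda>f. if trunc i f = v then upd i (ginv g \<cdot> lookup f i) f else f"]) auto

lemma root_mult: "root i v (g * h) = root i v g * root i v h"
  by (rule sym_eqI) (simp add: root_app)

lemma root_one: "root i v 1 = 1"
  by (rule sym_eqI) (simp add: root_app)

lemma root_ginv: "root i v (ginv g) = ginv (root i v g)"
proof -
  have "root i v g * root i v (ginv g) = 1" by (simp add: root_one flip: root_mult)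
  then show ?thesis using ginv_unique by metis
qed

lemma tri_root: "tri 1 (root i v g)"
proof -
  have "eqa j (root i v g \<cdot> f) (root i v g \<cdot> f')" if "eqa j f f'" for g j f f'
  proof (cases "le3 j i")
    case True
    then have "trunc i f = trunc i f'" "lookup f i = lookup f' i"
      using that le3_trans unfolding eqa_def trunc_eq_iff lt3_def by blast+
    then show ?thesis using that by (auto simp: root_app eqa_def)
  next
    case False
    then show ?thesis using that by (auto simp: root_app eqa_def)
  qed
  then show ?thesis by (intro triI) (auto simp: sgp_one[OF sgp_D] simp flip: root_ginv)
qed

lemma loc_root: "loc (root i v g) 1 j f = (if j = i \<and> trunc i f = v then g else 1)"
  by (rule sym_eqI) (simp add: loc_app[OF tri_root] root_app)

lemma bad_root: "bad (root i v g) 1 \<subseteq> {(i, v)}"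
  by (auto simp: bad_def vertices_def loc_root split: if_splits)

lemma shift_root:
  assumes "d \<in> D"
  shows "shift d * root i v g * ginv (shift d) = root (d \<cdot> i) (shiftf d v) g"
proof (rule sym_eqI)
  fix f
  have t: "trunc i (shiftf (ginv d) f) = v \<longleftrightarrow> trunc (d \<cdot> i) f = shiftf d v"
  proof -
    have "trunc (d \<cdot> i) f = shiftf d (trunc i (shiftf (ginv d) f))"
      using lt3_D[OF assms, of i "ginv d \<cdot> _"] by (simp add: poly_mapping_eq_iff fun_eq_iff)
    moreover have "shiftf d u = shiftf d v \<longleftrightarrow> u = v" for u
      using app_eq_iff[of "shift d" u v] by (simp add: shift_app)
    ultimately show ?thesis by metis
  qed
  show "(shift d * root i v g * ginv (shift d)) \<cdot> f = root (d \<cdot> i) (shiftf d v) g \<cdot> f"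
  proof (cases "trunc i (shiftf (ginv d) f) = v")
    case True
    have "shiftf d (upd i x (shiftf (ginv d) f)) = upd (d \<cdot> i) x f" for x
      by (auto simp: poly_mapping_eq_iff fun_eq_iff)
    then show ?thesis using True t by (simp add: root_app shift_app flip: shift_ginv)
  next
    case False
    then have "trunc (d \<cdot> i) f \<noteq> shiftf d v" using t by blast
    moreover have "shiftf d (shiftf (ginv d) f) = f" by (simp add: poly_mapping_eq_iff fun_eq_iff)
    ultimately show ?thesis using False by (simp add: root_app shift_app flip: shift_ginv)
  qed
qed

text \<open>If level j is not below i and differs from it, the conjugating element has trivial local
  actions on level i. Conjugation then moves the vertex and leaves g unchanged.\<close>

lemma root_root:
  assumes ij: "i \<noteq> j" "\<not> lt3 j i" and v: "trunc i v = v"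
  shows "root j w c * root i v g * ginv (root j w c) = root i (trunc i (root j w c \<cdot> v)) g"
proof (rule sym_eqI)
  fix f
  let ?r = "root j w c" and ?s = "root j w (ginv c)"
  have t: "trunc i (?s \<cdot> f) = v \<longleftrightarrow> trunc i f = trunc i (?r \<cdot> v)"
    using tri_trunc[OF tri_root, of i j w c "?s \<cdot> f" v] v by (simp add: root_ginv)
  show "(?r * root i v g * ginv ?r) \<cdot> f = root i (trunc i (?r \<cdot> v)) g \<cdot> f"
  proof (cases "trunc i (?s \<cdot> f) = v")
    case True
    have tj: "trunc j (upd i x e) = trunc j e" for x e using ij(2) by simp
    have l: "lookup (?s \<cdot> f) i = lookup f i" using ij(1) by (simp add: root_app)
    have "?r \<cdot> upd i x e = upd i x (?r \<cdot> e)" for x e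
    proof (cases "trunc j e = w")
      case True
      then show ?thesis using ij(1) by (simp add: root_app tj, intro poly_mapping_eqI) simp
    qed (simp add: root_app tj)
    then have "?r \<cdot> upd i x (?s \<cdot> f) = upd i x f" for x by (simp add: root_ginv)
    then show ?thesis using True t l by (simp add: root_app[of i] flip: root_ginv)
  next
    case False
    then have "trunc i f \<noteq> trunc i (?r \<cdot> v)" using t by blast
    then show ?thesis using False by (simp add: root_app[of i] root_ginv)
  qed
qed

section \<open>The wreath product construction\<close>

context stage
begin

definition wrel :: "int sym \<Rightarrow> fs sym \<Rightarrow> bool" where
  "wrel d h \<longleftrightarrow> tri d h \<and> (\<forall>i f. loc h d i f \<in> G) \<and> finite (bad h d)"

definition W :: "fs sym set" where
  "W = {h. \<exists>d. wrel d h}"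

text \<open>Admitting \<open>refl 0\<close> is essential: otherwise the normal closure of K would
  preserve all levels, and normal generation would fail for W.\<close>

definition K :: "fs sym set" where
  "K = {h. \<exists>d\<in>{1, refl 0}. wrel d h \<and> bad h d = {}}"

text \<open>Pointwise convergence is imposed on K, and K is declared open. W itself is not closed
  under pointwise limits, because infinitely many bad vertices may arise in the limit.\<close>

definition NW :: "fs sym set set" where
  "NW = (\<lambda>F. K \<inter> fix_pts F) ` {F. finite F}"

lemma wrel_tri: "wrel d h \<Longrightarrow> tri d h"
  by (simp add: wrel_def)

lemma wrel_loc: "wrel d h \<Longrightarrow> loc h d i f \<in> G"
  by (simp add: wrel_def)

lemma wrel_one: "wrel 1 1"
  using sgp_one[OF sgp_G] by (simp add: wrel_def tri_one bad_def)

lemma wrel_mult: assumes h: "wrel d h" and k: "wrel e k" shows "wrel (d * e) (h * k)"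
proof -
  note t = wrel_tri[OF h] wrel_tri[OF k]
  have "finite (bad k e \<union> {p \<in> vertices. vmap k e p \<in> bad h d})"
    using h k finite_vmap_vimage[OF t(2)] by (simp add: wrel_def)
  then have "finite (bad (h * k) (d * e))" using bad_mult[OF t] by (rule rev_finite_subset)
  moreover have "loc (h * k) (d * e) i f \<in> G" for i f
    unfolding loc_mult[OF t] by (intro sgp_mult[OF sgp_G] wrel_loc h k)
  ultimately show ?thesis using tri_mult[OF t] by (simp add: wrel_def)
qed

lemma wrel_ginv: assumes h: "wrel d h" shows "wrel (ginv d) (ginv h)"
proof -
  note t = wrel_tri[OF h]
  have "finite {p \<in> vertices. vmap (ginv h) (ginv d) p \<in> bad h d}"
    using h finite_vmap_vimage[OF tri_ginv[OF t]] by (simp add: wrel_def)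
  then have "finite (bad (ginv h) (ginv d))" using bad_ginv[OF t] by (rule rev_finite_subset)
  moreover have "loc (ginv h) (ginv d) i f \<in> G" for i f
    unfolding loc_ginv'[OF t] by (intro sgp_ginv[OF sgp_G] wrel_loc h)
  ultimately show ?thesis using tri_ginv[OF t] by (simp add: wrel_def)
qed

lemma wrel_root: "g \<in> G \<Longrightarrow> wrel 1 (root i v g)"
  using finite_subset[OF bad_root[of i v g]] sgp_one[OF sgp_G]
  by (simp add: wrel_def tri_root loc_root)

lemma wrel_shift: "d \<in> D \<Longrightarrow> wrel d (shift d)"
  using sgp_one[OF sgp_G] by (simp add: wrel_def tri_shift loc_shift bad_def)

lemma wrel_W: "wrel d h \<Longrightarrow> h \<in> W"
  by (auto simp: W_def)

lemma sgp_W: "sgp W"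
  by (rule sgpI) (auto simp: W_def intro: wrel_one wrel_mult wrel_ginv)

lemma K_iff: "h \<in> K \<longleftrightarrow> (\<exists>d\<in>{1, refl 0}. tri d h \<and> (\<forall>i f. loc h d i f \<in> G \<and> loc h d i f \<cdot> 0 = 0))"
  unfolding K_def wrel_def using bad_empty_iff by fastforce

lemma sgp_K: "sgp K"
proof -
  have P: "d * e \<in> {1, refl 0}" "ginv d \<in> {1, refl 0}" if "d \<in> {1, refl 0}" "e \<in> {1, refl 0}" for d e
    using that by (auto simp: ginv_refl)
  show ?thesis
  proof (rule sgpI)
    show "1 \<in> K" using wrel_one by (auto simp: K_def bad_def)
    fix h assume "h \<in> K"
    then obtain d where d: "d \<in> {1, refl 0}" "wrel d h" "bad h d = {}" by (auto simp: K_def)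
    have "bad (ginv h) (ginv d) = {}" using bad_ginv[OF wrel_tri[OF d(2)]] d(3) by auto
    then show "ginv h \<in> K" using wrel_ginv[OF d(2)] P[OF d(1) d(1)] unfolding K_def by blast
    fix k assume "k \<in> K"
    then obtain e where e: "e \<in> {1, refl 0}" "wrel e k" "bad k e = {}" by (auto simp: K_def)
    have "bad (h * k) (d * e) = {}" using bad_mult[OF wrel_tri[OF d(2)] wrel_tri[OF e(2)]] d(3) e(3) by auto
    then show "h * k \<in> K" using wrel_mult[OF d(2) e(2)] P(1)[OF d(1) e(1)] unfolding K_def by blast
  qed
qed

lemma K_subset_W: "K \<subseteq> W"
  by (auto simp: K_def W_def)

lemma root_K: "g \<in> G \<Longrightarrow> g \<cdot> 0 = 0 \<Longrightarrow> root i v g \<in> K"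
  using sgp_one[OF sgp_G] by (auto simp: K_iff tri_root loc_root intro!: bexI[of _ 1])

lemma root_W: "g \<in> G \<Longrightarrow> root i v g \<in> W"
  by (rule wrel_W[OF wrel_root])

lemma K_zero: assumes "h \<in> K" shows "h \<cdot> 0 = 0"
proof -
  obtain d where d: "tri d h" "\<And>i f. loc h d i f \<cdot> 0 = 0" using assms by (auto simp: K_iff)
  have "lookup (h \<cdot> 0) j = 0" for j
    using lookup_tri[OF d(1), of 0 "ginv d \<cdot> j"] d(2) by simp
  then show ?thesis by (simp add: poly_mapping_eq_iff fun_eq_iff)
qed

section \<open>Compactness of K\<close>

lemma finite_fs_bounded:
  assumes "finite L" "finite V" shows "finite {e :: fs. keys e \<subseteq> L \<and> (\<forall>i\<in>L. lookup e i \<in> V)}"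
proof (rule inj_on_finite[of "\<lambda>e. restrict (lookup e) L"])
  show "inj_on (\<lambda>e. restrict (lookup e) L) {e :: fs. keys e \<subseteq> L \<and> (\<forall>i\<in>L. lookup e i \<in> V)}"
  proof (rule inj_onI, rule poly_mapping_eqI)
    fix e e' :: fs and i assume *: "e \<in> {e. keys e \<subseteq> L \<and> (\<forall>i\<in>L. lookup e i \<in> V)}"
      "e' \<in> {e. keys e \<subseteq> L \<and> (\<forall>i\<in>L. lookup e i \<in> V)}" "restrict (lookup e) L = restrict (lookup e') L"
    show "lookup e i = lookup e' i"
    proof (cases "i \<in> L")
      case True
      then show ?thesis using fun_cong[OF *(3), of i] by simp
    next
      case False
      then have "i \<notin> keys e" "i \<notin> keys e'" using * by auto
      then show ?thesis by (simp add: in_keys_iff)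
    qed
  qed
  show "(\<lambda>e. restrict (lookup e) L) ` {e. keys e \<subseteq> L \<and> (\<forall>i\<in>L. lookup e i \<in> V)} \<subseteq> PiE L (\<lambda>_. V)"
    by auto
  show "finite (PiE L (\<lambda>_. V))" using assms by (simp add: finite_PiE)
qed

text \<open>Local actions of K fix 0, so supports change at most by \<open>refl 0\<close>, and
  non-zero values stay in finite orbits of the point stabiliser.\<close>

lemma finite_orbit_K: "finite {h \<cdot> f |h. h \<in> K}"
proof -
  let ?L = "keys f \<union> (\<lambda>i. refl 0 \<cdot> i) ` keys f"
  let ?V = "insert 0 (\<Union>x\<in>lookup f ` keys f. {u \<cdot> x |u. u \<in> G \<and> u \<cdot> 0 = 0})"
  have "{h \<cdot> f |h. h \<in> K} \<subseteq> {e. keys e \<subseteq> ?L \<and> (\<forall>i\<in>?L. lookup e i \<in> ?V)}"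
  proof
    fix e assume "e \<in> {h \<cdot> f |h. h \<in> K}"
    then obtain h where h: "h \<in> K" "e = h \<cdot> f" by blast
    then obtain d where d: "d \<in> {1, refl 0}" "tri d h" "\<And>i f. loc h d i f \<in> G" "\<And>i f. loc h d i f \<cdot> 0 = 0"
      by (auto simp: K_iff)
    have e: "lookup e j = loc h d (ginv d \<cdot> j) f \<cdot> lookup f (ginv d \<cdot> j)" for j
      using lookup_tri[OF d(2), of f "ginv d \<cdot> j"] by (simp add: h(2))
    have "j \<in> ?L" if "j \<in> keys e" for j
    proof -
      have "ginv d \<cdot> j \<in> keys f" using that d(4)[of "ginv d \<cdot> j" f] by (metis e in_keys_iff)
      then have "d \<cdot> ginv d \<cdot> j \<in> ?L" using d(1) by (metis UnI1 UnI2 imageI insertE one_app singletonD)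
      then show ?thesis by simp
    qed
    moreover have "lookup e j \<in> ?V" for j
    proof (cases "ginv d \<cdot> j \<in> keys f")
      case True
      then show ?thesis unfolding e using d(3,4) by blast
    next
      case False
      then show ?thesis unfolding e using d(4) by (simp add: in_keys_iff)
    qed
    ultimately have "keys e \<subseteq> ?L \<and> (\<forall>i\<in>?L. lookup e i \<in> ?V)" by (intro conjI subsetI ballI)
    then show "e \<in> {e. keys e \<subseteq> ?L \<and> (\<forall>i\<in>?L. lookup e i \<in> ?V)}" by (rule CollectI)
  qed
  moreover have "finite {e :: fs. keys e \<subseteq> ?L \<and> (\<forall>i\<in>?L. lookup e i \<in> ?V)}"
    using finite_orbits by (intro finite_fs_bounded) auto
  ultimately show ?thesis by (rule finite_subset)
qed

lemma K_limit:
  assumes h: "\<And>F. finite F \<Longrightarrow> \<exists>u\<in>K. \<forall>f\<in>F. u \<cdot> f = h \<cdot> f" shows "h \<in> K"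
proof -
  let ?f = "upd 0 1 0 :: fs"
  \<comment> \<open>The function \<open>upd 0 1 0\<close> detects the level permutation. Local
    actions of K fix 0 and hence keep the value 1 non-zero, so its image is supported at level 0 if
    the levels are fixed and at level 1 after \<open>refl 0\<close>. The pointwise limit therefore
    inherits one fixed permutation.\<close>
  define \<delta> where "\<delta> = (if lookup (h \<cdot> ?f) 0 \<noteq> 0 then 1 else refl 0)"
  have r0: "refl 0 \<cdot> 0 = 1" by (simp add: refl_app)
  have ap: "\<exists>u\<in>K. (\<forall>f\<in>F. u \<cdot> f = h \<cdot> f) \<and> tri \<delta> u \<and> (\<forall>i f. loc u \<delta> i f \<in> G \<and> loc u \<delta> i f \<cdot> 0 = 0)"
    if F: "finite F" for F
  proof -
    obtain u where u: "u \<in> K" "\<forall>f\<in>insert ?f F. u \<cdot> f = h \<cdot> f" using h[of "insert ?f F"] F by blast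
    obtain d where d: "d \<in> {1, refl 0}" "tri d u" "\<And>i f. loc u d i f \<in> G" "\<And>i f. loc u d i f \<cdot> 0 = 0"
      using u(1) by (auto simp: K_iff)
    have l: "lookup (u \<cdot> ?f) (d \<cdot> i) = loc u d i ?f \<cdot> lookup ?f i" for i by (rule lookup_tri[OF d(2)])
    have nz: "loc u d 0 ?f \<cdot> 1 \<noteq> 0" using d(4)[of 0 ?f] by (metis app_eq_iff zero_neq_one)
    have "d = \<delta>"
    proof (cases "d = 1")
      case True
      then show ?thesis using l[of 0] nz u(2) by (simp add: \<delta>_def)
    next
      case False
      then have dr: "d = refl 0" using d(1) by simp
      have "refl 0 \<cdot> 1 = (0::int)" by (simp add: refl_app)
      then have "lookup (u \<cdot> ?f) 0 = 0" using l[of 1] d(4) dr by simp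
      then show ?thesis using dr u(2) by (simp add: \<delta>_def)
    qed
    then show ?thesis using u d by (intro bexI[of _ u]) auto
  qed
  have tri: "tri \<delta> h"
    unfolding tri_def
  proof (intro conjI allI)
    show "\<delta> \<in> D" using sgp_one[OF sgp_D] refl_in_D by (simp add: \<delta>_def)
    fix i f g
    obtain u where u: "\<forall>f\<in>{f, g}. u \<cdot> f = h \<cdot> f" "tri \<delta> u" using ap[of "{f, g}"] by auto
    have "eqa (\<delta> \<cdot> i) (u \<cdot> f) (u \<cdot> g) \<longleftrightarrow> eqa i f g" by (rule tri_eqa[OF u(2)])
    then show "eqa (\<delta> \<cdot> i) (h \<cdot> f) (h \<cdot> g) \<longleftrightarrow> eqa i f g" using u(1) by simp
  qed
  have "loc h \<delta> i f \<in> G \<and> loc h \<delta> i f \<cdot> 0 = 0" for i f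
  proof
    have ex: "\<exists>u\<in>K. loc u \<delta> i f \<in> G \<and> loc u \<delta> i f \<cdot> 0 = 0 \<and> (\<forall>x\<in>F. loc u \<delta> i f \<cdot> x = loc h \<delta> i f \<cdot> x)"
      if F: "finite F" for F
    proof -
      obtain u where u: "u \<in> K" "\<forall>f\<in>(\<lambda>x. upd i x f) ` F. u \<cdot> f = h \<cdot> f" "tri \<delta> u"
        "\<forall>i f. loc u \<delta> i f \<in> G \<and> loc u \<delta> i f \<cdot> 0 = 0"
        using ap[OF finite_imageI[OF F, of "\<lambda>x. upd i x f"]] by blast
      then show ?thesis by (intro bexI[of _ u]) (simp_all add: loc_app[OF u(3)] loc_app[OF tri])
    qed
    show "loc h \<delta> i f \<in> G" by (rule closed) (use ex in blast)
    show "loc h \<delta> i f \<cdot> 0 = 0" using ex[of "{0}"] by auto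
  qed
  then show ?thesis using tri unfolding K_iff by (intro bexI[of _ \<delta>]) (auto simp: \<delta>_def)
qed

lemma K_complete:
  fixes u :: "nat \<Rightarrow> fs sym"
  assumes u: "\<And>i. u i \<in> K" and cauchy: "\<And>F. finite F \<Longrightarrow> \<exists>M. \<forall>m\<ge>M. ginv (u M) * u m \<in> fix_pts F"
  shows "\<exists>h\<in>K. \<forall>F. finite F \<longrightarrow> (\<exists>M. \<forall>m\<ge>M. \<forall>f\<in>F. u m \<cdot> f = h \<cdot> f)"
proof -
  have "\<exists>M. \<forall>m\<ge>M. u m \<cdot> f = u M \<cdot> f" for f
  proof -
    obtain M where M: "\<forall>m\<ge>M. ginv (u M) * u m \<in> fix_pts {f}" using cauchy[of "{f}"] by blast
    have "u m \<cdot> f = u M \<cdot> f" if "m \<ge> M" for m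
    proof -
      have "ginv (u M) \<cdot> u m \<cdot> f = f" using M that by (simp add: fix_pts_def)
      then show ?thesis by (metis app_ginv)
    qed
    then show ?thesis by blast
  qed
  then obtain M where M: "\<And>f m. m \<ge> M f \<Longrightarrow> u m \<cdot> f = u (M f) \<cdot> f" by metis
  define a where "a f = u (M f) \<cdot> f" for f
  have lim: "\<exists>k. \<forall>m\<ge>k. \<forall>f\<in>F. u m \<cdot> f = a f" if "finite F" for F
  proof (intro exI allI impI ballI)
    fix m f assume "Max (insert 0 (M ` F)) \<le> m" "f \<in> F"
    then have "M f \<le> m" using that by (auto intro: order_trans[OF Max_ge])
    then show "u m \<cdot> f = a f" unfolding a_def by (rule M)
  qed
  have "bij a"
  proof (rule bijI)
    show "inj a"
    proof (rule injI)
      fix f g assume "a f = a g"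
      moreover obtain k where "\<forall>m\<ge>k. \<forall>f\<in>{f, g}. u m \<cdot> f = a f" using lim[of "{f, g}"] by auto
      then have "u k \<cdot> f = a f" "u k \<cdot> g = a g" by simp_all
      ultimately have "u k \<cdot> f = u k \<cdot> g" by simp
      then show "f = g" by simp
    qed
    \<comment> \<open>A pointwise limit of permutations need not be surjective in general. Here the
      preimages of f under all \<open>u k\<close> lie in one finite orbit of K, on which the
      sequence is eventually constant.\<close>
    show "surj a"
      unfolding surj_def
    proof
      fix f
      obtain k where k: "\<forall>m\<ge>k. \<forall>g\<in>{h \<cdot> f |h. h \<in> K}. u m \<cdot> g = a g" using lim[OF finite_orbit_K] by blast
      have "ginv (u k) \<cdot> f \<in> {h \<cdot> f |h. h \<in> K}" using sgp_ginv[OF sgp_K u] by blast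
      then have "u k \<cdot> ginv (u k) \<cdot> f = a (ginv (u k) \<cdot> f)" using k by blast
      then show "\<exists>g. f = a g" by auto
    qed
  qed
  then have app: "Sym a \<cdot> f = a f" for f by (simp add: Sym_inverse)
  have "Sym a \<in> K"
  proof (rule K_limit)
    fix F :: "fs set" assume "finite F"
    then obtain k where "\<forall>m\<ge>k. \<forall>f\<in>F. u m \<cdot> f = a f" using lim by blast
    then show "\<exists>u\<in>K. \<forall>f\<in>F. u \<cdot> f = Sym a \<cdot> f" using u[of k] app by (intro bexI[of _ "u k"]) auto
  qed
  then show ?thesis using lim app by (intro bexI[of _ "Sym a"]) auto
qed

section \<open>Cosets of K in W\<close>

lemma transversal: "\<exists>tr. \<forall>x. tr x \<in> G \<and> tr x \<cdot> 0 = x"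
  using transitive by metis

definition tr :: "nat \<Rightarrow> nat sym" where
  "tr = (SOME tr. \<forall>x. tr x \<in> G \<and> tr x \<cdot> 0 = x)"

lemma tr: "tr x \<in> G" "tr x \<cdot> 0 = x"
  using someI_ex[OF transversal] unfolding tr_def by blast+

definition tr_roots :: "fs sym set" where
  "tr_roots = (\<lambda>((i, v), x). root i v (tr x)) ` UNIV"

lemma tr_roots: "root i v (tr x) \<in> tr_roots"
  unfolding tr_roots_def by (rule image_eqI[of _ _ "((i, v), x)"]) auto

text \<open>Bad vertices are removed one at a time, by induction on their number.\<close>

lemma base_decomposition:
  assumes "wrel 1 b" shows "\<exists>t\<in>gen tr_roots. wrel 1 (ginv t * b) \<and> bad (ginv t * b) 1 = {}"
  using assms
proof (induction "card (bad b 1)" arbitrary: b rule: less_induct)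
  case less
  note tb = wrel_tri[OF less.prems]
  show ?case
  proof (cases "bad b 1 = {}")
    case True
    then show ?thesis using less.prems sgp_one[OF sgp_gen] by (intro bexI[of _ 1]) auto
  next
    case False
    then obtain i v where iv: "(i, v) \<in> bad b 1" by auto
    have v: "trunc i v = v" using iv by (simp add: bad_def vertices_def)
    let ?x = "loc b 1 i v \<cdot> 0"
    \<comment> \<open>This root sits at the image vertex and sends 0 to the same place as the local
      action of b there. Dividing by it repairs the vertex v and leaves the local actions of b at
      all other vertices unchanged.\<close>
    let ?r = "root i (trunc i (b \<cdot> v)) (tr ?x)"
    have r: "?r \<in> gen tr_roots" using tr_roots gen_superset by blast
    have wr: "wrel 1 (ginv ?r)" using wrel_ginv[OF wrel_root[OF tr(1)]] by simp
    have w: "wrel 1 (ginv ?r * b)" using wrel_mult[OF wr less.prems] by simp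
    have l: "loc (ginv ?r * b) 1 j f = loc (ginv ?r) 1 j (b \<cdot> f) * loc b 1 j f" for j f
      using loc_mult[OF wrel_tri[OF wr] tb, of j f] by simp
    have "bad (ginv ?r * b) 1 \<subseteq> bad b 1 - {(i, v)}"
    proof
      fix p assume p: "p \<in> bad (ginv ?r * b) 1"
      obtain j f where jf: "p = (j, f)" by (cases p)
      have f: "trunc j f = f" "loc (ginv ?r) 1 j (b \<cdot> f) \<cdot> loc b 1 j f \<cdot> 0 \<noteq> 0"
        using p by (simp_all add: jf bad_def vertices_def l)
      have ne: "\<not> (j = i \<and> trunc i (b \<cdot> f) = trunc i (b \<cdot> v))"
      proof
        assume ji: "j = i \<and> trunc i (b \<cdot> f) = trunc i (b \<cdot> v)"
        then have "f = v" using tri_trunc[OF tb, of i f v] f(1) v by simp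
        then have "loc (ginv ?r) 1 j (b \<cdot> f) = ginv (tr ?x)" using ji by (simp add: loc_root flip: root_ginv)
        then have "ginv (tr ?x) \<cdot> ?x \<noteq> 0" using f(2) ji \<open>f = v\<close> by simp
        moreover have "ginv (tr ?x) \<cdot> tr ?x \<cdot> 0 = 0" by (rule ginv_app)
        ultimately show False using tr(2)[of ?x] by simp
      qed
      then have "loc (ginv ?r) 1 j (b \<cdot> f) = 1" unfolding root_ginv[symmetric] loc_root by (rule if_not_P)
      then have "p \<in> bad b 1" using f by (simp add: jf bad_def vertices_def)
      moreover have "p \<noteq> (i, v)" using ne jf by auto
      ultimately show "p \<in> bad b 1 - {(i, v)}" by blast
    qed
    moreover have fin: "finite (bad b 1)" using less.prems by (simp add: wrel_def)
    ultimately have "card (bad (ginv ?r * b) 1) < card (bad b 1)"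
      using iv by (intro psubset_card_mono) auto
    then obtain t where t: "t \<in> gen tr_roots" "wrel 1 (ginv t * (ginv ?r * b))" "bad (ginv t * (ginv ?r * b)) 1 = {}"
      using less.hyps[OF _ w] by blast
    have "?r * t \<in> gen tr_roots" by (rule sgp_mult[OF sgp_gen r t(1)])
    moreover have "ginv (?r * t) * b = ginv t * (ginv ?r * b)" by (simp add: ginv_mult mult.assoc)
    ultimately show ?thesis using t(2,3) by metis
  qed
qed

text \<open>First the level permutation is divided out, then the finitely many bad vertices. This
  gives countably many cosets of K as well as generators of W modulo K.\<close>

lemma W_decomposition:
  assumes "h \<in> W" shows "\<exists>d\<in>D. \<exists>t\<in>gen tr_roots. ginv (shift d * t) * h \<in> K"
proof -
  obtain d where d: "wrel d h" using assms by (auto simp: W_def)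
  have dD: "d \<in> D" using tri_D[OF wrel_tri[OF d]] .
  have "wrel (ginv d) (ginv (shift d))" by (rule wrel_ginv[OF wrel_shift[OF dD]])
  then have "wrel 1 (ginv (shift d) * h)" using wrel_mult[OF _ d] by fastforce
  then obtain t where "t \<in> gen tr_roots" "wrel 1 (ginv t * (ginv (shift d) * h))"
    "bad (ginv t * (ginv (shift d) * h)) 1 = {}"
    using base_decomposition by blast
  then show ?thesis using dD by (intro bexI[of _ d] bexI[of _ t]) (auto simp: K_def ginv_mult mult.assoc)
qed

lemma gen_tr_roots_W: "gen tr_roots \<subseteq> W"
  by (rule gen_least[OF sgp_W]) (auto simp: tr_roots_def root_W[OF tr(1)])

lemma W_least:
  assumes V: "sgp V" "K \<subseteq> V" "\<And>d. d \<in> D \<Longrightarrow> shift d \<in> V" "\<And>i v g. g \<in> G \<Longrightarrow> root i v g \<in> V"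
  shows "W \<subseteq> V"
proof
  fix h assume "h \<in> W"
  then obtain d t where d: "d \<in> D" "t \<in> gen tr_roots" "ginv (shift d * t) * h \<in> K" using W_decomposition by blast
  have "gen tr_roots \<subseteq> V" by (rule gen_least[OF V(1)]) (auto simp: tr_roots_def V(4)[OF tr(1)])
  then have "shift d * t * (ginv (shift d * t) * h) \<in> V"
    using d V(2,3) by (intro sgp_mult[OF V(1) sgp_mult[OF V(1)]]) auto
  then show "h \<in> V" by (simp add: mult.assoc)
qed

section \<open>The group topology of W\<close>

lemma filter_base_NW: "filter_base NW"
  unfolding filter_base_def
proof (intro conjI ballI)
  show "NW \<noteq> {}" by (auto simp: NW_def)
  show "sgp n" if "n \<in> NW" for n using that by (auto simp: NW_def intro: sgp_Int sgp_K sgp_fix_pts)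
  fix n m assume "n \<in> NW" "m \<in> NW"
  then obtain E F where "finite E" "finite F" "n = K \<inter> fix_pts E" "m = K \<inter> fix_pts F" by (auto simp: NW_def)
  then show "\<exists>k\<in>NW. k \<subseteq> n \<inter> m"
    by (intro bexI[of _ "K \<inter> fix_pts (E \<union> F)"]) (auto simp: NW_def fix_pts_Un intro!: image_eqI[of _ _ "E \<union> F"])
qed

lemma NW_I: "finite F \<Longrightarrow> K \<inter> fix_pts F \<in> NW"
  by (auto simp: NW_def)

lemma K_fix_level:
  assumes k: "k \<in> K" "k \<cdot> upd 0 1 0 = upd 0 1 0"
  shows "tri 1 k" "loc k 1 i f \<in> G" "loc k 1 i f \<cdot> 0 = 0"
proof -
  let ?f = "upd 0 1 0 :: fs"
  obtain e where e: "e \<in> {1, refl 0}" "tri e k" "\<And>i f. loc k e i f \<in> G" "\<And>i f. loc k e i f \<cdot> 0 = 0"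
    using k by (auto simp: K_iff)
  have "e = 1"
  proof (rule ccontr)
    assume "e \<noteq> 1"
    then have "e \<cdot> 0 = 1" using e(1) by (auto simp: refl_app)
    then have "loc k e 0 ?f \<cdot> 1 = 0" using lookup_tri[OF e(2), of ?f 0] k(2) by simp
    then show False using e(4)[of 0 ?f] by (metis app_eq_iff zero_neq_one)
  qed
  then show "tri 1 k" "loc k 1 i f \<in> G" "loc k 1 i f \<cdot> 0 = 0" using e by auto
qed

text \<open>By the chain rule the conjugate acts locally as loc g (k f') * loc k f' * inverse of loc
  g f'. If f' passes through no bad vertex of g, then neither does k f', because k fixes the bad
  vertices, and all three factors fix 0. At a bad vertex, which k fixes, the outer factors are
  mutually inverse, and k fixes the point that g sends to 0.\<close>

lemma K_conj_nbhd:
  assumes g: "g \<in> W" shows "\<exists>F. finite F \<and> (\<forall>k\<in>K \<inter> fix_pts F. g * k * ginv g \<in> K)"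
proof -
  obtain d where w: "wrel d g" using g by (auto simp: W_def)
  note tg = wrel_tri[OF w]
  let ?f = "upd 0 1 0 :: fs"
  \<comment> \<open>Three kinds of test functions: the detector of the level permutation, the bad
    vertices of g, and for each bad vertex its child that the local action of g sends to 0.\<close>
  let ?F = "insert ?f (snd ` bad g d \<union> (\<lambda>(i, v). upd i (ginv (loc g d i v) \<cdot> 0) v) ` bad g d)"
  have "g * k * ginv g \<in> K" if k: "k \<in> K \<inter> fix_pts ?F" for k
  proof -
    have fx: "k \<cdot> f = f" if "f \<in> ?F" for f using k that by (auto simp: fix_pts_def)
    have kf: "k \<in> K" "k \<cdot> ?f = ?f" using k fx[of ?f] by auto
    note tk = K_fix_level(1)[OF kf] and lk = K_fix_level(2,3)[OF kf]
    have t: "tri 1 (g * k * ginv g)"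
      using tri_mult[OF tri_mult[OF tg tk] tri_ginv[OF tg]] by simp
    have "loc (g * k * ginv g) 1 j f \<in> G \<and> loc (g * k * ginv g) 1 j f \<cdot> 0 = 0" for j f
    proof -
      define i where "i = ginv d \<cdot> j"
      define f' where "f' = ginv g \<cdot> f"
      let ?p = "loc g d i f'"
      have eq: "loc (g * k * ginv g) 1 j f = loc g d i (k \<cdot> f') * loc k 1 i f' * ginv ?p"
        using loc_mult[OF tri_mult[OF tg tk] tri_ginv[OF tg], of j f] loc_mult[OF tg tk, of i f']
        by (simp add: i_def f'_def loc_ginv'[OF tg])
      have inG: "loc (g * k * ginv g) 1 j f \<in> G"
        unfolding eq by (intro sgp_mult[OF sgp_G] sgp_ginv[OF sgp_G] wrel_loc[OF w] lk)
      have trk: "trunc i (k \<cdot> f') = trunc i (k \<cdot> trunc i f')" using tri_trunc[OF tk, of i f' "trunc i f'"] by simp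
      have "loc g d i (k \<cdot> f') \<cdot> loc k 1 i f' \<cdot> ginv ?p \<cdot> 0 = 0"
      proof (cases "?p \<cdot> 0 = 0")
        case False
        then have b: "(i, trunc i f') \<in> bad g d" by (simp add: trunc_mem_bad_iff[OF tg])
        have pv: "loc g d i (trunc i f') = ?p" by (rule loc_trunc[OF tg]) simp
        have "k \<cdot> trunc i f' = trunc i f'" using b by (intro fx) force
        then have "loc g d i (k \<cdot> f') = ?p" using trk by (intro loc_trunc[OF tg]) simp
        moreover have "loc k 1 i f' \<cdot> ginv ?p \<cdot> 0 = ginv ?p \<cdot> 0"
        proof -
          have "upd i (ginv ?p \<cdot> 0) (trunc i f') \<in> ?F"
            using imageI[OF b, of "\<lambda>(i, v). upd i (ginv (loc g d i v) \<cdot> 0) v"] pv by simp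
          then have "k \<cdot> upd i (ginv ?p \<cdot> 0) (trunc i f') = upd i (ginv ?p \<cdot> 0) (trunc i f')" by (rule fx)
          then have "loc k 1 i (trunc i f') \<cdot> ginv ?p \<cdot> 0 = ginv ?p \<cdot> 0" by (simp add: loc_app[OF tk])
          moreover have "loc k 1 i (trunc i f') = loc k 1 i f'" by (rule loc_trunc[OF tk]) simp
          ultimately show ?thesis by simp
        qed
        ultimately show ?thesis by simp
      next
        case True
        then have gp: "ginv ?p \<cdot> 0 = 0" by (metis ginv_app)
        have "loc g d i (k \<cdot> f') \<cdot> 0 = 0"
        proof (rule ccontr)
          assume *: "loc g d i (k \<cdot> f') \<cdot> 0 \<noteq> 0"
          let ?w = "trunc i (k \<cdot> f')"
          have b: "(i, ?w) \<in> bad g d" using * by (simp add: trunc_mem_bad_iff[OF tg])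
          then have "k \<cdot> ?w = ?w" by (intro fx) force
          then have "trunc i (k \<cdot> f') = trunc i (k \<cdot> ?w)" by simp
          then have "trunc i f' = trunc i (k \<cdot> f')" using tri_trunc[OF tk, of i f' ?w] by simp
          then have "?p = loc g d i (k \<cdot> f')" by (rule loc_trunc[OF tg])
          then show False using * True by simp
        qed
        then show ?thesis using gp lk by simp
      qed
      then show ?thesis using inG eq by simp
    qed
    then show ?thesis using t unfolding K_iff by (intro bexI[of _ 1]) auto
  qed
  moreover have "finite ?F" using w by (simp add: wrel_def)
  ultimately show ?thesis by (intro exI[of _ ?F]) blast
qed

sublocale W: tdlc NW W K
proof
  show "filter_base NW" by (rule filter_base_NW)
  show "sgp W" by (rule sgp_W)
  show "K \<subseteq> W" by (rule K_subset_W)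
  show "K \<in> NW" using NW_I[of "{}"] by (simp add: fix_pts_def)
  show "\<exists>m\<in>NW. \<forall>k\<in>W \<inter> m. g * k * ginv g \<in> n" if g: "g \<in> W" and n: "n \<in> NW" for g n
  proof -
    obtain E where E: "finite E" "n = K \<inter> fix_pts E" using n by (auto simp: NW_def)
    obtain F where F: "finite F" "\<forall>k\<in>K \<inter> fix_pts F. g * k * ginv g \<in> K" using K_conj_nbhd[OF g] by blast
    let ?F = "F \<union> (\<lambda>f. ginv g \<cdot> f) ` E"
    have "g * k * ginv g \<in> n" if "k \<in> K \<inter> fix_pts ?F" for k
    proof -
      have "g * k * ginv g \<in> K" using F(2) that by (auto simp: fix_pts_Un)
      moreover have "g * k * ginv g \<in> fix_pts E" using that by (auto simp: fix_pts_def)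
      ultimately show ?thesis by (simp add: E(2))
    qed
    then show ?thesis using E(1) F(1) by (intro bexI[of _ "K \<inter> fix_pts ?F"] NW_I) auto
  qed
  show "\<exists>n\<in>NW. x \<notin> n" if x: "x \<noteq> 1" for x
  proof -
    obtain f where "x \<cdot> f \<noteq> f" using x sym_eqI[of x 1] by auto
    then have "x \<notin> K \<inter> fix_pts {f}" by (simp add: fix_pts_def)
    then show ?thesis using NW_I[of "{f}"] by blast
  qed
  show "\<exists>A. finite A \<and> A \<subseteq> K \<and> (\<forall>u\<in>K. \<exists>a\<in>A. ginv a * u \<in> n)" if n: "n \<in> NW" for n
  proof -
    obtain F where F: "finite F" "n = K \<inter> fix_pts F" using n by (auto simp: NW_def)
    \<comment> \<open>Cosets of n in K are told apart by restrictions to F, of which there are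
      finitely many because orbits of K are finite.\<close>
    let ?r = "\<lambda>u :: fs sym. restrict (app u) F"
    have "?r ` K \<subseteq> PiE F (\<lambda>f. {h \<cdot> f |h. h \<in> K})" by auto
    then have fin: "finite (?r ` K)"
      using F(1) finite_orbit_K by (meson finite_PiE finite_subset)
    let ?A = "inv_into K ?r ` ?r ` K"
    have "\<exists>a\<in>?A. ginv a * u \<in> n" if u: "u \<in> K" for u
    proof -
      let ?a = "inv_into K ?r (?r u)"
      have a: "?a \<in> K" "?r ?a = ?r u" using inv_into_into[of "?r u" ?r K] f_inv_into_f[of "?r u" ?r K] u by auto
      have "u \<cdot> f = ?a \<cdot> f" if "f \<in> F" for f using fun_cong[OF a(2), of f] that by simp
      then have "ginv ?a * u \<in> fix_pts F" by (simp add: fix_pts_def)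
      moreover have "ginv ?a * u \<in> K" by (intro sgp_mult[OF sgp_K] sgp_ginv[OF sgp_K] a(1) u)
      ultimately show ?thesis using u F(2) by blast
    qed
    moreover have "?A \<subseteq> K" by (auto intro: inv_into_into)
    ultimately show ?thesis using fin by (intro exI[of _ ?A]) blast
  qed
  show "\<exists>x\<in>K. \<forall>n\<in>NW. \<exists>M. \<forall>m\<ge>M. ginv x * u m \<in> n"
    if u: "\<And>i. u i \<in> K" and c: "\<And>n. n \<in> NW \<Longrightarrow> \<exists>M. \<forall>m\<ge>M. ginv (u M) * u m \<in> n" for u :: "nat \<Rightarrow> fs sym"
  proof -
    have "\<exists>M. \<forall>m\<ge>M. ginv (u M) * u m \<in> fix_pts F" if "finite F" for F
      using c[OF NW_I[OF that]] by blast
    then obtain h where h: "h \<in> K" "\<forall>F. finite F \<longrightarrow> (\<exists>M. \<forall>m\<ge>M. \<forall>f\<in>F. u m \<cdot> f = h \<cdot> f)"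
      using K_complete[of u] u by blast
    have "\<exists>M. \<forall>m\<ge>M. ginv h * u m \<in> n" if n: "n \<in> NW" for n
    proof -
      obtain F where F: "finite F" "n = K \<inter> fix_pts F" using n by (auto simp: NW_def)
      obtain M where M: "\<forall>m\<ge>M. \<forall>f\<in>F. u m \<cdot> f = h \<cdot> f" using h(2) F(1) by blast
      have "ginv h * u m \<in> n" if "m \<ge> M" for m
        using M that sgp_mult[OF sgp_K sgp_ginv[OF sgp_K h(1)] u[of m]] by (simp add: F(2) fix_pts_def)
      then show ?thesis by blast
    qed
    then show ?thesis using h(1) by blast
  qed
  show "\<exists>\<nu> :: nat \<Rightarrow> fs sym set. (\<forall>i. \<nu> i \<in> NW) \<and> (\<forall>n\<in>NW. \<exists>i. \<nu> i \<subseteq> n)"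
  proof -
    let ?\<nu> = "\<lambda>i. K \<inter> fix_pts (from_nat_into UNIV ` {..<i} :: fs set)"
    have "\<exists>i. ?\<nu> i \<subseteq> n" if n: "n \<in> NW" for n
    proof -
      obtain F where F: "finite F" "n = K \<inter> fix_pts F" using n by (auto simp: NW_def)
      have "f = from_nat_into UNIV (to_nat_on UNIV f)" for f :: fs
        using from_nat_into_to_nat_on[OF countable_fs, of f] by simp
      moreover have "to_nat_on UNIV f < Suc (Max (insert 0 (to_nat_on UNIV ` F)))" if "f \<in> F" for f
        using F(1) that by (simp add: less_Suc_eq_le)
      ultimately have "F \<subseteq> from_nat_into UNIV ` {..<Suc (Max (insert 0 (to_nat_on UNIV ` F)))}"
        by (metis imageI lessThan_iff subsetI)
      then have "?\<nu> (Suc (Max (insert 0 (to_nat_on UNIV ` F)))) \<subseteq> n" by (auto simp: F(2) fix_pts_def)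
      then show ?thesis by blast
    qed
    then show ?thesis by (intro exI[of _ ?\<nu>]) (auto intro: NW_I)
  qed
  show "\<exists>A. countable A \<and> A \<subseteq> W \<and> (\<forall>x\<in>W. \<exists>a\<in>A. ginv a * x \<in> K)"
  proof -
    let ?A = "(\<lambda>(d, t). shift d * t) ` (D \<times> gen tr_roots)"
    have "countable (UNIV :: ((int \<times> fs) \<times> nat) set)"
      using countable_SIGMA[OF countable_SIGMA[OF countableI_type[of "UNIV :: int set"] countable_fs]
          countableI_type[of "UNIV :: nat set"]] by (simp flip: UNIV_Times_UNIV)
    then have "countable (gen tr_roots)" unfolding tr_roots_def by (intro countable_gen countable_image)
    then have "countable ?A" using countable_D by (intro countable_image countable_SIGMA)
    moreover have "?A \<subseteq> W"
    proof
      fix a assume "a \<in> ?A"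
      then obtain d t where "d \<in> D" "t \<in> gen tr_roots" "a = shift d * t" by auto
      then show "a \<in> W" using sgp_mult[OF sgp_W wrel_W[OF wrel_shift]] gen_tr_roots_W by blast
    qed
    moreover have "\<exists>a\<in>?A. ginv a * x \<in> K" if x: "x \<in> W" for x
    proof -
      obtain d t where dt: "d \<in> D" "t \<in> gen tr_roots" "ginv (shift d * t) * x \<in> K" using W_decomposition[OF x] by blast
      have "shift d * t \<in> ?A" using dt by (intro image_eqI[of _ _ "(d, t)"]) auto
      then show ?thesis using dt(3) by (rule rev_bexI)
    qed
    ultimately show ?thesis by (intro exI[of _ ?A] conjI ballI)
  qed
qed

end

section \<open>Transitivity, generation and normal generation of W\<close>

lemma trunc_eq_zero:
  assumes "\<And>k. k \<in> keys f \<Longrightarrow> k \<le> i" shows "trunc i f = 0"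
proof (rule poly_mapping_eqI)
  fix k
  have "lookup f k = 0" if "lt3 i k"
    using assms[of k] that by (force simp: in_keys_iff lt3_def le3_iff)
  then show "lookup (trunc i f) k = lookup 0 k" by simp
qed

lemma keys_upd_zero: "keys (upd j 0 f) = keys f - {j}"
  by (auto simp: in_keys_iff split: if_splits)

text \<open>Induction on the support of v: roots at zero vertices suffice, since their conjugates
  reach every other vertex.\<close>

lemma roots_generated:
  assumes V: "sgp V" and G: "\<And>x. \<exists>g\<in>G. g \<cdot> 0 = x" and r: "\<And>j g. g \<in> G \<Longrightarrow> root j 0 g \<in> V" and g: "g \<in> G"
  shows "root i v g \<in> V"
proof (cases "trunc i v = v")
  case False
  then have "root i v g = 1" by (intro sym_eqI) (auto simp: root_app)
  then show ?thesis using sgp_one[OF V] by simp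
next
  case True
  then show ?thesis
  proof (induction "card (keys v)" arbitrary: v rule: less_induct)
    case less
    show ?case
    proof (cases "v = 0")
      case True
      then show ?thesis using r g by simp
    next
      case False
      \<comment> \<open>Above the largest key all coordinates vanish, so a root at the zero vertex
        of level j can create the value at j and move u to v.\<close>
      define j where "j = Max (keys v)"
      have j: "j \<in> keys v" using False unfolding j_def by (intro Max_in) auto
      have nz: "lookup v j \<noteq> 0" using j by (simp add: in_keys_iff)
      have ij: "lt3 i j" using nz less.prems by (metis lookup_trunc)
      define u where "u = upd j 0 v"
      have ku: "keys u = keys v - {j}" by (simp add: u_def keys_upd_zero)
      have tu: "trunc i u = u"
      proof (rule poly_mapping_eqI)
        fix k
        have "lookup v k = 0" if "\<not> lt3 i k" using less.prems that by (metis lookup_trunc)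
        then show "lookup (trunc i u) k = lookup u k" by (simp add: u_def)
      qed
      have "card (keys u) < card (keys v)" unfolding ku using j by (intro psubset_card_mono) auto
      then have ru: "root i u g \<in> V" using less.hyps tu by blast
      obtain c where c: "c \<in> G" "c \<cdot> 0 = lookup v j" using G by blast
      have "trunc j u = 0" by (rule trunc_eq_zero) (simp add: ku j_def)
      then have "root j 0 c \<cdot> u = v" using c(2) by (simp add: root_app u_def)
      moreover have "i \<noteq> j" "\<not> lt3 j i" using ij le3_antisym by (auto simp: lt3_def)
      ultimately have "root j 0 c * root i u g * ginv (root j 0 c) = root i v g"
        using root_root[of i j u 0 c g] tu less.prems by simp
      then show ?thesis
        using ru r[OF c(1)] by (metis sgp_mult[OF V] sgp_ginv[OF V])
    qed
  qed
qed

context stage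
begin

lemma W_transitive: "\<exists>g\<in>W. g \<cdot> 0 = e"
proof (induction "card (keys e)" arbitrary: e rule: less_induct)
  case less
  show ?case
  proof (cases "e = 0")
    case True
    then show ?thesis using sgp_one[OF sgp_W] by (intro bexI[of _ 1]) auto
  next
    case False
    define j where "j = Max (keys e)"
    have j: "j \<in> keys e" using False unfolding j_def by (intro Max_in) auto
    define u where "u = upd j 0 e"
    have ku: "keys u = keys e - {j}" by (simp add: u_def keys_upd_zero)
    have "card (keys u) < card (keys e)" unfolding ku using j by (intro psubset_card_mono) auto
    then obtain g where g: "g \<in> W" "g \<cdot> 0 = u" using less.hyps by blast
    have "trunc j u = 0" by (rule trunc_eq_zero) (simp add: ku j_def)
    then have "root j 0 (tr (lookup e j)) \<cdot> u = e" using tr(2) by (simp add: root_app u_def)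
    then show ?thesis
      using g sgp_mult[OF sgp_W root_W[OF tr(1)]] by (intro bexI[of _ "root j 0 (tr (lookup e j)) * g"]) auto
  qed
qed

text \<open>K fixes the zero function, so conjugates of K by elements that send 0 to e fix e;
  finitely many of them control any basic neighbourhood.\<close>

lemma W_small:
  assumes n: "n \<in> NW"
  shows "\<exists>F. finite F \<and> F \<subseteq> W \<and> (\<forall>g\<in>W. (\<forall>a\<in>F. ginv a * g * a \<in> K) \<longrightarrow> g \<in> n)"
proof -
  obtain E where E: "finite E" "n = K \<inter> fix_pts E" using n by (auto simp: NW_def)
  obtain a where a: "\<And>e. a e \<in> W" "\<And>e. a e \<cdot> 0 = e" using W_transitive by metis
  have "g \<in> n" if g: "\<forall>b\<in>insert 1 (a ` E). ginv b * g * b \<in> K" for g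
  proof -
    have "g \<cdot> e = e" if "e \<in> E" for e
    proof -
      have "(ginv (a e) * g * a e) \<cdot> 0 = 0" using g that by (intro K_zero) blast
      then have "ginv (a e) \<cdot> g \<cdot> e = 0" using a(2)[of e] by simp
      then show ?thesis using a(2)[of e] by (metis app_ginv)
    qed
    moreover have "g \<in> K" using g by simp
    ultimately show ?thesis by (simp add: E(2) fix_pts_def)
  qed
  then show ?thesis
    using E(1) a(1) sgp_one[OF sgp_W] by (intro exI[of _ "insert 1 (a ` E)"]) auto
qed

lemma root_in_K_D: assumes "root i 0 g \<in> K" shows "g \<cdot> 0 = 0"
proof -
  obtain d where d: "tri d (root i 0 g)" "loc (root i 0 g) d i 0 \<cdot> 0 = 0" using assms by (auto simp: K_iff)
  have "d = 1" by (rule tri_unique[OF d(1) tri_root])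
  then show ?thesis using d(2) by (simp add: loc_root)
qed

lemma infinite_root_cosets:
  assumes "infinite ((\<lambda>g. g \<cdot> 0) ` C)" shows "infinite (lcoset K ` root i 0 ` C)"
proof
  assume fin: "finite (lcoset K ` root i 0 ` C)"
  let ?L = "\<lambda>g. lcoset K (root i 0 g)"
  have eq: "g \<cdot> 0 = h \<cdot> 0" if "?L g = ?L h" for g h
  proof -
    have "root i 0 (ginv g * h) \<in> K"
      using that by (simp add: lcoset_eq_iff[OF sgp_K] root_mult root_ginv)
    then have "(ginv g * h) \<cdot> 0 = 0" by (rule root_in_K_D)
    then show ?thesis by (metis mult_app app_ginv)
  qed
  have "(\<lambda>g. g \<cdot> 0) ` C \<subseteq> (\<lambda>X. inv_into C ?L X \<cdot> 0) ` ?L ` C"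
  proof
    fix x assume "x \<in> (\<lambda>g. g \<cdot> 0) ` C"
    then obtain g where g: "g \<in> C" "x = g \<cdot> 0" by blast
    have "?L (inv_into C ?L (?L g)) = ?L g" using f_inv_into_f[of "?L g" ?L C] g(1) by blast
    then have "inv_into C ?L (?L g) \<cdot> 0 = x" unfolding g(2) by (rule eq)
    then show "x \<in> (\<lambda>X. inv_into C ?L X \<cdot> 0) ` ?L ` C" using g(1) by blast
  qed
  moreover have "finite ((\<lambda>X. inv_into C ?L X \<cdot> 0) ` ?L ` C)"
    by (rule finite_imageI) (use fin in \<open>simp add: image_image\<close>)
  ultimately show False using assms by (simp add: finite_subset)
qed

lemma infinite_G: "infinite ((\<lambda>g. g \<cdot> 0) ` G)"
proof -
  have "x \<in> (\<lambda>g. g \<cdot> 0) ` G" for x using transitive[of x] by (metis imageI)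
  then have "(\<lambda>g. g \<cdot> 0) ` G = UNIV" by (intro UNIV_eq_I[symmetric])
  then show ?thesis by simp
qed

lemma infinite_W_cosets: "infinite (lcoset K ` W)"
  using infinite_root_cosets[OF infinite_G, of 0] root_W
  by (metis (no_types, lifting) finite_subset image_mono image_subsetI)

lemma conthom_root: "conthom (root i v) G perm_base NW"
  unfolding conthom_def
proof (intro conjI ballI)
  fix m assume "m \<in> NW"
  then obtain F where F: "finite F" "m = K \<inter> fix_pts F" by (auto simp: NW_def)
  let ?F = "insert 0 ((\<lambda>f. lookup f i) ` F)"
  have "root i v ` (G \<inter> fix_pts ?F) \<subseteq> m"
    using root_K by (auto simp: F(2) fix_pts_def root_app)
  then show "\<exists>n\<in>perm_base. root i v ` (G \<inter> n) \<subseteq> m" using F(1)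
    by (intro bexI[of _ "fix_pts ?F"]) (auto simp: perm_base_def)
qed (auto simp: root_mult sgp_G)

text \<open>The preimage of V in this copy of G is normal and contains the point stabiliser, hence
  is all of G by \<open>normal_generation\<close>.\<close>

lemma root_normal_generation:
  assumes V: "sgp V" "nrm V M" "root i v ` G \<subseteq> M" and U: "\<And>u. u \<in> G \<Longrightarrow> u \<cdot> 0 = 0 \<Longrightarrow> root i v u \<in> V"
    and g: "g \<in> G"
  shows "root i v g \<in> V"
proof -
  have "{g \<in> G. root i v g \<in> V} = G"
    using U by (intro normal_generation sgp_vimage[OF conthom_root V(1)] nrm_vimage[OF conthom_root V(2,3)]) auto
  then show ?thesis using g by blast
qed

lemma shift_refl_K: "shift (refl 0) \<in> K"
  using sgp_one[OF sgp_G] refl_in_D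
  unfolding K_iff by (intro bexI[of _ "refl 0"]) (auto simp: tri_shift loc_shift)

text \<open>K contains the point stabiliser of every copy of G, which yields all roots, and it
  contains the shift by \<open>refl 0\<close>, which yields all shifts because the reflections are
  conjugate.\<close>

lemma W_normal_generation:
  assumes V: "sgp V" "V \<subseteq> W" "nrm V W" "K \<subseteq> V" shows "V = W"
proof -
  have r: "root i v g \<in> V" if "g \<in> G" for i v g
    by (rule root_normal_generation[OF V(1,3) _ _ that]) (use root_W root_K V(4) in auto)
  have "{d \<in> D. shift d \<in> V} = D"
  proof (rule D_normal_generation)
    show "sgp {d \<in> D. shift d \<in> V}"
      by (rule sgpI) (auto simp: shift_one shift_mult shift_ginv sgp_one[OF sgp_D] sgp_mult[OF sgp_D]
          sgp_ginv[OF sgp_D] sgp_one[OF V(1)] sgp_mult[OF V(1)] sgp_ginv[OF V(1)])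
    show "nrm {d \<in> D. shift d \<in> V} D"
      using V(3) wrel_W[OF wrel_shift]
      by (auto simp: nrm_def shift_mult shift_ginv sgp_mult[OF sgp_D] sgp_ginv[OF sgp_D])
    show "refl 0 \<in> {d \<in> D. shift d \<in> V}" using shift_refl_K V(4) refl_in_D by blast
  qed blast
  then have "W \<subseteq> V" using V(1,4) r by (intro W_least) blast+
  then show ?thesis using V(2) by blast
qed

lemma cg_W: "cg NW W"
  unfolding cg_def
proof (intro allI impI)
  fix V :: "nat \<Rightarrow> fs sym set"
  assume V: "\<forall>i. relopen NW W (V i) \<and> V i \<subseteq> V (Suc i)" and u: "(\<Union>i. V i) = W"
  have incr: "V i \<subseteq> V (Suc i)" for i using V by blast
  have mono: "V i \<subseteq> V j" if "i \<le> j" for i j using incr that by (rule lift_Suc_mono_le)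
  have sV: "sgp (V i)" and VW: "V i \<subseteq> W" for i using V by (auto simp: relopen_def)
  obtain n where n: "n \<in> NW" "W \<inter> n \<subseteq> V 0" using V unfolding relopen_def by blast
  obtain A where A: "finite A" "A \<subseteq> K" "\<forall>u\<in>K. \<exists>a\<in>A. ginv a * u \<in> n" using W.finite_index[OF n(1)] by blast
  let ?X = "A \<union> shift ` {refl 0, refl 1, refl 2}"
  have "?X \<subseteq> W"
    using A(2) K_subset_W wrel_W[OF wrel_shift] refl_in_D by auto
  then obtain i where i: "?X \<subseteq> V i"
    using finite_subset_of_chain[of ?X V] incr A(1) u by auto
  \<comment> \<open>One copy of G, at the zero vertex of level 0, is absorbed by the chain because G
    satisfies \<open>cg\<close>. Shifts carry it to the zero vertices of the other levels, and
    \<open>roots_generated\<close> does the rest.\<close>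
  obtain j where j: "root 0 0 ` G \<subseteq> V j"
    using cg_subset_chain[OF cg_image[OF conthom_root cg_G] sgp_image[OF conthom_root], where S = W and V = V] V u root_W
    by blast
  define m where "m = max i j"
  have X: "?X \<subseteq> V m" and R: "root 0 0 ` G \<subseteq> V m"
    using i j mono[of i m] mono[of j m] by (auto simp: m_def)
  have "K \<subseteq> V m"
  proof
    fix k assume k: "k \<in> K"
    then obtain a where a: "a \<in> A" "ginv a * k \<in> n" using A(3) by blast
    have "ginv a * k \<in> W" using a(1) A(2) k K_subset_W by (intro sgp_mult[OF sgp_W] sgp_ginv[OF sgp_W]) auto
    then have "ginv a * k \<in> V m" using n(2) a(2) mono[of 0 m] by auto
    then have "a * (ginv a * k) \<in> V m" using sgp_mult[OF sV, of a m "ginv a * k"] X a(1) by auto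
    then show "k \<in> V m" by simp
  qed
  moreover have sh: "shift d \<in> V m" if "d \<in> D" for d
  proof -
    have "sgp {d. shift d \<in> V m}"
      by (rule sgpI) (auto simp: shift_one shift_mult shift_ginv sgp_one[OF sV] sgp_mult[OF sV] sgp_ginv[OF sV])
    then have "D \<subseteq> {d. shift d \<in> V m}" unfolding D_def using X by (intro gen_least) auto
    then show ?thesis using that by blast
  qed
  moreover have "root i v g \<in> V m" if "g \<in> G" for i v g
  proof (rule roots_generated[OF sV transitive _ that])
    fix j g assume g: "g \<in> G"
    obtain d where d: "d \<in> D" "d \<cdot> 0 = j" using D_transitive by blast
    have "shiftf d 0 = 0" by (simp add: poly_mapping_eq_iff fun_eq_iff)
    then have "root j 0 g = shift d * root 0 0 g * ginv (shift d)" using shift_root[OF d(1), of 0 0 g] d(2) by simp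
    then show "root j 0 g \<in> V m"
      using R g sh[OF d(1)] sgp_mult[OF sV] sgp_ginv[OF sV] by auto
  qed
  ultimately have "W \<subseteq> V m" using sV by (intro W_least)
  then show "\<exists>i. V i = W" using VW by blast
qed

text \<open>Iterated wreath products along a chain of levels. The discrete residual of \<open>tower k C\<close> contains
  \<open>tower k (res C)\<close> if \<open>C\<close> is not relatively compact: small elements on the lower levels can be moved
  away from any finite set by \<open>C\<close>, and they generate everything on these levels as a normal subgroup.\<close>

definition tower :: "nat \<Rightarrow> nat sym set \<Rightarrow> fs sym set" where
  "tower k A = gen (\<Union>m\<in>{..k}. root (3 * int m) 0 ` (if m = k then A else G))"

lemma root_tower:
  "g \<in> A \<Longrightarrow> root (3 * int k) 0 g \<in> tower k A" "m < k \<Longrightarrow> g \<in> G \<Longrightarrow> root (3 * int m) 0 g \<in> tower k A"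
  unfolding tower_def by (rule subsetD[OF gen_superset], force)+

lemma tower_least:
  assumes "sgp V" "\<And>g. g \<in> A \<Longrightarrow> root (3 * int k) 0 g \<in> V" "\<And>m g. m < k \<Longrightarrow> g \<in> G \<Longrightarrow> root (3 * int m) 0 g \<in> V"
  shows "tower k A \<subseteq> V"
  unfolding tower_def using assms by (intro gen_least) (auto split: if_splits)

lemma sgp_tower: "sgp (tower k A)"
  unfolding tower_def by (rule sgp_gen)

lemma tower_W: "A \<subseteq> G \<Longrightarrow> tower k A \<subseteq> W"
  using root_W by (intro tower_least[OF sgp_W]) auto

lemma cg_tower: assumes "sgp C" "C \<subseteq> G" "cg perm_base C" shows "cg NW (tower k C)"
  unfolding tower_def
proof (rule cg_gen_UN)
  fix m assume "m \<in> {..k}"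
  have C: "conthom (root (3 * int m) 0) C perm_base NW" by (rule conthom_subset[OF conthom_root assms(1,2)])
  show "sgp (root (3 * int m) 0 ` (if m = k then C else G)) \<and>
      cg NW (root (3 * int m) 0 ` (if m = k then C else G))"
    using sgp_image[OF C] cg_image[OF C assms(3)] sgp_image[OF conthom_root] cg_image[OF conthom_root cg_G]
    by auto
qed simp

lemma tower_res_subset:
  assumes C: "sgp C" "C \<subseteq> G" and inf: "infinite ((\<lambda>g. g \<cdot> 0) ` C)"
  shows "tower k (res perm_base C) \<subseteq> res NW (tower k C)"
proof -
  have "tower k (res perm_base C) \<subseteq> V" if V: "relopen NW (tower k C) V" "nrm V (tower k C)" for V
  proof (rule tower_least)
    show sV: "sgp V" using V(1) by (simp add: relopen_def)
    let ?j = "3 * int k"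
    have \<phi>: "conthom (root ?j 0) C perm_base NW" by (rule conthom_subset[OF conthom_root C])
    have im: "root ?j 0 ` C \<subseteq> tower k C" using root_tower(1) by blast
    show "root ?j 0 g \<in> V" if "g \<in> res perm_base C" for g
      using that relopen_vimage[OF \<phi> V(1) im] nrm_vimage[OF \<phi> V(2) im] by (auto simp: res_def)
    fix m g assume m: "m < k" and g: "g \<in> G"
    let ?i = "3 * int m"
    have ij: "lt3 ?i ?j" "?i \<noteq> ?j" "\<not> lt3 ?j ?i" using m by (auto simp: lt3_def le3_iff)
    obtain F where F: "finite F" "tower k C \<inter> (K \<inter> fix_pts F) \<subseteq> V"
      using V(1) by (auto simp: relopen_def NW_def)
    \<comment> \<open>Choose c so that it sends 0 to a value that no member of F takes at level
      \<open>?j\<close>. Conjugation by its root carries elements on the lower level to a vertex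
      through which no member of F passes. Elements of the point stabiliser then fix F and fall into
      V, and conjugating back returns them to the zero vertex.\<close>
    have "infinite ((\<lambda>g. g \<cdot> 0) ` C - (\<lambda>f. lookup f ?j) ` F)" using inf F(1) by simp
    then have "(\<lambda>g. g \<cdot> 0) ` C - (\<lambda>f. lookup f ?j) ` F \<noteq> {}" by (rule infinite_imp_nonempty)
    then obtain c where c: "c \<in> C" "c \<cdot> 0 \<notin> (\<lambda>f. lookup f ?j) ` F" by blast
    let ?r = "root ?j 0 c"
    have r: "?r \<in> tower k C" by (rule root_tower(1)[OF c(1)])
    show "root ?i 0 g \<in> V"
    proof (rule root_normal_generation[OF sV V(2) _ _ g])
      show "root ?i 0 ` G \<subseteq> tower k C" using root_tower(2)[OF m] by blast
      fix u assume u: "u \<in> G" "u \<cdot> 0 = 0"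
      let ?x = "?r * root ?i 0 u * ginv ?r"
      have x: "?x = root ?i (trunc ?i (?r \<cdot> 0)) u" using root_root[OF ij(2,3), of 0 0 c u] by simp
      have "?x \<in> K" unfolding x by (rule root_K[OF u])
      moreover have "?x \<cdot> f = f" if "f \<in> F" for f
      proof -
        have "trunc ?i f \<noteq> trunc ?i (?r \<cdot> 0)"
        proof
          assume "trunc ?i f = trunc ?i (?r \<cdot> 0)"
          then have "lookup f ?j = c \<cdot> 0" using ij(1) by (simp add: trunc_eq_iff root_app)
          then show False using c(2) that by (metis imageI)
        qed
        then show ?thesis unfolding x by (simp add: root_app[of ?i])
      qed
      moreover have "?x \<in> tower k C"
        using r root_tower(2)[OF m u(1)] by (intro sgp_mult[OF sgp_tower] sgp_ginv[OF sgp_tower])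
      ultimately have "?x \<in> V" using F(2) by (auto simp: fix_pts_def)
      then have "ginv ?r * ?x * ginv (ginv ?r) \<in> V"
        using V(2) sgp_ginv[OF sgp_tower r] unfolding nrm_def by blast
      then show "root ?i 0 u \<in> V" by (simp add: mult.assoc)
    qed
  qed
  moreover have "tower k (res perm_base C) \<subseteq> tower k C"
    using root_tower res_subset[of perm_base C] by (intro tower_least[OF sgp_tower]) blast+
  ultimately show ?thesis by (auto simp: res_def[of NW])
qed

text \<open>Descents are first made in the top copy, while the residuals keep all lower levels; once
  \<alpha> is used up, the lower levels still provide \<mu>. This order of descent explains the sum
  \<mu> + \<alpha>.\<close>

lemma big_tower:
  assumes "big_perm A \<alpha>" "A \<subseteq> G" and low: "\<And>A. big NW (lcoset K) (tower k A) \<mu>"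
  shows "big NW (lcoset K) (tower k A) (\<mu> + \<alpha>)"
  using assms(1,2)
proof induction
  case (big_zero A)
  show ?case using low by simp
next
  case (big_sup A f \<alpha>)
  have "\<mu> + \<alpha> \<le> osup (range (\<lambda>i. \<mu> + f i))"
    by (rule order_trans[OF add_right_mono_countable_ord[OF big_sup(2)] add_osup_range_le])
  then show ?case by (rule big.big_sup[rotated]) (rule big_sup.IH[OF big_sup.prems])
next
  case (big_suc C A \<alpha>)
  have CG: "C \<subseteq> G" using big_suc by blast
  have "big NW (lcoset K) (tower k A) ((\<mu> + \<alpha>) + 1)"
  proof (rule big.big_suc)
    show "sgp (tower k C)" by (rule sgp_tower)
    show "tower k C \<subseteq> tower k A" using root_tower big_suc(2) by (intro tower_least[OF sgp_tower]) blast+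
    show "cg NW (tower k C)" by (rule cg_tower[OF big_suc(1) CG big_suc(3)])
    have "lcoset K ` root (3 * int k) 0 ` C \<subseteq> lcoset K ` tower k C" using root_tower(1) by blast
    then show "infinite (lcoset K ` tower k C)"
      using infinite_root_cosets[OF big_suc(4)] infinite_super by blast
    have "big NW (lcoset K) (tower k (res perm_base C)) (\<mu> + \<alpha>)"
      using big_suc.IH CG res_subset by blast
    then show "big NW (lcoset K) (res NW (tower k C)) (\<mu> + \<alpha>)"
      by (rule big_subset[OF _ tower_res_subset[OF big_suc(1) CG big_suc(4)]])
  qed
  then show ?case by (simp add: add.assoc)
qed

text \<open>A tower with one more level contains the full previous tower, whatever stands on its new
  top level, so each level adds a summand \<alpha>. All finite towers lie in W.\<close>

lemma big_W:
  assumes "big_perm G \<alpha>" shows "big NW (lcoset K) W (osup (range (mult_nat_ord \<alpha>)))"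
proof -
  have "big NW (lcoset K) (tower k A) (mult_nat_ord \<alpha> k)" for k A
  proof (induction k arbitrary: A)
    case 0
    show ?case by (simp add: big.big_zero)
  next
    case (Suc k)
    have "big NW (lcoset K) (tower k G) (mult_nat_ord \<alpha> k + \<alpha>)" by (rule big_tower[OF assms order_refl Suc])
    moreover have "tower k G \<subseteq> tower (Suc k) A"
      using root_tower(2)[of _ "Suc k"] by (intro tower_least[OF sgp_tower]) simp_all
    ultimately show ?case by (simp add: big_subset)
  qed
  then have bW: "big NW (lcoset K) W (mult_nat_ord \<alpha> k)" for k
    using tower_W[OF order_refl, of k] big_subset by blast
  show ?thesis by (rule big.big_sup[OF bW order_refl])
qed

end

section \<open>Elementarity of W by peeling off levels\<close>

context stage
begin

text \<open>Forgets the action of h on level j and on the levels below it in the same chain. The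
  result lies in W again, so this is a retraction and comes with the section needed for split
  extensions.\<close>

definition cut :: "int \<Rightarrow> fs sym \<Rightarrow> fs sym" where
  "cut j h = Sym (\<lambda>f. mix {i. le3 i j} f (h \<cdot> f))"

lemma eqa_mix: "\<not> le3 i j \<Longrightarrow> eqa i (mix {i. le3 i j} f g) g"
  using le3_trans by (auto simp: eqa_def)

lemma cut_app: assumes h: "tri 1 h" shows "cut j h \<cdot> f = mix {i. le3 i j} f (h \<cdot> f)"
proof -
  let ?m = "\<lambda>h f. mix {i. le3 i j} f (h \<cdot> f)"
  have inv: "?m (ginv h) (?m h f) = f" if h: "tri 1 h" for h f
  proof (rule poly_mapping_eqI)
    fix i
    have "lookup (ginv h \<cdot> ?m h f) i = lookup f i" if "\<not> le3 i j"
      using tri_eqa[OF tri_ginv[OF h], of i "?m h f" "h \<cdot> f"] eqa_mix[OF that] by (simp add: eqa_iff)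
    then show "lookup (?m (ginv h) (?m h f)) i = lookup f i" by simp
  qed
  show ?thesis unfolding cut_def
    by (rule Sym_app[of "?m (ginv h)"]) (use inv[OF h] inv[of "ginv h"] tri_ginv[OF h] in simp_all)
qed

text \<open>If i is not at or below j, neither is any level above i. The coordinates kept by the cut
  thus depend only on kept coordinates.\<close>

lemma cut_mult: assumes h: "tri 1 h" and k: "tri 1 k" shows "cut j (h * k) = cut j h * cut j k"
proof (rule sym_eqI)
  fix f
  have hk: "tri 1 (h * k)" using tri_mult[OF h k] by simp
  have "mix {i. le3 i j} f (h \<cdot> k \<cdot> f) = mix {i. le3 i j} (mix {i. le3 i j} f (k \<cdot> f)) (h \<cdot> mix {i. le3 i j} f (k \<cdot> f))"
  proof (rule poly_mapping_eqI)
    fix i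
    have "lookup (h \<cdot> mix {i. le3 i j} f (k \<cdot> f)) i = lookup (h \<cdot> k \<cdot> f) i" if "\<not> le3 i j"
      using tri_eqa[OF h, of i "mix {i. le3 i j} f (k \<cdot> f)" "k \<cdot> f"] eqa_mix[OF that] by (simp add: eqa_iff)
    then show "lookup (mix {i. le3 i j} f (h \<cdot> k \<cdot> f)) i =
      lookup (mix {i. le3 i j} (mix {i. le3 i j} f (k \<cdot> f)) (h \<cdot> mix {i. le3 i j} f (k \<cdot> f))) i" by simp
  qed
  then show "cut j (h * k) \<cdot> f = (cut j h * cut j k) \<cdot> f" by (simp add: cut_app h k hk)
qed

lemma cut_one: "cut j 1 = 1"
  by (rule sym_eqI, rule poly_mapping_eqI) (simp add: cut_app[OF tri_one])

lemma tri_cut: assumes h: "tri 1 h" shows "tri 1 (cut j h)"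
proof -
  have *: "eqa i (cut j h \<cdot> f) (cut j h \<cdot> g)" if h: "tri 1 h" and e: "eqa i f g" for h i f g
    using tri_eqa[OF h, of i f g] e by (simp add: cut_app[OF h] eqa_def)
  have gi: "tri 1 (ginv h)" using tri_ginv[OF h] by simp
  have "cut j h * cut j (ginv h) = 1" using cut_mult[OF h gi] by (simp add: cut_one)
  then have "ginv (cut j h) = cut j (ginv h)" by (rule ginv_unique)
  then show ?thesis using *[OF h] *[OF gi] sgp_one[OF sgp_D] by (intro triI) auto
qed

lemma loc_cut: assumes h: "tri 1 h" shows "loc (cut j h) 1 i f = (if le3 i j then 1 else loc h 1 i f)"
  by (rule sym_eqI) (simp add: loc_app[OF tri_cut[OF h]] loc_app[OF h] cut_app[OF h])

lemma wrel_cut: assumes h: "wrel 1 h" shows "wrel 1 (cut j h)"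
proof -
  note t = wrel_tri[OF h]
  have "bad (cut j h) 1 \<subseteq> bad h 1" by (auto simp: bad_def loc_cut[OF t] split: if_splits)
  then show ?thesis
    using h sgp_one[OF sgp_G] finite_subset by (auto simp: wrel_def tri_cut loc_cut)
qed

text \<open>Level-preserving elements whose bad vertices lie on levels in J. Since each element has
  finitely many bad vertices, the finite sets J exhaust all level-preserving elements of W.\<close>

definition base :: "int set \<Rightarrow> fs sym set" where
  "base J = {h. wrel 1 h \<and> (\<forall>i f. i \<notin> J \<longrightarrow> loc h 1 i f \<cdot> 0 = 0)}"

lemma base_K: "wrel 1 h \<Longrightarrow> h \<in> K \<Longrightarrow> loc h 1 i f \<cdot> 0 = 0"
proof -
  assume h: "wrel 1 h" "h \<in> K"
  obtain d where d: "tri d h" "loc h d i f \<cdot> 0 = 0" using h(2) unfolding K_iff by blast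
  show ?thesis using d(2) unfolding tri_unique[OF d(1) wrel_tri[OF h(1)]] .
qed

lemma K_I: "wrel 1 h \<Longrightarrow> (\<And>i f. loc h 1 i f \<cdot> 0 = 0) \<Longrightarrow> h \<in> K"
  unfolding K_iff by (intro bexI[of _ 1]) (auto simp: wrel_def)

lemma loc_mult1: "wrel 1 h \<Longrightarrow> wrel 1 k \<Longrightarrow> loc (h * k) 1 i f = loc h 1 i (k \<cdot> f) * loc k 1 i f"
  using loc_mult[of 1 h 1 k i f] by (simp add: wrel_tri)

lemma loc_ginv1: "wrel 1 h \<Longrightarrow> loc (ginv h) 1 i f = ginv (loc h 1 i (ginv h \<cdot> f))"
  using loc_ginv'[of 1 h i f] by (simp add: wrel_tri)

lemma ginv_fix_zero: "p \<cdot> x = x \<Longrightarrow> ginv p \<cdot> x = x"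
  by (metis ginv_app)

lemma wrel_mult1: "wrel 1 h \<Longrightarrow> wrel 1 k \<Longrightarrow> wrel 1 (h * k)"
  using wrel_mult[of 1 h 1 k] by simp

lemma wrel_ginv1: "wrel 1 h \<Longrightarrow> wrel 1 (ginv h)"
  using wrel_ginv[of 1 h] by simp

lemma sgp_base: "sgp (base J)"
proof (rule sgpI)
  show "1 \<in> base J" by (simp add: base_def wrel_one)
  show "x * y \<in> base J" if "x \<in> base J" "y \<in> base J" for x y
    using that by (simp add: base_def wrel_mult1 loc_mult1)
  show "ginv x \<in> base J" if "x \<in> base J" for x
    using that by (simp add: base_def wrel_ginv1 loc_ginv1 ginv_fix_zero)
qed

lemma relopen_base:
  assumes "J \<subseteq> I" shows "relopen NW (base I) (base J)"
  unfolding relopen_def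
proof (intro conjI)
  show "base J \<subseteq> base I" using assms by (auto simp: base_def)
  have "base I \<inter> K \<subseteq> base J" using base_K by (auto simp: base_def)
  then show "\<exists>n\<in>NW. base I \<inter> n \<subseteq> base J" using W.U_base by blast
qed (rule sgp_base)

text \<open>These subgroups are relatively open in \<open>base UNIV\<close>, which is open in W
  because elements of K fixing \<open>upd 0 1 0\<close> preserve all levels.\<close>

lemma closed_base: "W.closed_sgp (base J)"
proof -
  have "relopen NW W (base UNIV)"
    unfolding relopen_def
  proof (intro conjI)
    show "base UNIV \<subseteq> W" using wrel_W by (auto simp: base_def)
    have "W \<inter> (K \<inter> fix_pts {upd 0 1 0}) \<subseteq> base UNIV"
    proof
      fix h assume "h \<in> W \<inter> (K \<inter> fix_pts {upd 0 1 0})"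
      then have h: "h \<in> K" "h \<cdot> upd 0 1 0 = upd 0 1 0" by (auto simp: fix_pts_def)
      have "bad h 1 = {}" using bad_empty_iff[OF K_fix_level(1)[OF h]] K_fix_level(3)[OF h] by simp
      then show "h \<in> base UNIV" using K_fix_level[OF h] by (simp add: base_def wrel_def)
    qed
    then show "\<exists>n\<in>NW. W \<inter> n \<subseteq> base UNIV" using NW_I[of "{upd 0 1 0}"] by blast
  qed (rule sgp_base)
  then have "W.closed_sgp (base UNIV)" by (rule W.closed_sgp_relopen[OF W.closed_sgp_self])
  then show ?thesis by (rule W.closed_sgp_relopen[OF _ relopen_base]) simp
qed

lemma conthom_cut: "conthom (cut j) (base J) NW NW"
  unfolding conthom_def
proof (intro conjI ballI)
  show "cut j (x * y) = cut j x * cut j y" if "x \<in> base J" "y \<in> base J" for x y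
    using that by (simp add: base_def cut_mult wrel_tri)
  fix m assume m: "m \<in> NW"
  then obtain F where F: "finite F" "m = K \<inter> fix_pts F" by (auto simp: NW_def)
  have "cut j h \<in> m" if h: "h \<in> base J" "h \<in> m" for h
  proof -
    have w: "wrel 1 h" "tri 1 h" "h \<in> K" using h by (auto simp: base_def wrel_tri F(2))
    have "cut j h \<in> K" by (rule K_I[OF wrel_cut[OF w(1)]]) (simp add: loc_cut[OF w(2)] base_K[OF w(1,3)])
    moreover have "cut j h \<cdot> f = f" if "f \<in> F" for f
    proof -
      have "h \<cdot> f = f" using h(2) that by (auto simp: F(2) fix_pts_def)
      then show ?thesis by (intro poly_mapping_eqI) (simp add: cut_app[OF w(2)])
    qed
    ultimately show ?thesis by (simp add: F(2) fix_pts_def)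
  qed
  then show "\<exists>n\<in>NW. cut j ` (base J \<inter> n) \<subseteq> m" using m by blast
qed (rule sgp_base)

lemma conthom_id: "sgp C \<Longrightarrow> conthom (\<lambda>x. x) C N N"
  by (auto simp: conthom_def)

lemma cut_base: "h \<in> base J \<Longrightarrow> cut j h \<in> base (J - {j})"
  by (auto simp: base_def wrel_cut loc_cut wrel_tri)

lemma cut_cut: assumes h: "tri 1 h" shows "cut j (cut j h) = cut j h"
  by (rule sym_eqI, rule poly_mapping_eqI) (simp add: cut_app[OF h] cut_app[OF tri_cut[OF h]])

text \<open>The kernel of \<open>cut j\<close> on \<open>base J\<close>, for minimal \<open>j\<close>, and its subgroups where the local action on
  level \<open>j\<close> is unrestricted only at the vertices in \<open>F\<close>.\<close>

definition layer :: "int set \<Rightarrow> int \<Rightarrow> fs set \<Rightarrow> fs sym set" where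
  "layer J j F = {h \<in> base J. cut j h = 1 \<and> (\<forall>f. trunc j f \<notin> F \<longrightarrow> loc h 1 j f \<cdot> 0 = 0)}"

text \<open>Elements of the kernel fix all coordinates that are not at or below j, hence every
  vertex on level j. This is why the local action at such a vertex becomes a homomorphism.\<close>

lemma cut_kernel_trunc:
  assumes h: "tri 1 h" "cut j h = 1" shows "trunc j (h \<cdot> f) = trunc j f"
proof -
  have "lookup (h \<cdot> f) i = lookup f i" if "\<not> le3 i j" for i
  proof -
    have "lookup (cut j h \<cdot> f) i = lookup (h \<cdot> f) i" using that by (simp add: cut_app[OF h(1)])
    then show ?thesis using h(2) by simp
  qed
  moreover have "\<not> le3 k j" if "lt3 j k" for k using that le3_antisym by (auto simp: lt3_def)
  ultimately show ?thesis by (simp add: trunc_eq_iff)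
qed

lemma layer_wrel: "h \<in> layer J j F \<Longrightarrow> wrel 1 h"
  by (simp add: layer_def base_def)

lemma layer_loc_mult:
  assumes "h \<in> layer J j F" "k \<in> layer J j F'" shows "loc (h * k) 1 j f = loc h 1 j f * loc k 1 j f"
proof -
  have w: "wrel 1 h" "wrel 1 k" "cut j k = 1" using assms by (auto simp: layer_def base_def)
  have "loc h 1 j (k \<cdot> f) = loc h 1 j f"
    by (rule loc_trunc[OF wrel_tri[OF w(1)]]) (rule cut_kernel_trunc[OF wrel_tri[OF w(2)] w(3)])
  then show ?thesis by (simp add: loc_mult1 w)
qed

lemma sgp_layer: "sgp (layer J j F)"
proof (rule sgpI)
  show "1 \<in> layer J j F" using sgp_one[OF sgp_base] by (simp add: layer_def cut_one)
  show "x * y \<in> layer J j F" if "x \<in> layer J j F" "y \<in> layer J j F" for x y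
    using that layer_loc_mult[OF that] sgp_mult[OF sgp_base, of x J y]
    by (auto simp: layer_def base_def cut_mult wrel_tri)
  show "ginv x \<in> layer J j F" if x: "x \<in> layer J j F" for x
  proof -
    have xb: "x \<in> base J" "cut j x = 1" "wrel 1 x" using x by (auto simp: layer_def base_def)
    have "cut j (ginv x) = 1" using conthom_ginv[OF conthom_cut xb(1)] xb(2) by simp
    moreover have "loc (ginv x) 1 j f \<cdot> 0 = 0" if "trunc j f \<notin> F" for f
    proof -
      have "trunc j (ginv x \<cdot> f) = trunc j f"
        by (rule cut_kernel_trunc[OF wrel_tri[OF wrel_ginv1[OF xb(3)]] calculation])
      then have "loc x 1 j (ginv x \<cdot> f) \<cdot> 0 = 0" using x that by (simp add: layer_def)
      then show ?thesis by (simp add: loc_ginv1[OF xb(3)] ginv_fix_zero)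
    qed
    ultimately show ?thesis using sgp_ginv[OF sgp_base xb(1)] by (simp add: layer_def)
  qed
qed

lemma relopen_layer: assumes "F \<subseteq> F'" shows "relopen NW (layer J j F') (layer J j F)"
  unfolding relopen_def
proof (intro conjI)
  show "layer J j F \<subseteq> layer J j F'" using assms by (auto simp: layer_def)
  have "layer J j F' \<inter> K \<subseteq> layer J j F" using base_K by (auto simp: layer_def base_def)
  then show "\<exists>n\<in>NW. layer J j F' \<inter> n \<subseteq> layer J j F" using W.U_base by blast
qed (rule sgp_layer)

lemma closed_layer: "W.closed_sgp (layer J j F)"
proof -
  have "{h \<in> base J. cut j h = 1} = layer J j UNIV" by (auto simp: layer_def)
  moreover have "W.closed_sgp {h \<in> base J. cut j h = 1}"
  proof (rule W.closed_sgp_equalizer[OF closed_base filter_base_NW sgp_base[of "J - {j}"]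
        W.Hausdorff_closed_sgp[OF closed_base] conthom_cut _ W.conthom_trivial[OF sgp_base filter_base_NW]])
    show "cut j ` base J \<subseteq> base (J - {j})" using cut_base by blast
  qed (simp add: sgp_one[OF sgp_base] image_subset_iff)
  ultimately have "W.closed_sgp (layer J j UNIV)" by simp
  then show ?thesis by (rule W.closed_sgp_relopen[OF _ relopen_layer]) simp
qed

lemma root_layer:
  assumes g: "g \<in> G" and j: "j \<in> J" and v: "v \<in> F" shows "root j v g \<in> layer J j F"
proof -
  have "cut j (root j v g) = 1"
    by (rule sym_eqI, rule poly_mapping_eqI) (auto simp: cut_app[OF tri_root] root_app)
  then show ?thesis
    using wrel_root[OF g] j v by (auto simp: layer_def base_def loc_root)
qed

lemma topological_group_G: "topological_group (TG perm_base G)"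
  by (rule filtered_group.topological_group_TG[OF filtered_group_perm_base[OF sgp_G]])

text \<open>Adding one vertex v to F is a split extension by G: the local action at v maps onto G
  with section \<open>root j v\<close>, and its kernel lies in the layer for F.\<close>

lemma good_layer:
  assumes j: "j \<in> J" "\<And>i. i \<in> J \<Longrightarrow> \<not> lt3 i j" and F: "finite F" shows "W.good (layer J j F)"
  using F
proof (induction F rule: finite_induct)
  case empty
  \<comment> \<open>Local actions fix 0 on level j since no exceptional vertices are left, below j
    since no such level belongs to J, and elsewhere since the cut is trivial.\<close>
  have "layer J j {} \<subseteq> K"
  proof
    fix h assume h: "h \<in> layer J j {}"
    have w: "wrel 1 h" "cut j h = 1" using h by (auto simp: layer_def base_def)
    show "h \<in> K"
    proof (rule K_I[OF w(1)])
      fix i f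
      consider "i = j" | "lt3 i j" | "\<not> le3 i j" by (auto simp: lt3_def)
      then show "loc h 1 i f \<cdot> 0 = 0"
      proof cases
        case 1
        then show ?thesis using h by (simp add: layer_def)
      next
        case 2
        then have "i \<notin> J" using j(2) by blast
        then show ?thesis using h by (simp add: layer_def base_def)
      next
        case 3
        then have "loc h 1 i f = loc (cut j h) 1 i f" by (simp add: loc_cut[OF wrel_tri[OF w(1)]])
        then show ?thesis using w(2) by simp
      qed
    qed
  qed
  then show ?case by (rule W.good_compact[OF closed_layer])
next
  case (insert v F)
  show ?case
  proof (cases "trunc j v = v")
    case False
    then have "trunc j f \<noteq> v" for f by (metis trunc_trunc)
    then have "layer J j (insert v F) = layer J j F" by (auto simp: layer_def)
    then show ?thesis using insert by simp
  next
    case True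
    let ?C = "layer J j (insert v F)" and ?\<phi> = "\<lambda>h. loc h 1 j v"
    have \<phi>: "conthom ?\<phi> ?C NW perm_base"
      unfolding conthom_def
    proof (intro conjI ballI)
      fix m :: "nat sym set" assume "m \<in> perm_base"
      then obtain E where E: "finite E" "m = fix_pts E" by (auto simp: perm_base_def)
      have "loc h 1 j v \<in> m" if h: "h \<in> ?C \<inter> (K \<inter> fix_pts ((\<lambda>x. upd j x v) ` E))" for h
      proof -
        have "tri 1 h" using h wrel_tri[OF layer_wrel] by blast
        then show ?thesis using h by (simp add: E(2) fix_pts_def loc_app)
      qed
      then show "\<exists>n\<in>NW. ?\<phi> ` (?C \<inter> n) \<subseteq> m" using NW_I[OF finite_imageI[OF E(1)]] by blast
    qed (auto simp: layer_loc_mult sgp_layer)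
    have im: "?\<phi> ` ?C \<subseteq> G" using wrel_loc[OF layer_wrel] by blast
    have sub: "{h \<in> ?C. ?\<phi> h = 1} \<subseteq> layer J j F"
    proof (clarsimp simp: layer_def)
      fix h f assume h: "h \<in> base J" "loc h 1 j v = 1" "trunc j f \<notin> F"
        "\<forall>f. trunc j f \<noteq> v \<and> trunc j f \<notin> F \<longrightarrow> loc h 1 j f \<cdot> 0 = 0"
      show "loc h 1 j f \<cdot> 0 = 0"
      proof (cases "trunc j f = v")
        case True
        then have "trunc j f = trunc j v" using trunc_trunc[of j f] by simp
        then have "loc h 1 j f = loc h 1 j v" using h(1) by (intro loc_trunc) (auto simp: base_def wrel_tri)
        then show ?thesis using h(2) by simp
      qed (use h in blast)
    qed
    have "Hausdorff_space (group_topology perm_base G)"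
      using iso_elementary_imp_Hausdorff[OF iso_elementary_G] by simp
    then have "W.closed_sgp {h \<in> ?C. ?\<phi> h = 1}"
      using im sgp_one[OF sgp_G]
      by (intro W.closed_sgp_equalizer[OF closed_layer filter_base_perm_base sgp_G _ \<phi>]
          W.conthom_trivial[OF sgp_layer filter_base_perm_base]) auto
    then have ker: "W.good {h \<in> ?C. ?\<phi> h = 1}"
      by (rule W.good_subset[OF insert.IH closed_layer _ sub])
    show ?thesis
    proof (rule W.good_extension[OF closed_layer filter_base_perm_base sgp_G topological_group_G
          iso_elementary_G wfr_G \<phi> im conthom_root _ _ ker])
      show "root j v ` G \<subseteq> ?C" using root_layer[OF _ j(1), of _ v "insert v F"] by blast
      show "loc (root j v q) 1 j v = q" if "q \<in> G" for q using True by (simp add: loc_root)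
    qed
  qed
qed

text \<open>Cutting at the lowest level j splits \<open>base J\<close> into a part on fewer levels
  and the kernel. The kernel is the increasing union of layers over finite sets of vertices.\<close>

lemma good_base: assumes "finite J" shows "W.good (base J)"
  using assms
proof (induction "card J" arbitrary: J rule: less_induct)
  case less
  show ?case
  proof (cases "J = {}")
    case True
    have "base {} \<subseteq> K" by (auto simp: base_def intro: K_I)
    then show ?thesis unfolding True by (rule W.good_compact[OF closed_base])
  next
    case False
    define j where "j = Min J"
    have j: "j \<in> J" "\<not> lt3 i j" if "i \<in> J" for i
      using Min_in[OF less.prems False] Min_le[OF less.prems that] by (simp_all add: j_def lt3_def le3_iff del: Min_in)
    have jJ: "j \<in> J" using False less.prems by (simp add: j_def)
    have "card (J - {j}) < card J" using jJ less.prems by (intro psubset_card_mono) auto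
    then have g: "W.good (base (J - {j}))" using less.hyps less.prems by blast
    \<comment> \<open>The image of the cut, described as its fixed points: this makes it closed and
      lets the inclusion serve as section.\<close>
    let ?Q = "{q \<in> base (J - {j}). cut j q = q}"
    have cQ: "W.closed_sgp ?Q"
    proof (rule W.closed_sgp_equalizer[OF closed_base filter_base_NW sgp_base[of "J - {j}"]
          W.Hausdorff_closed_sgp[OF closed_base] conthom_cut _ conthom_id[OF sgp_base]])
      show "cut j ` base (J - {j}) \<subseteq> base (J - {j})" using cut_base[of _ "J - {j}" j] by auto
    qed simp
    have gQ: "W.good ?Q" by (rule W.good_subset[OF g closed_base cQ]) blast
    have Q: "sgp ?Q" "?Q \<subseteq> W" using cQ by (auto simp: W.closed_sgp_def)
    have lay: "{h \<in> base J. cut j h = 1} = layer J j UNIV" by (auto simp: layer_def)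
    have "W.good (layer J j UNIV)"
    proof (rule W.good_chain_union[OF closed_layer])
      let ?F = "\<lambda>m :: nat. from_nat_into (UNIV :: fs set) ` {..<m}"
      show "relopen NW (layer J j UNIV) (layer J j (?F m))" for m by (rule relopen_layer) simp
      show "layer J j (?F m) \<subseteq> layer J j (?F (Suc m))" for m
        unfolding layer_def by (auto simp: lessThan_Suc)
      show "W.good (layer J j (?F m))" for m using j by (intro good_layer[OF jJ]) auto
      have "h \<in> (\<Union>m. layer J j (?F m))" if h: "h \<in> layer J j UNIV" for h
      proof -
        have w: "wrel 1 h" "tri 1 h" using layer_wrel[OF h] wrel_tri by blast+
        have fin: "finite (snd ` bad h 1)" using w(1) by (simp add: wrel_def)
        have "snd ` bad h 1 \<subseteq> (\<Union>m. ?F m)"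
        proof
          fix f assume "f \<in> snd ` bad h 1"
          have "f = from_nat_into UNIV (to_nat_on UNIV f)"
            using from_nat_into_to_nat_on[OF countable_fs, of f] by simp
          then show "f \<in> (\<Union>m. ?F m)" by (intro UN_I[of "Suc (to_nat_on UNIV f)"] UNIV_I image_eqI) auto
        qed
        then obtain m where m: "snd ` bad h 1 \<subseteq> ?F m"
          using finite_subset_of_chain[OF fin, of ?F] by (auto simp: lessThan_Suc)
        have "loc h 1 j f \<cdot> 0 = 0" if "trunc j f \<notin> ?F m" for f
          using m that trunc_mem_bad_iff[OF w(2), of j f] by force
        then show ?thesis using h by (auto simp: layer_def)
      qed
      then show "(\<Union>m. layer J j (?F m)) = layer J j UNIV" by (auto simp: layer_def)
    qed
    then have ker: "W.good {h \<in> base J. cut j h = 1}" unfolding lay .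
    show ?thesis
    proof (rule W.good_extension[OF closed_base filter_base_NW Q(1) W.topological_group_TG_subset[OF Q] _ _
          conthom_cut _ conthom_id[OF Q(1)] _ _ ker])
      show "iso_elementary (TG NW ?Q)" "wfr NW ?Q" using gQ by (auto simp: W.good_def)
      show "cut j ` base J \<subseteq> ?Q" using cut_base by (auto simp: base_def cut_cut wrel_tri)
      show "(\<lambda>x. x) ` ?Q \<subseteq> base J" by (auto simp: base_def)
      show "cut j q = q" if "q \<in> ?Q" for q using that by simp
    qed
  qed
qed

lemma good_base_UNIV: "W.good (base UNIV)"
proof (rule W.good_chain_union[OF closed_base])
  let ?J = "\<lambda>m :: nat. {- int m..int m}"
  show "relopen NW (base UNIV) (base (?J m))" for m by (rule relopen_base) simp
  show "base (?J m) \<subseteq> base (?J (Suc m))" for m by (auto simp: base_def)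
  show "W.good (base (?J m))" for m by (rule good_base) simp
  have "h \<in> (\<Union>m. base (?J m))" if h: "h \<in> base UNIV" for h
  proof -
    have w: "wrel 1 h" "tri 1 h" using h by (auto simp: base_def wrel_tri)
    have fin: "finite (fst ` bad h 1)" using w(1) by (simp add: wrel_def)
    have "fst ` bad h 1 \<subseteq> (\<Union>m. ?J m)"
    proof
      fix i assume "i \<in> fst ` bad h 1"
      show "i \<in> (\<Union>m. ?J m)" by (rule UN_I[of "nat \<bar>i\<bar>"]) auto
    qed
    then obtain m where m: "fst ` bad h 1 \<subseteq> ?J m"
      using finite_subset_of_chain[OF fin, of ?J] by auto
    have "loc h 1 i f \<cdot> 0 = 0" if "i \<notin> ?J m" for i f
      using m that trunc_mem_bad_iff[OF w(2), of i f] by force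
    then show ?thesis using w by (auto simp: base_def)
  qed
  then show "(\<Union>m. base (?J m)) = base UNIV" by (auto simp: base_def)
qed

end

section \<open>The affine group as initial stage\<close>

definition ND :: "int sym set set" where
  "ND = {{1}, {1, refl 0}}"

lemma refl_0_app: "refl 0 \<cdot> 0 = 1" "refl 0 \<cdot> 1 = 0"
  by (simp_all add: refl_app)

text \<open>Since {1} belongs to the base the topology is discrete; the other base member is the
  finite subgroup whose cosets are permuted in the initial stage.\<close>

interpretation aff: tdlc ND D "{1, refl 0}"
proof
  have s: "sgp {1, refl 0}" by (rule sgpI) (auto simp: ginv_refl)
  show "filter_base ND" using s sgp_trivial[where 'a = "int sym"] by (auto simp: filter_base_def ND_def)
  show "sgp D" by (rule sgp_D)
  show "{1, refl 0} \<in> ND" by (simp add: ND_def)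
  show "{1, refl 0} \<subseteq> D" using sgp_one[OF sgp_D] refl_in_D by simp
  have one: "1 \<in> n" if "n \<in> ND" for n using that by (auto simp: ND_def)
  show "\<exists>m\<in>ND. \<forall>k\<in>D \<inter> m. g * k * ginv g \<in> n" if "n \<in> ND" for g n
    using one[OF that] by (intro bexI[of _ "{1}"]) (auto simp: ND_def)
  show "\<exists>n\<in>ND. x \<notin> n" if "x \<noteq> 1" for x
    using that by (intro bexI[of _ "{1}"]) (auto simp: ND_def)
  show "\<exists>F. finite F \<and> F \<subseteq> {1, refl 0} \<and> (\<forall>u\<in>{1, refl 0}. \<exists>f\<in>F. ginv f * u \<in> n)" if "n \<in> ND" for n
  proof (intro exI[of _ "{1, refl 0}"] conjI ballI)
    show "\<exists>f\<in>{1, refl 0}. ginv f * u \<in> n" if "u \<in> {1, refl 0}" for u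
      using that one[OF \<open>n \<in> ND\<close>] by (intro bexI[of _ u]) auto
  qed auto
  show "\<exists>x\<in>{1, refl 0}. \<forall>n\<in>ND. \<exists>M. \<forall>m\<ge>M. ginv x * u m \<in> n"
    if u: "\<And>i. u i \<in> {1, refl 0}" and c: "\<And>n. n \<in> ND \<Longrightarrow> \<exists>M. \<forall>m\<ge>M. ginv (u M) * u m \<in> n"
    for u :: "nat \<Rightarrow> int sym"
  proof -
    obtain M where M: "\<forall>m\<ge>M. ginv (u M) * u m \<in> {1}" using c[of "{1}"] by (auto simp: ND_def)
    then have "\<exists>M. \<forall>m\<ge>M. ginv (u M') * u m \<in> n" if "n \<in> ND" "M' = M" for n M'
      using one[OF that(1)] that(2) by (intro exI[of _ M]) auto
    then show ?thesis using u by blast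
  qed
  show "\<exists>\<nu> :: nat \<Rightarrow> int sym set. (\<forall>i. \<nu> i \<in> ND) \<and> (\<forall>n\<in>ND. \<exists>i. \<nu> i \<subseteq> n)"
    using one by (intro exI[of _ "\<lambda>_. {1}"]) (auto simp: ND_def)
  show "\<exists>A. countable A \<and> A \<subseteq> D \<and> (\<forall>x\<in>D. \<exists>a\<in>A. ginv a * x \<in> {1, refl 0})"
    using countable_D by (intro exI[of _ D]) (auto intro!: bexI)
qed

lemma aff_good: "aff.good D"
  by (rule aff.good_discrete[OF _ countable_D]) (simp add: ND_def)

text \<open>The bound 1 is a single use of \<open>big_suc\<close> for D itself, which is finitely
  generated and has infinitely many cosets of a finite subgroup.\<close>

lemma stage_zero: "\<exists>G. stage G \<and> big_perm G 1"
proof (rule aff.stage_of_cosets[OF _ _ _ _ aff_good])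
  show inf: "infinite (lcoset {1, refl 0} ` D)"
  proof
    assume fin: "finite (lcoset {1, refl 0} ` D)"
    have "D \<subseteq> \<Union>(lcoset {1, refl 0} ` D)" by (auto simp: lcoset_def)
    moreover have "finite (\<Union>(lcoset {1, refl 0} ` D))" using fin by (auto simp: lcoset_def)
    ultimately have "finite ((\<lambda>d. d \<cdot> 0) ` D)" by (auto dest: finite_subset)
    moreover have "(\<lambda>d. d \<cdot> (0::int)) ` D = UNIV" using D_transitive by (auto simp: image_iff) metis
    ultimately show False by simp
  qed
  show cg: "cg ND D" unfolding D_def by (rule cg_gen_finite) simp
  show "big ND (lcoset {1, refl 0}) D 1"
    using big.big_suc[OF sgp_D order_refl cg inf big.big_zero] by simp
  show "V = D" if "sgp V" "V \<subseteq> D" "nrm V D" "{1, refl 0} \<subseteq> V" for V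
    using that by (intro D_normal_generation) auto
  show "\<exists>F. finite F \<and> F \<subseteq> D \<and> (\<forall>g\<in>D. (\<forall>a\<in>F. ginv a * g * a \<in> {1, refl 0}) \<longrightarrow> g \<in> n)" if "n \<in> ND" for n
  \<comment> \<open>The subgroup {1, refl 0} meets its conjugate by \<open>refl 1\<close> trivially:
    conjugating \<open>refl 0\<close> gives an element sending 0 to 2, whereas \<open>refl 0\<close>
    sends 0 to 1.\<close>
  proof (intro exI[of _ "{1, refl 1}"] conjI ballI impI)
    fix g assume *: "\<forall>a\<in>{1, refl 1}. ginv a * g * a \<in> {1, refl 0}"
    have "g \<noteq> refl 0"
    proof
      let ?r = "refl 1 * refl 0 * refl 1"
      assume "g = refl 0"
      then have "?r \<in> {1, refl 0}" using * by (simp add: ginv_refl)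
      then have "?r \<cdot> 0 \<in> {0, 1}"
        using refl_0_app(1) by (elim insertE) (simp_all del: mult_app)
      moreover have "?r \<cdot> 0 = 2" by (simp add: refl_app)
      ultimately show False by simp
    qed
    then show "g \<in> n" using * that by (auto simp: ND_def)
  qed (use sgp_one[OF sgp_D] refl_in_D in auto)
qed

section \<open>The inductive step and the conclusion\<close>

context stage
begin

text \<open>Passing to the level permutation maps W onto the discrete group D; \<open>shift\<close>
  is a section and the kernel is \<open>base UNIV\<close>.\<close>

lemma good_W: "W.good W"
proof -
  define dd where "dd h = (THE d. tri d h)" for h
  have dd: "dd h = d" if "tri d h" for h d
    unfolding dd_def using that tri_unique by blast
  have \<phi>: "conthom dd W NW ND"
    unfolding conthom_def
  proof (intro conjI ballI)
    show "dd (x * y) = dd x * dd y" if xy: "x \<in> W" "y \<in> W" for x y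
    proof -
      obtain d e where "tri d x" "tri e y" using xy by (auto simp: W_def wrel_def)
      then show ?thesis using tri_mult by (simp add: dd)
    qed
    fix m assume m: "m \<in> ND"
    have "dd k = 1" if "k \<in> W \<inter> (K \<inter> fix_pts {upd 0 1 0})" for k
      using that by (intro dd K_fix_level(1)) (auto simp: fix_pts_def)
    then have "dd ` (W \<inter> (K \<inter> fix_pts {upd 0 1 0})) \<subseteq> m" using m by (auto simp: ND_def)
    then show "\<exists>n\<in>NW. dd ` (W \<inter> n) \<subseteq> m" using NW_I[of "{upd 0 1 0}"] by blast
  qed (rule sgp_W)
  have s: "conthom shift D ND NW"
    unfolding conthom_def
  proof (intro conjI ballI)
    fix m assume "m \<in> NW"
    then have "shift ` (D \<inter> {1}) \<subseteq> m" using sgp_one[OF W.sgp_base] by (auto simp: shift_one)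
    then show "\<exists>n\<in>ND. shift ` (D \<inter> n) \<subseteq> m" by (intro bexI[of _ "{1}"]) (simp_all add: ND_def)
  qed (auto simp: shift_mult sgp_D)
  have ker: "{h \<in> W. dd h = 1} = base UNIV"
    using dd wrel_tri by (auto simp: W_def base_def) metis
  show ?thesis
  proof (rule W.good_extension[OF W.closed_sgp_self aff.filter_base sgp_D aff.topological_group_TG _ _ \<phi> _ s])
    show "iso_elementary (TG ND D)" "wfr ND D" using aff_good by (auto simp: aff.good_def)
    show "dd ` W \<subseteq> D" using dd[OF wrel_tri] tri_D[OF wrel_tri] by (auto simp: W_def)
    show "shift ` D \<subseteq> W" using wrel_W[OF wrel_shift] by blast
    show "dd (shift q) = q" if "q \<in> D" for q by (rule dd[OF tri_shift[OF that]])
    show "W.good {h \<in> W. dd h = 1}" unfolding ker by (rule good_base_UNIV)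
  qed
qed

lemma stage_Suc:
  assumes "big_perm G \<alpha>" shows "\<exists>G'. stage G' \<and> big_perm G' (osup (range (mult_nat_ord \<alpha>)))"
  using W.stage_of_cosets[OF W_small infinite_W_cosets cg_W W_normal_generation good_W big_W[OF assms]] .

end

lemma exists_stage: "\<exists>G. stage G \<and> big_perm G (omega_power n)"
proof (induction n)
  case 0
  show ?case using stage_zero by simp
next
  case (Suc n)
  then show ?case using stage.stage_Suc by fastforce
qed

theorem mainTheorem1:
  fixes n :: nat
  shows "\<exists>G :: nat set topgroup. elementary G \<and> compactly_generated G \<and> \<xi> G = \<omega> ^ n + 2"
proof -
  \<comment> \<open>One power more than asked for, so that \<omega> ^ n + 2 fits below the rank and
    the descent can start.\<close>
  obtain G where G: "stage G" "big_perm G (omega_power (Suc n))" using exists_stage by blast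
  interpret stage G by (rule G(1))
  note top = topspace_group_topology[OF filter_base_perm_base sgp_G]
  obtain H where H: "elementary H" "TG perm_base G \<cong>\<^sub>t H"
    using iso_elementary_G by (auto simp: iso_elementary_def)
  have tH: "topological_group H" using H(1) by (rule elementary_imp_topological_group)
  obtain f where f: "f \<in> iso (TG perm_base G) H" "homeomorphic_map (group_topology perm_base G) (topol H) f"
    using H(2) by (auto simp: topgroup_iso_def)
  obtain g where g: "g \<in> iso H (TG perm_base G)" "homeomorphic_map (topol H) (group_topology perm_base G) g"
    using topgroup_iso_sym[OF topological_group_G topspace_topological_group[OF tH] H(2)]
    by (auto simp: topgroup_iso_def)
  obtain V where V: "sgp V" "V \<subseteq> G" "openin (group_topology perm_base G) V"
    "compactin (group_topology perm_base G) V"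
    using compact_open by blast
  \<comment> \<open>Existence of some rank is all that well-foundedness gives. The value \<beta>
    stays unknown and is only bounded below.\<close>
  have "\<exists>\<beta>. has_rank H \<beta>"
  proof (rule wfr_imp_has_rank[OF wfr_G filter_base_perm_base sgp_G H(1)])
    show "cont_embedding g H (TG perm_base G)"
      using g by (auto simp: cont_embedding_def iso_def bij_betw_def homeomorphic_imp_continuous_map)
    show "subgroup (f ` V) H"
      by (rule subgroup_iso_image[OF group_TG[OF sgp_G] topological_group_group[OF tH] f(1)])
        (simp add: subgroup_TG_iff[OF sgp_G] V)
    show "openin (topol H) (f ` V)" using homeomorphic_map_openness[OF f(2)] V top by simp
    show "compactin (topol H) (f ` V)"
      by (rule image_compactin[OF V(4) homeomorphic_imp_continuous_map[OF f(2)]])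
  qed
  then obtain \<beta> where \<beta>: "has_rank H \<beta>" ..
  have "omega_power (Suc n) \<le> \<beta>"
  proof (rule big_imp_le_rank[OF G(2) filter_base_perm_base sgp_G _ \<beta>])
    show "cont_embedding f (TG perm_base G) H"
      using f by (auto simp: cont_embedding_def iso_def bij_betw_def homeomorphic_imp_continuous_map)
  qed
  moreover have "\<omega> ^ n + 2 \<le> omega_power n + 2" by (rule add_left_mono_countable_ord[OF power_omega_le])
  ultimately have "\<omega> ^ n + 2 \<le> \<beta>" by (rule order_trans[OF order_trans[OF _ omega_power_add_two_le], rotated])
  moreover have two: "\<omega> ^ n + 2 = \<omega> ^ n + 1 + 1" by (simp add: add.assoc flip: one_add_one)
  ultimately show ?thesis
    using exists_compactly_generated_of_rank[OF \<beta>, of "\<omega> ^ n"] power_omega_pos by simp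
qed

end
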